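(* Let $k$ be a field, $X$ a finite set, $\Gamma=\Gamma(X)$ the free group on $X$, and fix a total order $<$ on $\Gamma$ compatible with the group structure. Every $*$-rational Malcev–Neumann series $a\in k(\!(\Gamma)\!)$ over $\Gamma$ has an equivalent $*$-rational expression without simplification, and this expression is effectively computable: there is an algorithm which, given a $*$-rational expression for $a$ over $k(\!(\Gamma)\!)$, outputs a $*$-rational expression without simplification representing the same series $a$.
   Context: **Series.** $k\Gamma$ is the vector space with basis $\Gamma$; $k^\Gamma$ is the space of all formal series $a=\sum_{\omega\in\Gamma}(a,\omega)\omega$; the support of $a$ is $\operatorname{supp}(a)=\{\omega:(a,\omega)\ne0\}$. The Cauchy product $ab$ is well-defined if for every $\omega$ the sum $(ab,\omega)=\sum_{\alpha\beta=\omega}(a,\alpha)(b,\beta)$ has only finitely many nonzero terms. The star $a^*=1+a+a^2+\cdots$ is well-defined if for every $\omega$ there are only finitely many tuples $(\omega_1,\dots,\omega_n)$ (any $n$) with $\omega_1\cdots\omega_n=\omega$ and $(a,\omega_1)\cdots(a,\omega_n)\ne0$. **Malcev–Neumann series.** The order is compatible with the group structure: $\alpha<\beta$ implies $\upsilon\alpha\upsilon'<\upsilon\beta\upsilon'$ for all $\upsilon,\upsilon'\in\Gamma$. $k(\!(\Gamma)\!)\subseteq k^\Gamma$ is the set of series with well-ordered support (every nonempty subset of the support has a minimum); it is a skew field. A $*$-rational expression over $k(\!(\Gamma)\!)$ is an expression built from elements of $k\Gamma$ by finitely many operations $+$, Cauchy product, and star, the star being applied only to subexpressions representing Malcev–Neumann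 series whose support lies in $\{\omega\in\Gamma:\omega>1\}$; a $*$-rational Malcev–Neumann series is one represented by such an expression. (Inverses are regarded as already rewritten via stars: if $a=a_{\mathrm o}\omega_{\mathrm o}+\sum_{\omega>\omega_{\mathrm o}}a_\omega\omega$ with $a_{\mathrm o}\neq 0$, then $a^{-1}=a_{\mathrm o}^{-1}\omega_{\mathrm o}^{-1}\big[\sum_{\omega>\omega_{\mathrm o}}(-a_\omega a_{\mathrm o}^{-1})\,\omega\omega_{\mathrm o}^{-1}\big]^*$.) **Expressions without simplification.** A $*$-rational expression in $k^\Gamma$ is one built from elements of $k\Gamma$ by finitely many $+$, Cauchy products and stars, all of them well-defined. Let $\ell(\omega)$ be the reduced length of $\omega\in\Gamma$. Expressions without simplification are defined recursively: a linear combination of monomials of $k\Gamma$, each written as a reduced word, is one; if $a,b$ are expressions without simplification then so is $a+b$; the product $a\cdot b$ of two expressions without simplification is one if $\ell(\alpha\beta)=\ell(\alpha)+\ell(\beta)$ for all $\alpha\in\operatorname{supp}(a)$ and $\beta\in\operatorname{supp}(b)$; if $a$ is one and $a^*$ is well-defined, then $a^*$ is one if and only if $a\cdot a$ is one. Two expressions are equivalent if they represent the same series. **Effectivity.** "Effectively computable" means computable by an algorithm that may perform exact arithmetic and equality tests in $k$. *)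

theory Defs
  imports "HOL-Algebra.Group"
begin

section \<open>The free group\<close>

text \<open>The letter \<open>(x, True)\<close> stands for \<open>x\<close>, and \<open>(x, False)\<close> for its formal inverse. The elements
  of the free group are the reduced words, so that the reduced length is just \<open>length\<close>.\<close>

type_synonym 'x letter = "'x \<times> bool"
type_synonym 'x word = "'x letter list"

definition inv_letter :: "'x letter \<Rightarrow> 'x letter" where
  "inv_letter a = (fst a, \<not> snd a)"

definition reduced :: "'x word \<Rightarrow> bool" where
  "reduced w \<longleftrightarrow> successively (\<lambda>a b. b \<noteq> inv_letter a) w"

fun push :: "'x letter \<Rightarrow> 'x word \<Rightarrow> 'x word" where
  "push a [] = [a]"
| "push a (b # w) = (if b = inv_letter a then w else a # b # w)"

definition free_group :: "'x set \<Rightarrow> 'x word monoid" where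
  "free_group X = \<lparr>carrier = {w. reduced w \<and> fst ` set w \<subseteq> X},
                   mult = (\<lambda>u v. foldr push u v), one = []\<rparr>"

lemma inv_letter_inv [simp]: "inv_letter (inv_letter a) = a"
  by (simp add: inv_letter_def)

lemma fst_inv_letter [simp]: "fst (inv_letter a) = fst a"
  by (simp add: inv_letter_def)

lemma reduced_Nil [simp]: "reduced []"
  by (simp add: reduced_def)

lemma reduced_Cons:
  "reduced (a # w) \<longleftrightarrow> reduced w \<and> (w = [] \<or> hd w \<noteq> inv_letter a)"
  by (cases w) (auto simp: reduced_def)

lemma reduced_push: "reduced w \<Longrightarrow> reduced (push a w)"
  by (cases w) (auto simp: reduced_Cons)

lemma reduced_foldr_push: "reduced v \<Longrightarrow> reduced (foldr push u v)"
  by (induction u) (auto simp: reduced_push)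

lemma push_reduced: "reduced (a # w) \<Longrightarrow> push a w = a # w"
  by (cases w) (auto simp: reduced_Cons)

lemma push_inv_push: "reduced w \<Longrightarrow> push a (push (inv_letter a) w) = w"
  by (cases w) (auto simp: reduced_Cons push_reduced)

lemma set_push: "set (push a w) \<subseteq> insert a (set w)"
  by (cases w) auto

lemma set_foldr_push: "set (foldr push u v) \<subseteq> set u \<union> set v"
proof (induction u)
  case (Cons a u)
  then show ?case using set_push[of a "foldr push u v"] by auto
qed simp

lemma foldr_push_push:
  assumes "reduced v" "reduced w"
  shows "foldr push (push a v) w = push a (foldr push v w)"
proof (cases v)
  case (Cons b v')
  show ?thesis
  proof (cases "b = inv_letter a")
    case True
    then show ?thesis
      using Cons push_inv_push[OF reduced_foldr_push[OF assms(2)]] by simp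
  qed (use Cons in simp)
qed simp

lemma foldr_push_assoc:
  assumes "reduced v" "reduced w"
  shows "foldr push (foldr push u v) w = foldr push u (foldr push v w)"
  by (induction u) (simp_all add: foldr_push_push reduced_foldr_push assms)

lemma foldr_push_Nil: "reduced u \<Longrightarrow> foldr push u [] = u"
  by (induction u) (auto simp: reduced_Cons push_reduced)

lemma foldr_push_inverse:
  "reduced w \<Longrightarrow> foldr push (rev (map inv_letter w)) w = []"
  by (induction w) (auto simp: reduced_Cons)

lemma reduced_inverse: "reduced w \<Longrightarrow> reduced (rev (map inv_letter w))"
proof -
  assume "reduced w"
  then have "successively (\<lambda>a b. inv_letter a \<noteq> b) w"
    unfolding reduced_def by (rule successively_mono) auto
  then show ?thesis
    unfolding reduced_def by (auto simp: successively_map elim: successively_mono)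
qed

lemma group_free_group: "group (free_group X)"
proof (rule groupI)
  fix x y assume "x \<in> carrier (free_group X)" "y \<in> carrier (free_group X)"
  then show "x \<otimes>\<^bsub>free_group X\<^esub> y \<in> carrier (free_group X)"
    using set_foldr_push[of x y] by (fastforce simp: free_group_def reduced_foldr_push)
next
  fix x assume x: "x \<in> carrier (free_group X)"
  then have "rev (map inv_letter x) \<in> carrier (free_group X)"
    by (auto simp: free_group_def reduced_inverse)
  moreover have "rev (map inv_letter x) \<otimes>\<^bsub>free_group X\<^esub> x = \<one>\<^bsub>free_group X\<^esub>"
    using x by (simp add: free_group_def foldr_push_inverse)
  ultimately show "\<exists>y\<in>carrier (free_group X). y \<otimes>\<^bsub>free_group X\<^esub> x = \<one>\<^bsub>free_group X\<^esub>"
    by blast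
qed (auto simp: free_group_def foldr_push_assoc)


section \<open>Series\<close>

text \<open>A series over \<open>G\<close> is a function vanishing outside \<open>carrier G\<close>.\<close>

definition supp :: "('g \<Rightarrow> 'k::zero) \<Rightarrow> 'g set" where
  "supp a = {w. a w \<noteq> 0}"

definition series :: "'g monoid \<Rightarrow> ('g \<Rightarrow> 'k::zero) set" where
  "series G = {a. supp a \<subseteq> carrier G}"

definition cauchy_terms ::
  "'g monoid \<Rightarrow> ('g \<Rightarrow> 'k::field) \<Rightarrow> ('g \<Rightarrow> 'k) \<Rightarrow> 'g \<Rightarrow> ('g \<times> 'g) set" where
  "cauchy_terms G a b w = {(u, v). u \<in> carrier G \<and> v \<in> carrier G \<and> u \<otimes>\<^bsub>G\<^esub> v = w \<and> a u * b v \<noteq> 0}"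

definition cauchy_defined :: "'g monoid \<Rightarrow> ('g \<Rightarrow> 'k::field) \<Rightarrow> ('g \<Rightarrow> 'k) \<Rightarrow> bool" where
  "cauchy_defined G a b \<longleftrightarrow> (\<forall>w. finite (cauchy_terms G a b w))"

definition cauchy :: "'g monoid \<Rightarrow> ('g \<Rightarrow> 'k::field) \<Rightarrow> ('g \<Rightarrow> 'k) \<Rightarrow> 'g \<Rightarrow> 'k" where
  "cauchy G a b w = (\<Sum>(u, v)\<in>cauchy_terms G a b w. a u * b v)"

text \<open>The empty tuple contributes the term \<open>1\<close> of the star.\<close>

definition star_terms :: "'g monoid \<Rightarrow> ('g \<Rightarrow> 'k::field) \<Rightarrow> 'g \<Rightarrow> 'g list set" where
  "star_terms G a w =
    {us. set us \<subseteq> carrier G \<and> foldr (mult G) us \<one>\<^bsub>G\<^esub> = w \<and> prod_list (map a us) \<noteq> 0}"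

definition star_defined :: "'g monoid \<Rightarrow> ('g \<Rightarrow> 'k::field) \<Rightarrow> bool" where
  "star_defined G a \<longleftrightarrow> (\<forall>w. finite (star_terms G a w))"

definition star :: "'g monoid \<Rightarrow> ('g \<Rightarrow> 'k::field) \<Rightarrow> 'g \<Rightarrow> 'k" where
  "star G a w = (\<Sum>us\<in>star_terms G a w. prod_list (map a us))"


section \<open>Malcev-Neumann series\<close>

definition compatible_order :: "'g monoid \<Rightarrow> 'g rel \<Rightarrow> bool" where
  "compatible_order G r \<longleftrightarrow>
    strict_linear_order_on (carrier G) r \<and>
    (\<forall>a\<in>carrier G. \<forall>b\<in>carrier G. \<forall>u\<in>carrier G. \<forall>v\<in>carrier G.
       (a, b) \<in> r \<longrightarrow> (u \<otimes>\<^bsub>G\<^esub> a \<otimes>\<^bsub>G\<^esub> v, u \<otimes>\<^bsub>G\<^esub> b \<otimes>\<^bsub>G\<^esub> v) \<in> r)"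

definition malcev_neumann :: "'g monoid \<Rightarrow> 'g rel \<Rightarrow> ('g \<Rightarrow> 'k::zero) set" where
  "malcev_neumann G r =
    {a \<in> series G. \<forall>S. S \<subseteq> supp a \<and> S \<noteq> {} \<longrightarrow> (\<exists>m\<in>S. \<forall>s\<in>S. s = m \<or> (m, s) \<in> r)}"


section \<open>Rational expressions\<close>

text \<open>An atom is an element of the group algebra, written as a list of coefficients and monomials.
  A monomial may be repeated, in which case its coefficients are added.\<close>

datatype ('k, 'g) rexp =
    Lin "('k \<times> 'g) list"
  | Plus "('k, 'g) rexp" "('k, 'g) rexp"
  | Times "('k, 'g) rexp" "('k, 'g) rexp"
  | Star "('k, 'g) rexp"

text \<open>The value is meaningful only if all products and stars involved are well-defined, which is
  what the predicates below ensure.\<close>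

primrec value_of :: "'g monoid \<Rightarrow> ('k::field, 'g) rexp \<Rightarrow> 'g \<Rightarrow> 'k" where
  "value_of G (Lin cs) = (\<lambda>w. \<Sum>(c, u)\<leftarrow>cs. if u = w then c else 0)"
| "value_of G (Plus e f) = (\<lambda>w. value_of G e w + value_of G f w)"
| "value_of G (Times e f) = cauchy G (value_of G e) (value_of G f)"
| "value_of G (Star e) = star G (value_of G e)"

primrec star_rational_exp :: "'g monoid \<Rightarrow> ('k::field, 'g) rexp \<Rightarrow> bool" where
  "star_rational_exp G (Lin cs) \<longleftrightarrow> snd ` set cs \<subseteq> carrier G"
| "star_rational_exp G (Plus e f) \<longleftrightarrow> star_rational_exp G e \<and> star_rational_exp G f"
| "star_rational_exp G (Times e f) \<longleftrightarrow> star_rational_exp G e \<and> star_rational_exp G f \<and>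
     cauchy_defined G (value_of G e) (value_of G f)"
| "star_rational_exp G (Star e) \<longleftrightarrow> star_rational_exp G e \<and> star_defined G (value_of G e)"

text \<open>Products of Malcev-Neumann series, and stars of those supported in the elements greater
  than \<open>1\<close>, are always well-defined Malcev-Neumann series (Neumann), so this need not be required
  here.\<close>

primrec mn_exp :: "'g monoid \<Rightarrow> 'g rel \<Rightarrow> ('k::field, 'g) rexp \<Rightarrow> bool" where
  "mn_exp G r (Lin cs) \<longleftrightarrow> snd ` set cs \<subseteq> carrier G"
| "mn_exp G r (Plus e f) \<longleftrightarrow> mn_exp G r e \<and> mn_exp G r f"
| "mn_exp G r (Times e f) \<longleftrightarrow> mn_exp G r e \<and> mn_exp G r f"
| "mn_exp G r (Star e) \<longleftrightarrow> mn_exp G r e \<and> value_of G e \<in> malcev_neumann G r \<and>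
     (\<forall>w\<in>supp (value_of G e). (\<one>\<^bsub>G\<^esub>, w) \<in> r)"

definition mn_rational :: "'g monoid \<Rightarrow> 'g rel \<Rightarrow> ('g \<Rightarrow> 'k::field) \<Rightarrow> bool" where
  "mn_rational G r a \<longleftrightarrow> a \<in> malcev_neumann G r \<and> (\<exists>e. mn_exp G r e \<and> value_of G e = a)"

definition length_additive :: "'x set \<Rightarrow> ('x word \<Rightarrow> 'k::zero) \<Rightarrow> ('x word \<Rightarrow> 'k) \<Rightarrow> bool" where
  "length_additive X a b \<longleftrightarrow>
    (\<forall>u\<in>supp a. \<forall>v\<in>supp b. length (u \<otimes>\<^bsub>free_group X\<^esub> v) = length u + length v)"

primrec without_simplification :: "'x set \<Rightarrow> ('k::field, 'x word) rexp \<Rightarrow> bool" where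
  "without_simplification X (Lin cs) \<longleftrightarrow> snd ` set cs \<subseteq> carrier (free_group X)"
| "without_simplification X (Plus e f) \<longleftrightarrow>
     without_simplification X e \<and> without_simplification X f"
| "without_simplification X (Times e f) \<longleftrightarrow>
     without_simplification X e \<and> without_simplification X f \<and>
     length_additive X (value_of (free_group X) e) (value_of (free_group X) f)"
| "without_simplification X (Star e) \<longleftrightarrow>
     without_simplification X e \<and> star_defined (free_group X) (value_of (free_group X) e) \<and>
     length_additive X (value_of (free_group X) e) (value_of (free_group X) e)"


section \<open>Algorithms with exact arithmetic in a field\<close>

text \<open>Algorithms are first-order recursive programs (in the sense of McCarthy) over Lisp-like data
  whose atoms are scalars, generators and symbols. The primitives are pairing and projections,
  the field operations (with inversion of \<open>0\<close> undefined), the scalars \<open>0\<close> and \<open>1\<close>, and the equality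
  test. A program is a list of function bodies. It mentions neither scalars nor generators, and it
  has no access to the order of the group.\<close>

datatype ('k, 'x) val =
    Scalar 'k
  | Gen 'x
  | Sym nat
  | Pr "('k, 'x) val" "('k, 'x) val"

datatype tm =
    Var nat
  | Quote nat
  | Pairing tm tm
  | Fst tm
  | Snd tm
  | IfPair tm tm tm
  | IfEq tm tm tm tm
  | KZero
  | KOne
  | KAdd tm tm
  | KMult tm tm
  | KNeg tm
  | KInv tm
  | LetIn tm tm
  | Call nat "tm list"

type_synonym prog = "tm list"

text \<open>\<open>eval P \<rho> t v\<close>: in the environment \<open>\<rho>\<close> the evaluation of \<open>t\<close> terminates with value \<open>v\<close>.
  \<open>LetIn\<close> puts its value in front of the environment.\<close>

inductive eval :: "prog \<Rightarrow> ('k::field, 'x) val list \<Rightarrow> tm \<Rightarrow> ('k, 'x) val \<Rightarrow> bool"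
  for P :: prog where
  eval_Var: "i < length \<rho> \<Longrightarrow> eval P \<rho> (Var i) (\<rho> ! i)"
| eval_Quote: "eval P \<rho> (Quote n) (Sym n)"
| eval_Pairing: "eval P \<rho> s u \<Longrightarrow> eval P \<rho> t v \<Longrightarrow> eval P \<rho> (Pairing s t) (Pr u v)"
| eval_Fst: "eval P \<rho> t (Pr u v) \<Longrightarrow> eval P \<rho> (Fst t) u"
| eval_Snd: "eval P \<rho> t (Pr u v) \<Longrightarrow> eval P \<rho> (Snd t) v"
| eval_IfPair_True: "eval P \<rho> c (Pr u v) \<Longrightarrow> eval P \<rho> s w \<Longrightarrow> eval P \<rho> (IfPair c s t) w"
| eval_IfPair_False:
    "eval P \<rho> c u \<Longrightarrow> \<forall>x y. u \<noteq> Pr x y \<Longrightarrow> eval P \<rho> t w \<Longrightarrow> eval P \<rho> (IfPair c s t) w"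
| eval_IfEq_True:
    "eval P \<rho> c u \<Longrightarrow> eval P \<rho> d u \<Longrightarrow> eval P \<rho> s w \<Longrightarrow> eval P \<rho> (IfEq c d s t) w"
| eval_IfEq_False:
    "eval P \<rho> c u \<Longrightarrow> eval P \<rho> d v \<Longrightarrow> u \<noteq> v \<Longrightarrow> eval P \<rho> t w \<Longrightarrow> eval P \<rho> (IfEq c d s t) w"
| eval_KZero: "eval P \<rho> KZero (Scalar 0)"
| eval_KOne: "eval P \<rho> KOne (Scalar 1)"
| eval_KAdd:
    "eval P \<rho> s (Scalar x) \<Longrightarrow> eval P \<rho> t (Scalar y) \<Longrightarrow> eval P \<rho> (KAdd s t) (Scalar (x + y))"
| eval_KMult:
    "eval P \<rho> s (Scalar x) \<Longrightarrow> eval P \<rho> t (Scalar y) \<Longrightarrow> eval P \<rho> (KMult s t) (Scalar (x * y))"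
| eval_KNeg: "eval P \<rho> t (Scalar x) \<Longrightarrow> eval P \<rho> (KNeg t) (Scalar (- x))"
| eval_KInv: "eval P \<rho> t (Scalar x) \<Longrightarrow> x \<noteq> 0 \<Longrightarrow> eval P \<rho> (KInv t) (Scalar (inverse x))"
| eval_LetIn: "eval P \<rho> s u \<Longrightarrow> eval P (u # \<rho>) t v \<Longrightarrow> eval P \<rho> (LetIn s t) v"
| eval_Call:
    "f < length P \<Longrightarrow> list_all2 (eval P \<rho>) ts us \<Longrightarrow> eval P us (P ! f) v \<Longrightarrow> eval P \<rho> (Call f ts) v"

inductive_cases eval_cases:
  "eval P \<rho> (Var i) v" "eval P \<rho> (Quote n) v" "eval P \<rho> (Pairing s t) v" "eval P \<rho> (Fst t) v"
  "eval P \<rho> (Snd t) v" "eval P \<rho> (IfPair c s t) v" "eval P \<rho> (IfEq c d s t) v" "eval P \<rho> KZero v"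
  "eval P \<rho> KOne v" "eval P \<rho> (KAdd s t) v" "eval P \<rho> (KMult s t) v" "eval P \<rho> (KNeg t) v"
  "eval P \<rho> (KInv t) v" "eval P \<rho> (LetIn s t) v" "eval P \<rho> (Call f ts) v"

lemma eval_deterministic: "eval P \<rho> t v \<Longrightarrow> eval P \<rho> t v' \<Longrightarrow> v = v'"
proof (induction arbitrary: v' rule: eval.induct)
  case (eval_Call f \<rho> ts us v)
  from eval_Call.prems obtain us' where us': "list_all2 (eval P \<rho>) ts us'" "eval P us' (P ! f) v'"
    by (auto elim: eval_cases)
  have "us = us'"
    using eval_Call.IH(1) us'(1)
    by (auto simp: list_all2_conv_all_nth intro!: nth_equalityI)
  then show ?case using eval_Call.IH(2) us'(2) by blast
next
  case eval_Var
  from eval_Var.prems show ?case by (auto elim!: eval_cases(1))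
next
  case eval_Quote
  from eval_Quote.prems show ?case by (auto elim!: eval_cases(2))
next
  case eval_Pairing
  from eval_Pairing.prems show ?case by (auto elim!: eval_cases(3) dest!: eval_Pairing.IH)
next
  case eval_Fst
  from eval_Fst.prems show ?case by (auto elim!: eval_cases(4) dest!: eval_Fst.IH)
next
  case eval_Snd
  from eval_Snd.prems show ?case by (auto elim!: eval_cases(5) dest!: eval_Snd.IH)
next
  case eval_IfPair_True
  from eval_IfPair_True.prems show ?case by (auto elim!: eval_cases(6) dest!: eval_IfPair_True.IH)
next
  case eval_IfPair_False
  from eval_IfPair_False.prems eval_IfPair_False.hyps show ?case by (auto elim!: eval_cases(6) dest!: eval_IfPair_False.IH)
next
  case eval_IfEq_True
  from eval_IfEq_True.prems show ?case by (auto elim!: eval_cases(7) dest!: eval_IfEq_True.IH)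
next
  case eval_IfEq_False
  from eval_IfEq_False.prems eval_IfEq_False.hyps show ?case by (auto elim!: eval_cases(7) dest!: eval_IfEq_False.IH)
next
  case eval_KZero
  from eval_KZero.prems show ?case by (auto elim!: eval_cases(8))
next
  case eval_KOne
  from eval_KOne.prems show ?case by (auto elim!: eval_cases(9))
next
  case eval_KAdd
  from eval_KAdd.prems show ?case by (auto elim!: eval_cases(10) dest!: eval_KAdd.IH)
next
  case eval_KMult
  from eval_KMult.prems show ?case by (auto elim!: eval_cases(11) dest!: eval_KMult.IH)
next
  case eval_KNeg
  from eval_KNeg.prems show ?case by (auto elim!: eval_cases(12) dest!: eval_KNeg.IH)
next
  case eval_KInv
  from eval_KInv.prems show ?case by (auto elim!: eval_cases(13) dest!: eval_KInv.IH)
next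
  case eval_LetIn
  from eval_LetIn.prems show ?case by (auto elim!: eval_cases(14) dest!: eval_LetIn.IH)
qed

text \<open>The main function is the one numbered \<open>0\<close>.\<close>

definition computes :: "prog \<Rightarrow> ('k::field, 'x) val \<Rightarrow> ('k, 'x) val \<Rightarrow> bool" where
  "computes P u v \<longleftrightarrow> eval P [u] (Call 0 [Var 0]) v"

fun enc_list :: "('a \<Rightarrow> ('k, 'x) val) \<Rightarrow> 'a list \<Rightarrow> ('k, 'x) val" where
  "enc_list g [] = Sym 0"
| "enc_list g (a # as) = Pr (g a) (enc_list g as)"

definition enc_letter :: "'x letter \<Rightarrow> ('k, 'x) val" where
  "enc_letter a = Pr (Gen (fst a)) (Sym (of_bool (snd a)))"

definition enc_monomial :: "'k \<times> 'x word \<Rightarrow> ('k, 'x) val" where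
  "enc_monomial m = Pr (Scalar (fst m)) (enc_list enc_letter (snd m))"

primrec enc :: "('k, 'x word) rexp \<Rightarrow> ('k, 'x) val" where
  "enc (Lin cs) = Pr (Sym 0) (enc_list enc_monomial cs)"
| "enc (Plus e f) = Pr (Sym 1) (Pr (enc e) (enc f))"
| "enc (Times e f) = Pr (Sym 2) (Pr (enc e) (enc f))"
| "enc (Star e) = Pr (Sym 3) (enc e)"

end

theory Submission
  imports Defs "HOL.Vector_Spaces" "HOL-Library.Function_Algebras" "HOL-Library.Infinite_Set"
    "HOL-Library.Sublist"
begin

text \<open>A product or star of expressions without simplification is computed in the free monoid on the
  letters first, by a weighted automaton whose behaviour is a series on possibly unreduced words.
  Neumann's lemma says that only finitely many words with nonzero weight have a given normal form.
  Since finitely many contexts \<open>u _ v\<close> suffice to decide whether a word acts as zero inside the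
  automaton, almost all words that reduce to \<open>1\<close> act as zero. A bound on the length of the others can
  be recognised by a finite test: a trivial word splits as \<open>b d b\<^sup>-\<^sup>1 z\<close> with \<open>d\<close> and \<open>z\<close> trivial, so if
  the test succeeds for the lengths from \<open>m + 1\<close> to \<open>2m + 2\<close>, it succeeds for all larger lengths. The
  bound is found by search, and no access to the order is needed. Contracting the remaining trivial
  words yields an automaton on reduced words, and state elimination turns it into an expression in
  which no product or star simplifies.\<close>

section \<open>Neumann's lemma\<close>

text \<open>Free reduction cannot wait until the end. The expression \<open>x x^-1 - 1\<close> has
  value zero, so its star is admissible, yet on the level of words that star gives nonzero weight to
  every power of \<open>x x^-1\<close>, and all of these reduce to the empty word. Neumann's lemma
  speaks about supports in the group only. Hence each product or star is formed from automata that
  already vanish on unreduced words, and is then reduced itself. Finitely many contexts suffice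
  because an automaton with \<open>n\<close> states carries vectors of dimension at most
  \<open>n\<close>: the \<open>n + 1\<close> vectors reached by the prefixes of length at most
  \<open>n\<close> are linearly dependent, so a long context is a combination of shorter ones. That
  state elimination does not simplify is a property of the states: in the reduced automaton each
  state remembers the last letter read, so paths that can be composed carry words whose
  concatenation is reduced.\<close>

definition good_seqs :: "('a \<Rightarrow> 'a \<Rightarrow> bool) \<Rightarrow> 'a set \<Rightarrow> bool" where
  "good_seqs below S \<longleftrightarrow> (\<forall>f :: nat \<Rightarrow> 'a. range f \<subseteq> S \<longrightarrow> (\<exists>i j. i < j \<and> below (f i) (f j)))"

lemma good_seqsD:
  assumes "good_seqs below S" "\<And>i. f i \<in> S"
  obtains i j :: nat where "i < j" "below (f i) (f j)"
proof -
  have "range f \<subseteq> S" using assms(2) by auto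
  then show ?thesis using assms(1) that unfolding good_seqs_def by blast
qed

definition has_minima :: "('a \<Rightarrow> 'a \<Rightarrow> bool) \<Rightarrow> 'a set \<Rightarrow> bool" where
  "has_minima below S \<longleftrightarrow> (\<forall>T. T \<subseteq> S \<and> T \<noteq> {} \<longrightarrow> (\<exists>m\<in>T. \<forall>s\<in>T. below m s))"

lemma good_seqs_if_has_minima:
  assumes "has_minima below S"
  shows "good_seqs below S"
  unfolding good_seqs_def
proof (intro allI impI)
  fix f :: "nat \<Rightarrow> 'a" assume "range f \<subseteq> S"
  then obtain m where "m \<in> range f" "\<forall>s\<in>range f. below m s"
    using assms unfolding has_minima_def by blast
  then show "\<exists>i j. i < j \<and> below (f i) (f j)" by blast
qed

text \<open>Every tail of \<open>f\<close> has a minimum, so infinitely many indices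
  \<open>i\<close> satisfy \<open>below (f i) (f j)\<close> for all \<open>j \<ge> i\<close>. Along
  these indices the first condition is automatic, and only \<open>g\<close> needs a good
  pair.\<close>

lemma good_seqs_pair:
  assumes "has_minima below S" "good_seqs below' T" "\<And>i. f i \<in> S" "\<And>i. g i \<in> T"
  obtains i j :: nat where "i < j" "below (f i) (f j)" "below' (g i) (g j)"
proof -
  define I where "I = {i. \<forall>j\<ge>i. below (f i) (f j)}"
  have inf: "\<exists>i\<in>I. N \<le> i" for N
  proof -
    have "f ` {N..} \<subseteq> S" "f ` {N..} \<noteq> {}" using assms(3) by auto
    then obtain m where "m \<in> f ` {N..}" "\<forall>s\<in>f ` {N..}. below m s"
      using assms(1) unfolding has_minima_def by meson
    then obtain i where "N \<le> i" "\<forall>j\<ge>N. below (f i) (f j)" by auto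
    then have "\<forall>j\<ge>i. below (f i) (f j)" by simp
    with \<open>N \<le> i\<close> show ?thesis unfolding I_def by blast
  qed
  then have "infinite I" by (metis infinite_nat_iff_unbounded_le)
  then have e: "enumerate I i \<in> I" "i < j \<Longrightarrow> enumerate I i < enumerate I j" for i j
    by (auto simp: enumerate_in_set enumerate_mono)
  obtain i j where ij: "i < j" "below' (g (enumerate I i)) (g (enumerate I j))"
    using good_seqsD[OF assms(2), of "\<lambda>i. g (enumerate I i)"] assms(4) by blast
  have "below (f (enumerate I i)) (f (enumerate I j))"
    using e(1)[of i] e(2)[OF ij(1)] unfolding I_def by auto
  then show ?thesis using ij e(2) that by blast
qed

definition extends_to_bad :: "('a \<Rightarrow> 'a \<Rightarrow> bool) \<Rightarrow> 'a set \<Rightarrow> 'a list \<Rightarrow> bool" where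
  "extends_to_bad below S xs \<longleftrightarrow> (\<exists>f :: nat \<Rightarrow> 'a. range f \<subseteq> S \<and> (\<forall>i j. i < j \<longrightarrow> \<not> below (f i) (f j)) \<and>
     (\<forall>i < length xs. f i = xs ! i))"

text \<open>Nash-Williams' minimal bad sequence argument.\<close>

lemma higman:
  assumes "has_minima below S"
  shows "good_seqs (list_emb below) (lists S)"
proof (rule ccontr)
  let ?B = "extends_to_bad (list_emb below) (lists S)"
  assume "\<not> ?thesis"
  then have B0: "?B []" unfolding extends_to_bad_def good_seqs_def by auto
  \<comment> \<open>The shortest next entry among those that keep the finite beginning extendable to
    a bad sequence.\<close>
  define nxt where "nxt xs = arg_min length (\<lambda>x. ?B (xs @ [x]))" for xs
  define F where "F n = rec_nat [] (\<lambda>_ xs. xs @ [nxt xs]) n" for n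
  have F_Suc: "F (Suc n) = F n @ [nxt (F n)]" for n by (simp add: F_def)
  define m where "m n = nxt (F n)" for n
  have ext: "\<exists>x. ?B (xs @ [x])" if "?B xs" for xs
  proof -
    from that obtain f where f: "range f \<subseteq> lists S" "\<forall>i j. i < j \<longrightarrow> \<not> list_emb below (f i) (f j)"
      "\<forall>i < length xs. f i = xs ! i" unfolding extends_to_bad_def by blast
    then have "?B (xs @ [f (length xs)])"
      unfolding extends_to_bad_def
      by (intro exI[of _ f]) (auto simp: nth_append less_Suc_eq)
    then show ?thesis by blast
  qed
  have nxt: "?B (xs @ [nxt xs])" "\<And>x. ?B (xs @ [x]) \<Longrightarrow> length (nxt xs) \<le> length x"
    if "?B xs" for xs
    using ext[OF that] arg_min_natI[of "\<lambda>x. ?B (xs @ [x])" _ length]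
      arg_min_nat_le[of "\<lambda>x. ?B (xs @ [x])" _ length] unfolding nxt_def by blast+
  have BF: "?B (F n)" for n
    by (induction n) (use B0 nxt(1) in \<open>auto simp: F_Suc\<close>, simp add: F_def)
  have lenF: "length (F n) = n" for n
    by (induction n) (auto simp: F_Suc, simp add: F_def)
  have nthF: "i < n \<Longrightarrow> F n ! i = m i" for i n
    by (induction n) (auto simp: F_Suc nth_append lenF m_def less_Suc_eq)
  have m_seq: "\<exists>f. range f \<subseteq> lists S \<and> (\<forall>i j. i < j \<longrightarrow> \<not> list_emb below (f i) (f j)) \<and>
      (\<forall>i<n. f i = m i)" for n
    using BF[of n] nthF unfolding extends_to_bad_def lenF by auto
  have m_mem: "m i \<in> lists S" for i
  proof -
    obtain f where f: "range f \<subseteq> lists S" "\<forall>k<Suc i. f k = m k" using m_seq[of "Suc i"] by blast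
    have "f i \<in> lists S" using f(1) by blast
    then show ?thesis using f(2) by simp
  qed
  have m_bad: "\<not> list_emb below (m i) (m j)" if "i < j" for i j
  proof -
    obtain f where f: "\<forall>i j. i < j \<longrightarrow> \<not> list_emb below (f i) (f j)" "\<forall>k<Suc j. f k = m k"
      using m_seq[of "Suc j"] by blast
    have "\<not> list_emb below (f i) (f j)" using f(1) that by blast
    then show ?thesis using f(2) that by simp
  qed
  have m_ne: "m i \<noteq> []" for i using m_bad[of i "Suc i"] by auto
  define v where "v i = tl (m i)" for i
  define s where "s i = hd (m i)" for i
  have m_eq: "m i = s i # v i" for i using m_ne[of i] by (simp add: s_def v_def)
  \<comment> \<open>A bad sequence \<open>h\<close> of tails could be spliced behind
    \<open>m 0, ..., m (n - 1)\<close>, giving a bad sequence whose entry at \<open>n\<close> is the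
    tail of \<open>m n\<close>, shorter than the minimal choice.\<close>
  have "good_seqs (list_emb below) (range v)"
  proof (rule ccontr)
    assume "\<not> ?thesis"
    then obtain h :: "nat \<Rightarrow> 'a list" where h: "range h \<subseteq> range v"
        "\<And>i j. i < j \<Longrightarrow> \<not> list_emb below (h i) (h j)"
      unfolding good_seqs_def by blast
    then have "\<forall>j. \<exists>k. h j = v k" by blast
    then obtain \<sigma> where \<sigma>: "\<And>j. h j = v (\<sigma> j)" by metis
    \<comment> \<open>Starting at the smallest index \<open>n = \<sigma> j0\<close> makes each later
      \<open>h j\<close> the tail of some \<open>m k\<close> with \<open>k \<ge> n\<close>. An
      embedding of \<open>m i\<close> with \<open>i < n\<close> into that tail would embed
      \<open>m i\<close> into \<open>m k\<close>.\<close>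
    define j0 where "j0 = arg_min \<sigma> (\<lambda>_. True)"
    have j0: "\<sigma> j0 \<le> \<sigma> j" for j
      unfolding j0_def by (rule arg_min_nat_le) simp
    define n where "n = \<sigma> j0"
    define f where "f i = (if i < n then m i else h (j0 + (i - n)))" for i
    have "h j \<in> lists S" for j
      using m_mem[of "\<sigma> j"] \<sigma>[of j] m_eq[of "\<sigma> j"] by auto
    then have "range f \<subseteq> lists S" using m_mem by (auto simp: f_def)
    moreover have "\<not> list_emb below (f i) (f j)" if "i < j" for i j
    proof (cases "i < n \<and> \<not> j < n")
      case True
      define k where "k = \<sigma> (j0 + (j - n))"
      have "i < k" using True j0 unfolding n_def k_def by (meson order_less_le_trans)
      then have "\<not> list_emb below (m i) (s k # v k)" using m_bad m_eq by metis
      then show ?thesis using True \<sigma> by (auto simp: f_def k_def)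
    next
      case False
      then show ?thesis using that m_bad h(2) by (auto simp: f_def)
    qed
    moreover have "\<forall>i < length (F n @ [h j0]). f i = (F n @ [h j0]) ! i"
      by (auto simp: f_def lenF nth_append nthF less_Suc_eq)
    ultimately have "?B (F n @ [h j0])" unfolding extends_to_bad_def by blast
    then have "length (m n) \<le> length (h j0)" using nxt(2)[OF BF] unfolding m_def by blast
    then show False using \<sigma>[of j0] m_eq[of n] by (simp add: n_def)
  qed
  moreover have "s i \<in> S" for i using m_mem[of i] m_eq[of i] by auto
  ultimately obtain i j where "i < j" "below (s i) (s j)" "list_emb below (v i) (v j)"
    using good_seqs_pair[OF assms, of "list_emb below" "range v" s v] by blast
  then show False using m_bad[of i j] m_eq by auto
qed

section \<open>Well-ordered subsets of an ordered group\<close>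

locale ordered_group = group G for G (structure) +
  fixes r :: "'a rel"
  assumes compatible: "compatible_order G r"
begin

definition below :: "'a \<Rightarrow> 'a \<Rightarrow> bool" where
  "below x y \<longleftrightarrow> x = y \<or> (x, y) \<in> r"

abbreviation well_ordered :: "'a set \<Rightarrow> bool" where
  "well_ordered S \<equiv> S \<subseteq> carrier G \<and> has_minima below S"

lemma malcev_neumann_iff: "a \<in> malcev_neumann G r \<longleftrightarrow> well_ordered (supp a)"
proof -
  have "(\<forall>s\<in>S. s = m \<or> (m, s) \<in> r) \<longleftrightarrow> (\<forall>s\<in>S. below m s)" for m S
    unfolding below_def by metis
  then show ?thesis by (simp add: malcev_neumann_def series_def has_minima_def)
qed

lemma irreflexive: "(x, x) \<notin> r"
  using compatible
  unfolding compatible_order_def strict_linear_order_on_def irrefl_def by blast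

lemma transitive: "(x, y) \<in> r \<Longrightarrow> (y, z) \<in> r \<Longrightarrow> (x, z) \<in> r"
  using compatible
  unfolding compatible_order_def strict_linear_order_on_def trans_def by blast

lemma total: "x \<in> carrier G \<Longrightarrow> y \<in> carrier G \<Longrightarrow> x = y \<or> (x, y) \<in> r \<or> (y, x) \<in> r"
  using compatible
  unfolding compatible_order_def strict_linear_order_on_def total_on_def by blast

lemma mult_less_left:
  "(a, b) \<in> r \<Longrightarrow> a \<in> carrier G \<Longrightarrow> b \<in> carrier G \<Longrightarrow> u \<in> carrier G \<Longrightarrow> (u \<otimes> a, u \<otimes> b) \<in> r"
  using compatible unfolding compatible_order_def by (metis one_closed r_one m_closed)

lemma mult_less_right:
  "(a, b) \<in> r \<Longrightarrow> a \<in> carrier G \<Longrightarrow> b \<in> carrier G \<Longrightarrow> v \<in> carrier G \<Longrightarrow> (a \<otimes> v, b \<otimes> v) \<in> r"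
  using compatible unfolding compatible_order_def by (metis one_closed l_one m_closed)

text \<open>One factor is raised at a time. By cancellation each strict step stays strict, so equal
  products force both steps to be equalities. The second half is what turns good pairs into
  finiteness.\<close>

lemma mult_mono:
  assumes "below a b" "below c d" "a \<in> carrier G" "b \<in> carrier G" "c \<in> carrier G" "d \<in> carrier G"
  shows "below (a \<otimes> c) (b \<otimes> d)" "a \<otimes> c = b \<otimes> d \<Longrightarrow> a = b \<and> c = d"
proof -
  have 1: "below (a \<otimes> c) (b \<otimes> c)" "a \<otimes> c = b \<otimes> c \<longleftrightarrow> a = b"
    using assms mult_less_right unfolding below_def by auto
  have 2: "below (b \<otimes> c) (b \<otimes> d)" "b \<otimes> c = b \<otimes> d \<longleftrightarrow> c = d"
    using assms mult_less_left unfolding below_def by auto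
  show "below (a \<otimes> c) (b \<otimes> d)" using 1(1) 2(1) transitive unfolding below_def by metis
  assume "a \<otimes> c = b \<otimes> d"
  then show "a = b \<and> c = d"
    using 1 2 transitive irreflexive unfolding below_def by metis
qed

text \<open>The order is total, so without a minimum dependent choice yields an infinite strictly
  descending sequence, and such a sequence has no good pair.\<close>

lemma has_minima_if_good_seqs:
  assumes "S \<subseteq> carrier G" "good_seqs below S"
  shows "has_minima below S"
  unfolding has_minima_def
proof (intro allI impI, elim conjE)
  fix T assume T: "T \<subseteq> S" "T \<noteq> {}"
  show "\<exists>m\<in>T. \<forall>s\<in>T. below m s"
  proof (rule ccontr)
    assume "\<not> ?thesis"
    then have *: "\<exists>s\<in>T. (s, m) \<in> r" if "m \<in> T" for m
      using that T assms(1) total unfolding below_def by (metis subset_eq)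
    obtain t where "t \<in> T" using T by blast
    then obtain f :: "nat \<Rightarrow> 'a" where f: "\<And>n. f n \<in> T" "\<And>n. (f (Suc n), f n) \<in> r"
      using dependent_nat_choice[of "\<lambda>_ x. x \<in> T" "\<lambda>_ x y. (y, x) \<in> r"] * by (metis (no_types))
    have dec: "(f j, f i) \<in> r" if "i < j" for i j
      using that
    proof (induction j)
      case (Suc j)
      then show ?case using f(2)[of j] transitive by (cases "i = j") auto
    qed simp
    obtain i j where "i < j" "below (f i) (f j)"
      using good_seqsD[OF assms(2), of f] f(1) T(1) by blast
    then show False using dec transitive irreflexive unfolding below_def by metis
  qed
qed

lemma well_ordered_iff: "well_ordered S \<longleftrightarrow> S \<subseteq> carrier G \<and> good_seqs below S"
  using has_minima_if_good_seqs good_seqs_if_has_minima by blast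

lemma well_ordered_subset: "well_ordered S \<Longrightarrow> T \<subseteq> S \<Longrightarrow> well_ordered T"
  unfolding has_minima_def by blast

lemma well_ordered_finite:
  assumes "finite S" "S \<subseteq> carrier G"
  shows "well_ordered S"
proof -
  have "good_seqs below S"
    unfolding good_seqs_def
  proof (intro allI impI)
    fix f :: "nat \<Rightarrow> 'a" assume "range f \<subseteq> S"
    then have "finite (range f)" using assms finite_subset by blast
    then have "\<not> inj f" using finite_imageD infinite_UNIV_nat by blast
    then obtain i j where "i < j" "f i = f j"
      unfolding inj_def by (metis nat_neq_iff)
    then show "\<exists>i j. i < j \<and> below (f i) (f j)" unfolding below_def by auto
  qed
  then show ?thesis using assms(2) well_ordered_iff by blast
qed

lemma well_ordered_Un:
  assumes "well_ordered S" "well_ordered T"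
  shows "well_ordered (S \<union> T)"
proof -
  have "\<exists>m\<in>U. \<forall>s\<in>U. below m s" if U: "U \<subseteq> S \<union> T" "U \<noteq> {}" for U
  proof (cases "U \<inter> S = {} \<or> U \<inter> T = {}")
    case True
    then have "U \<subseteq> S \<or> U \<subseteq> T" using U by blast
    then show ?thesis using assms U(2) unfolding has_minima_def by metis
  next
    case False
    obtain m where m: "m \<in> U \<inter> S" "\<forall>s\<in>U \<inter> S. below m s"
      using assms(1) False unfolding has_minima_def by (metis inf_le2)
    obtain n where n: "n \<in> U \<inter> T" "\<forall>s\<in>U \<inter> T. below n s"
      using assms(2) False unfolding has_minima_def by (metis inf_le2)
    have "below m n \<or> below n m" using m(1) n(1) assms total unfolding below_def by blast
    moreover have "below x z" if "below x y" "below y z" for x y z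
      using that transitive unfolding below_def by blast
    ultimately show ?thesis using m n U(1) by (metis Int_iff Un_iff subset_eq)
  qed
  then show ?thesis using assms unfolding has_minima_def by blast
qed

text \<open>Two indices that increase in both coordinates serve both claims: the products increase,
  and infinitely many factorizations of one \<open>w\<close> would contain two distinct ones that
  \<open>mult_mono(2)\<close> identifies.\<close>

lemma well_ordered_product:
  assumes "well_ordered S" "well_ordered T"
  shows "well_ordered {s \<otimes> t | s t. s \<in> S \<and> t \<in> T}"
    and "finite {(s, t). s \<in> S \<and> t \<in> T \<and> s \<otimes> t = w}"
proof -
  have pair: "\<exists>i j. i < j \<and> below (f i) (f j) \<and> below (g i) (g j)"
    if "\<And>i. f i \<in> S" "\<And>i. g i \<in> T" for f g :: "nat \<Rightarrow> 'a"
    using good_seqs_pair[of below S below T f g] assms well_ordered_iff that by metis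
  have "good_seqs below {s \<otimes> t | s t. s \<in> S \<and> t \<in> T}"
    unfolding good_seqs_def
  proof (intro allI impI)
    fix h :: "nat \<Rightarrow> 'a" assume "range h \<subseteq> {s \<otimes> t | s t. s \<in> S \<and> t \<in> T}"
    then have "\<forall>i. \<exists>s t. s \<in> S \<and> t \<in> T \<and> h i = s \<otimes> t" by blast
    then obtain f g where fg: "\<And>i. f i \<in> S" "\<And>i. g i \<in> T" "\<And>i. h i = f i \<otimes> g i" by metis
    then show "\<exists>i j. i < j \<and> below (h i) (h j)"
      using pair[of f g] mult_mono(1) assms by (metis subset_eq)
  qed
  then show "well_ordered {s \<otimes> t | s t. s \<in> S \<and> t \<in> T}"
    using assms by (subst well_ordered_iff) auto
  show "finite {(s, t). s \<in> S \<and> t \<in> T \<and> s \<otimes> t = w}" (is "finite ?F")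
  proof (rule ccontr)
    assume "infinite ?F"
    then obtain h :: "nat \<Rightarrow> 'a \<times> 'a" where h: "inj h" "range h \<subseteq> ?F"
      using infinite_countable_subset by blast
    define f g where "f i = fst (h i)" and "g i = snd (h i)" for i
    have fg: "f i \<in> S" "g i \<in> T" "f i \<otimes> g i = w" for i
      using h(2) unfolding f_def g_def by (auto simp: subset_eq split: prod.splits) (metis prod.collapse)+
    obtain i j where ij: "i < j" "below (f i) (f j)" "below (g i) (g j)" using pair fg by blast
    have "f i \<in> carrier G" "g i \<in> carrier G" "f j \<in> carrier G" "g j \<in> carrier G"
      using fg assms by blast+
    then have "f i = f j \<and> g i = g j"
      using mult_mono(2)[OF ij(2,3)] fg(3) by simp
    then show False using h(1) ij(1) by (metis f_def g_def injD less_irrefl prod_eqI)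
  qed
qed

abbreviation product :: "'a list \<Rightarrow> 'a" where
  "product us \<equiv> foldr (mult G) us \<one>"

lemma product_closed: "set us \<subseteq> carrier G \<Longrightarrow> product us \<in> carrier G"
  by (induction us) auto

text \<open>Raising a factor cannot lower the product, and inserting a factor above
  \<open>\<one>\<close> raises it strictly. Equal products therefore leave no room for any
  change.\<close>

lemma product_mono:
  assumes "list_emb below us vs" "set us \<subseteq> carrier G" "set vs \<subseteq> carrier G"
    "\<forall>v\<in>set vs. (\<one>, v) \<in> r"
  shows "below (product us) (product vs) \<and> (product us = product vs \<longrightarrow> us = vs)"
  using assms
proof (induction rule: list_emb.induct)
  case (list_emb_Nil vs)
  have "product vs = \<one> \<and> vs = [] \<or> (\<one>, product vs) \<in> r"
    using list_emb_Nil(2,3)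
  proof (induction vs)
    case (Cons v vs)
    then have v: "(\<one>, v) \<in> r" "v \<in> carrier G" "product vs \<in> carrier G" "below \<one> (product vs)"
      using product_closed unfolding below_def by auto
    then have "below (\<one> \<otimes> \<one>) (v \<otimes> product vs)"
      using mult_mono(1)[of \<one> v \<one> "product vs"] unfolding below_def by blast
    moreover have "\<one> \<otimes> \<one> \<noteq> v \<otimes> product vs"
      using mult_mono(2)[of \<one> v \<one> "product vs"] v irreflexive unfolding below_def by blast
    ultimately show ?case by (simp add: below_def)
  qed simp
  then show ?case using irreflexive unfolding below_def by auto
next
  case (list_emb_Cons us vs v)
  then have c: "v \<in> carrier G" "product us \<in> carrier G" "product vs \<in> carrier G"
    and l: "below \<one> v" "v \<noteq> \<one>" "below (product us) (product vs)"
    using product_closed irreflexive by (auto simp: below_def)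
  show ?case using mult_mono[OF l(1,3)] c l(2) by auto
next
  case (list_emb_Cons2 u v us vs)
  then have c: "u \<in> carrier G" "v \<in> carrier G" "product us \<in> carrier G" "product vs \<in> carrier G"
    and l: "below u v" "below (product us) (product vs)"
    using product_closed by auto
  show ?case using mult_mono[OF l] c list_emb_Cons2 by auto
qed

text \<open>Higman's lemma supplies an embedded pair in any sequence of lists over \<open>S\<close>.
  By \<open>product_mono\<close> its products increase, and the two lists coincide if the products
  agree.\<close>

lemma neumann:
  assumes "well_ordered S" "\<forall>s\<in>S. (\<one>, s) \<in> r"
  shows "well_ordered (product ` lists S)" and "finite {us \<in> lists S. product us = w}"
proof -
  have high: "good_seqs (list_emb below) (lists S)" using higman assms(1) by blast
  have mono: "below (product us) (product vs) \<and> (product us = product vs \<longrightarrow> us = vs)"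
    if "list_emb below us vs" "us \<in> lists S" "vs \<in> lists S" for us vs
    using product_mono[OF that(1)] that(2,3) assms by (auto simp: subset_eq in_lists_conv_set)
  have "good_seqs below (product ` lists S)"
    unfolding good_seqs_def
  proof (intro allI impI)
    fix h :: "nat \<Rightarrow> 'a" assume "range h \<subseteq> product ` lists S"
    then have "\<forall>i. \<exists>us. us \<in> lists S \<and> h i = product us" by blast
    then obtain f where f: "\<And>i. f i \<in> lists S" "\<And>i. h i = product (f i)" by metis
    then show "\<exists>i j. i < j \<and> below (h i) (h j)"
      using good_seqsD[OF high, of f] mono by metis
  qed
  moreover have "product ` lists S \<subseteq> carrier G"
    using assms(1) product_closed by (auto simp: subset_eq in_lists_conv_set)
  ultimately show "well_ordered (product ` lists S)" by (subst well_ordered_iff) simp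
  show "finite {us \<in> lists S. product us = w}" (is "finite ?F")
  proof (rule ccontr)
    assume "infinite ?F"
    then obtain h :: "nat \<Rightarrow> 'a list" where h: "inj h" "range h \<subseteq> ?F"
      using infinite_countable_subset by blast
    then have hF: "\<And>i. h i \<in> lists S" "\<And>i. product (h i) = w" by blast+
    obtain i j where "i < j" "list_emb below (h i) (h j)" using good_seqsD[OF high, of h] hF(1) by metis
    then show False using mono hF h(1) by (metis injD less_irrefl)
  qed
qed

section \<open>Malcev-Neumann series under product and star\<close>

lemma cauchy_malcev_neumann:
  fixes a b :: "'a \<Rightarrow> 'k::field"
  assumes "a \<in> malcev_neumann G r" "b \<in> malcev_neumann G r"
  shows "cauchy_defined G a b" "cauchy G a b \<in> malcev_neumann G r"
proof -
  note wo = assms[unfolded malcev_neumann_iff]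
  have "cauchy_terms G a b w \<subseteq> {(s, t). s \<in> supp a \<and> t \<in> supp b \<and> s \<otimes> t = w}" for w
    by (auto simp: cauchy_terms_def supp_def)
  then show "cauchy_defined G a b"
    unfolding cauchy_defined_def using well_ordered_product(2)[OF wo] finite_subset by blast
  have "supp (cauchy G a b) \<subseteq> {s \<otimes> t | s t. s \<in> supp a \<and> t \<in> supp b}"
  proof
    fix w assume "w \<in> supp (cauchy G a b)"
    then have "cauchy_terms G a b w \<noteq> {}" by (auto simp: supp_def cauchy_def)
    then show "w \<in> {s \<otimes> t | s t. s \<in> supp a \<and> t \<in> supp b}"
      by (auto simp: cauchy_terms_def supp_def)
  qed
  then show "cauchy G a b \<in> malcev_neumann G r"
    unfolding malcev_neumann_iff by (rule well_ordered_subset[OF well_ordered_product(1)[OF wo]])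
qed

lemma star_malcev_neumann:
  fixes a :: "'a \<Rightarrow> 'k::field"
  assumes "a \<in> malcev_neumann G r" "\<forall>w\<in>supp a. (\<one>, w) \<in> r"
  shows "star_defined G a" "star G a \<in> malcev_neumann G r"
proof -
  note wo = assms(1)[unfolded malcev_neumann_iff] assms(2)
  have st: "star_terms G a w \<subseteq> {us \<in> lists (supp a). product us = w}" for w
    by (auto simp: star_terms_def supp_def prod_list_zero_iff)
  then show "star_defined G a"
    unfolding star_defined_def using neumann(2)[OF wo] finite_subset by blast
  have "supp (star G a) \<subseteq> product ` lists (supp a)"
  proof
    fix w assume "w \<in> supp (star G a)"
    then have "star_terms G a w \<noteq> {}" by (auto simp: supp_def star_def)
    then show "w \<in> product ` lists (supp a)" using st[of w] by blast
  qed
  then show "star G a \<in> malcev_neumann G r"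
    unfolding malcev_neumann_iff by (rule well_ordered_subset[OF neumann(1)[OF wo]])
qed

lemma value_of_malcev_neumann:
  "mn_exp G r e \<Longrightarrow> value_of G e \<in> malcev_neumann G r"
proof (induction e)
  case (Lin cs)
  have "supp (value_of G (Lin cs)) \<subseteq> snd ` set cs"
  proof
    fix w assume "w \<in> supp (value_of G (Lin cs))"
    then have "sum_list (map (\<lambda>(c, u). if u = w then c else 0) cs) \<noteq> 0" by (simp add: supp_def)
    then show "w \<in> snd ` set cs"
      by (induction cs) (auto split: if_splits)
  qed
  then have "well_ordered (supp (value_of G (Lin cs)))"
    using Lin by (intro well_ordered_finite) (auto intro: finite_subset)
  then show ?case by (simp only: malcev_neumann_iff)
next
  case (Plus e f)
  have "supp (value_of G (Plus e f)) \<subseteq> supp (value_of G e) \<union> supp (value_of G f)"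
    by (auto simp: supp_def)
  moreover have "well_ordered (supp (value_of G e) \<union> supp (value_of G f))"
    using Plus by (intro well_ordered_Un) (auto simp: malcev_neumann_iff)
  ultimately have "well_ordered (supp (value_of G (Plus e f)))" using well_ordered_subset by blast
  then show ?case by (simp only: malcev_neumann_iff)
next
  case (Times e f)
  then show ?case using cauchy_malcev_neumann(2) by auto
next
  case (Star e)
  then show ?case using star_malcev_neumann(2) by auto
qed

end

section \<open>Free reduction\<close>

definition nf :: "'x word \<Rightarrow> 'x word" where
  "nf w = foldr push w []"

lemma nf_Nil [simp]: "nf [] = []"
  by (simp add: nf_def)

lemma nf_Cons: "nf (a # w) = push a (nf w)"
  by (simp add: nf_def)

lemma reduced_nf: "reduced (nf w)"
  by (simp add: nf_def reduced_foldr_push)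

lemma nf_reduced: "reduced w \<Longrightarrow> nf w = w"
  by (simp add: nf_def foldr_push_Nil)

lemma foldr_push_nf: "reduced v \<Longrightarrow> foldr push (nf u) v = foldr push u v"
  unfolding nf_def by (subst foldr_push_assoc) auto

lemma nf_append: "nf (u @ v) = foldr push (nf u) (nf v)"
  by (simp add: foldr_push_nf reduced_nf) (simp add: nf_def)

lemma nf_append_Nil [simp]: "nf u = [] \<Longrightarrow> nf (u @ v) = nf v"
  by (simp add: nf_append)

lemma set_nf: "set (nf w) \<subseteq> set w"
  using set_foldr_push[of w "[]"] by (simp add: nf_def)

text \<open>Each letter of the normal form is a letter of the word that survives cancellation;
  cutting at the first survivor leaves a trivial word in front of it.\<close>

lemma nf_split:
  "nf w = a # v \<Longrightarrow> \<exists>d z. w = d @ a # z \<and> nf d = [] \<and> nf z = v"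
proof (induction "length w" arbitrary: w a v rule: less_induct)
  case less
  then obtain b w' where w: "w = b # w'" by (cases w) auto
  show ?case
  proof (cases "\<exists>y. nf w' = inv_letter b # y")
    case True
    \<comment> \<open>Here the head \<open>b\<close> gets cancelled. The induction hypothesis is
      applied once to locate the cancelling letter, and again behind that letter to locate
      \<open>a\<close>.\<close>
    then have w': "nf w' = inv_letter b # a # v" using less.prems w by (auto simp: nf_Cons)
    then obtain d z where dz: "w' = d @ inv_letter b # z" "nf d = []" "nf z = a # v"
      using less.hyps[of w'] w by auto
    then obtain d' z' where dz': "z = d' @ a # z'" "nf d' = []" "nf z' = v"
      using less.hyps[of z] w by auto
    have "nf (b # d @ inv_letter b # d') = []"
      using dz(2) dz'(2) by (simp add: nf_Cons)
    then show ?thesis using w dz(1) dz'(1,3)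
      by (intro exI[of _ "b # d @ inv_letter b # d'"] exI[of _ z']) simp
  next
    case False
    then have "nf w = b # nf w'" using w by (cases "nf w'") (auto simp: nf_Cons)
    then show ?thesis using less.prems w by (intro exI[of _ "[]"] exI[of _ w']) simp
  qed
qed

fun no_trivial_suffix :: "'x word \<Rightarrow> bool" where
  "no_trivial_suffix [] \<longleftrightarrow> True"
| "no_trivial_suffix (a # w) \<longleftrightarrow> nf (a # w) \<noteq> [] \<and> no_trivial_suffix w"

lemma no_trivial_suffix_iff:
  "no_trivial_suffix w \<longleftrightarrow> (\<forall>u v. w = u @ v \<and> nf v = [] \<longrightarrow> v = [])"
proof (induction w)
  case (Cons a w)
  have "(\<forall>u v. a # w = u @ v \<and> nf v = [] \<longrightarrow> v = []) \<longleftrightarrow>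
    nf (a # w) \<noteq> [] \<and> (\<forall>u v. w = u @ v \<and> nf v = [] \<longrightarrow> v = [])"
    by (auto simp: Cons_eq_append_conv)
  then show ?case using Cons by simp
qed simp

lemma nf_append_eq_singleton:
  assumes "nf (x @ y) = [a]" "nf x = [a]"
  shows "nf y = []"
proof (cases "nf y")
  case (Cons b z)
  then show ?thesis
    using assms reduced_nf[of y] by (auto simp: nf_append reduced_Cons split: if_splits)
qed

text \<open>Of two such prefixes of one word, the longer is the shorter followed by a trivial word,
  which must be empty.\<close>

lemma first_passage_unique:
  assumes "nf x = [a]" "no_trivial_suffix x" "nf x' = [a]" "no_trivial_suffix x'" "x @ z = x' @ z'"
  shows "x = x'"
  using assms unfolding append_eq_append_conv2
  by (metis nf_append_eq_singleton no_trivial_suffix_iff append.right_neutral)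

text \<open>The shortest prefix that qualifies works: a nonempty trivial suffix of it could be moved
  to the remainder \<open>z\<close>.\<close>

lemma first_passage_exists:
  assumes "nf w = a # v"
  shows "\<exists>x z. w = x @ z \<and> nf x = [a] \<and> no_trivial_suffix x \<and> nf z = v"
proof -
  define Q where "Q x \<longleftrightarrow> (\<exists>z. w = x @ z \<and> nf x = [a] \<and> nf z = v)" for x
  obtain d z where "w = d @ a # z" "nf d = []" "nf z = v" using nf_split[OF assms] by blast
  then have "Q (d @ [a])" unfolding Q_def by (simp add: nf_Cons)
  then have x: "Q (arg_min length Q)" "\<And>y. Q y \<Longrightarrow> length (arg_min length Q) \<le> length y"
    by (auto intro: arg_min_natI arg_min_nat_le)
  define x where "x = arg_min length Q"
  obtain z where z: "w = x @ z" "nf x = [a]" "nf z = v" using x(1) unfolding Q_def x_def by blast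
  have "no_trivial_suffix x"
    unfolding no_trivial_suffix_iff
  proof (intro allI impI, elim conjE)
    fix u s assume "x = u @ s" "nf s = []"
    then have "nf u = [a]" "w = u @ (s @ z)" "nf (s @ z) = v"
      using z by (auto simp: nf_append foldr_push_Nil reduced_nf)
    then have "length x \<le> length u" using x(2) unfolding Q_def x_def by blast
    then show "s = []" using \<open>x = u @ s\<close> by simp
  qed
  then show ?thesis using z by blast
qed

text \<open>What follows the first letter reduces to the inverse of that letter, and
  \<open>nf_split\<close> locates it.\<close>

lemma trivial_word_split:
  assumes "nf w = []" "w \<noteq> []"
  shows "\<exists>b d z. w = b # d @ inv_letter b # z \<and> nf d = [] \<and> nf z = []"
proof -
  obtain b w' where w: "w = b # w'" using assms(2) by (cases w) auto
  then have "nf w' = [inv_letter b]"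
    using assms(1) by (cases "nf w'") (auto simp: nf_Cons split: if_splits)
  then show ?thesis using nf_split[of w'] w by blast
qed


section \<open>Series over the free monoid\<close>

text \<open>The Cauchy product over the free monoid. The recursion takes the derivative of the left
  factor by the first letter, in step with the recursion of \<open>path\<close>;
  \<open>conv_eq_sum\<close> is the usual formula.\<close>

primrec conv :: "('a list \<Rightarrow> 'k::field) \<Rightarrow> ('a list \<Rightarrow> 'k) \<Rightarrow> 'a list \<Rightarrow> 'k" where
  "conv f g [] = f [] * g []"
| "conv f g (a # w) = f [] * g (a # w) + conv (\<lambda>u. f (a # u)) g w"

lemma conv_sum_left:
  "conv (\<lambda>u. \<Sum>s\<in>S. c s * f s u) g w = (\<Sum>s\<in>S. c s * conv (f s) g w)"
proof (induction w arbitrary: f)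
  case (Cons a w)
  show ?case
    using Cons[of "\<lambda>s u. f s (a # u)"]
    by (simp add: sum_distrib_right sum_distrib_left sum.distrib algebra_simps)
qed (simp add: sum_distrib_right mult.assoc)

lemma conv_add_left: "conv (\<lambda>u. f u + f' u) g w = conv f g w + conv f' g w"
  by (induction w arbitrary: f f') (auto simp: algebra_simps)

lemma splits_Cons:
  "{(u, v). u @ v = a # w} = insert ([], a # w) ((\<lambda>(u, v). (a # u, v)) ` {(u, v). u @ v = w})"
  by (auto simp: append_eq_Cons_conv image_iff)

lemma finite_splits: "finite {(u, v). u @ v = w}"
  by (induction w) (auto simp: splits_Cons)

lemma conv_eq_sum: "conv f g w = (\<Sum>(u, v)\<in>{(u, v). u @ v = w}. f u * g v)"
proof (induction w arbitrary: f)
  case Nil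
  have "{(u, v). u @ v = []} = {([] :: 'a list, [] :: 'a list)}" by auto
  then show ?case by simp
next
  case (Cons a w)
  have "inj_on (\<lambda>(u, v). (a # u, v)) {(u, v). u @ v = w}" by (auto simp: inj_on_def)
  moreover have "([], a # w) \<notin> (\<lambda>(u, v). (a # u, v)) ` {(u, v). u @ v = w}" by auto
  ultimately show ?case
    unfolding splits_Cons using Cons finite_splits[of w]
    by (simp add: sum.reindex case_prod_unfold)
qed

definition factorizations :: "'a list \<Rightarrow> 'a list list set" where
  "factorizations w = {us. concat us = w \<and> [] \<notin> set us}"

text \<open>The star of the proper part of \<open>f\<close>: the value \<open>f []\<close> is
  ignored, since factors are nonempty. This keeps the sum finite for every \<open>f\<close> and is
  the usual star when \<open>f [] = 0\<close>.\<close>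

definition fstar :: "('a list \<Rightarrow> 'k::field) \<Rightarrow> 'a list \<Rightarrow> 'k" where
  "fstar f w = (\<Sum>us\<in>factorizations w. prod_list (map f us))"

lemma factorizations_Nil: "factorizations [] = {[]}"
proof -
  have "us = []" if "concat us = []" "[] \<notin> set us" for us :: "'a list list"
    using that by (cases us) auto
  then show ?thesis by (auto simp: factorizations_def)
qed

lemma factorizations_Cons:
  "factorizations (a # w) =
    (\<lambda>((u, v), us). (a # u) # us) ` (SIGMA uv : {(u, v). u @ v = w}. factorizations (snd uv))"
  (is "_ = ?h ` ?S")
proof (intro equalityI subsetI)
  fix us assume us: "us \<in> factorizations (a # w)"
  then obtain u us' where u: "us = u # us'" by (cases us) (auto simp: factorizations_def)
  then obtain u' where u': "u = a # u'" using us by (cases u) (auto simp: factorizations_def)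
  have "((u', concat us'), us') \<in> ?S" using us u u' by (auto simp: factorizations_def)
  moreover have "us = ?h ((u', concat us'), us')" using u u' by simp
  ultimately show "us \<in> ?h ` ?S" by blast
qed (auto simp: factorizations_def)

lemma inj_factorizations_Cons:
  "inj_on (\<lambda>((u, v), us). (a # u) # us)
    (SIGMA uv : {(u, v). u @ v = w}. factorizations (snd uv))"
  by (auto simp: inj_on_def)

lemma finite_factorizations: "finite (factorizations w)"
proof (induction "length w" arbitrary: w rule: less_induct)
  case less
  show ?case
  proof (cases w)
    case (Cons a w')
    have "finite (factorizations v)" if "u @ v = w'" for u v
      using that less Cons by auto
    then show ?thesis
      unfolding Cons factorizations_Cons by (auto intro!: finite_imageI finite_SigmaI finite_splits)
  qed (simp add: factorizations_Nil)
qed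

lemma fstar_Nil [simp]: "fstar f [] = 1"
  by (simp add: fstar_def factorizations_Nil)

text \<open>The letter \<open>a\<close> opens the first factor; the rest of that factor and the
  factorization of what follows can be chosen independently.\<close>

lemma fstar_Cons: "fstar f (a # w) = conv (\<lambda>u. f (a # u)) (fstar f) w"
proof -
  have "fstar f (a # w) =
      (\<Sum>((u, v), us)\<in>(SIGMA uv : {(u, v). u @ v = w}. factorizations (snd uv)).
        f (a # u) * prod_list (map f us))"
    unfolding fstar_def factorizations_Cons
    by (subst sum.reindex[OF inj_factorizations_Cons]) (auto intro!: sum.cong)
  also have "\<dots> = (\<Sum>uv\<in>{(u, v). u @ v = w}. \<Sum>us\<in>factorizations (snd uv).
        f (a # fst uv) * prod_list (map f us))"
    by (subst sum.Sigma) (auto simp: finite_splits finite_factorizations intro!: sum.cong)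
  also have "\<dots> = conv (\<lambda>u. f (a # u)) (fstar f) w"
    by (simp add: conv_eq_sum fstar_def sum_distrib_left case_prod_unfold)
  finally show ?thesis .
qed


section \<open>Weighted automata\<close>

record ('s, 'l, 'k) automaton =
  states :: "'s list"
  start :: 's
  weight :: "'s \<Rightarrow> 'l \<Rightarrow> 's \<Rightarrow> 'k"
  final :: "'s \<Rightarrow> 'k"

text \<open>The target \<open>None\<close> closes the path with the final weight,
  \<open>Some q\<close> demands the end state \<open>q\<close>. One recursion thus gives both
  behaviours and transition matrices.\<close>

primrec path :: "('s, 'l, 'k::field) automaton \<Rightarrow> 's \<Rightarrow> 'l list \<Rightarrow> 's option \<Rightarrow> 'k" where
  "path M p [] t = (case t of None \<Rightarrow> final M p | Some q \<Rightarrow> of_bool (p = q))"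
| "path M p (a # w) t = (\<Sum>s\<in>set (states M). weight M p a s * path M s w t)"

definition behaviour :: "('s, 'l, 'k::field) automaton \<Rightarrow> 'l list \<Rightarrow> 'k" where
  "behaviour M w = path M (start M) w None"

lemma path_append:
  assumes "p \<in> set (states M)"
  shows "path M p (u @ v) t = (\<Sum>s\<in>set (states M). path M p u (Some s) * path M s v t)"
  using assms
proof (induction u arbitrary: p)
  case Nil
  then show ?case by (simp add: of_bool_def if_distrib[of "\<lambda>x. x * _"] cong: if_cong)
next
  case (Cons a u)
  have "path M p ((a # u) @ v) t = (\<Sum>q\<in>set (states M). weight M p a q *
      (\<Sum>s\<in>set (states M). path M q u (Some s) * path M s v t))"
    using Cons by simp
  also have "\<dots> = (\<Sum>s\<in>set (states M). \<Sum>q\<in>set (states M). weight M p a q *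
      (path M q u (Some s) * path M s v t))"
    unfolding sum_distrib_left by (rule sum.swap)
  finally show ?case by (simp add: sum_distrib_right mult.assoc)
qed


subsection \<open>Linear dependence of reachable vectors\<close>

text \<open>Among \<open>n + 1\<close> vectors in dimension at most \<open>n\<close>, one lies in
  the span of its predecessors. Expressing it by earlier vectors, not by arbitrary ones, is what
  later makes words shorter.\<close>

lemma dependent_vectors:
  fixes x :: "nat \<Rightarrow> 's \<Rightarrow> 'k::field"
  assumes "finite Q" "card Q \<le> n"
  shows "\<exists>i\<le>n. \<exists>c. \<forall>q\<in>Q. x i q = (\<Sum>j<i. c j * x j q)"
proof (rule ccontr)
  assume neg: "\<not> ?thesis"
  define scale :: "'k \<Rightarrow> ('s \<Rightarrow> 'k) \<Rightarrow> 's \<Rightarrow> 'k" where "scale c f = (\<lambda>q. c * f q)" for c f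
  interpret vector_space scale
    by unfold_locales (auto simp: scale_def algebra_simps fun_eq_iff)
  \<comment> \<open>Cutting the vectors off outside \<open>Q\<close> puts them into the span of at
    most \<open>n\<close> unit vectors.\<close>
  define y where "y i = (\<lambda>q. if q \<in> Q then x i q else 0)" for i
  define \<delta> :: "'s \<Rightarrow> 's \<Rightarrow> 'k" where "\<delta> q = (\<lambda>p. of_bool (p = q))" for q
  have sum_apply: "sum g S q = (\<Sum>j\<in>S. g j q)" for g :: "'b \<Rightarrow> 's \<Rightarrow> 'k" and S q
    by (induction S rule: infinite_finite_induct) auto
  have y_eq: "y i = (\<Sum>q\<in>Q. scale (x i q) (\<delta> q))" for i
    using assms(1) by (auto simp: fun_eq_iff sum_apply scale_def \<delta>_def y_def)
  have in_span: "y i \<in> span (\<delta> ` Q)" for i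
    unfolding y_eq
  proof (rule span_sum)
    fix q assume "q \<in> Q"
    then have "\<delta> q \<in> span (\<delta> ` Q)" by (simp add: span_base)
    then show "scale (x i q) (\<delta> q) \<in> span (\<delta> ` Q)" by (rule span_scale)
  qed
  \<comment> \<open>The negated claim keeps every vector out of the span of its predecessors, so
    \<open>n + 1\<close> vectors would be independent in a space spanned by at most
    \<open>n\<close>.\<close>
  have notin: "y i \<notin> span (y ` {..<i})" if "i \<le> n" for i
  proof
    assume "y i \<in> span (y ` {..<i})"
    then have "\<exists>c. y i = (\<Sum>j<i. scale (c j) (y j))"
    proof (induction rule: span_induct_alt)
      case base
      show ?case by (rule exI[of _ "\<lambda>_. 0"]) (simp add: scale_def fun_eq_iff sum_apply)
    next
      case (step c z w)
      then obtain j d where j: "j < i" "z = y j" and d: "w = (\<Sum>j<i. scale (d j) (y j))" by auto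
      have "(\<Sum>k<i. (if k = j then c else 0) * y k q) = c * y j q" for q
        using j(1) by (simp add: if_distrib[of "\<lambda>x. x * _"] cong: if_cong)
      then have "scale c z + w = (\<Sum>k<i. scale ((if k = j then c else 0) + d k) (y k))"
        unfolding j d fun_eq_iff by (simp add: sum_apply scale_def sum.distrib distrib_right)
      then show ?case by (rule exI[of _ "\<lambda>k. (if k = j then c else 0) + d k"])
    qed
    then obtain c where "y i = (\<Sum>j<i. scale (c j) (y j))" by blast
    then have y_i: "y i q = (\<Sum>j<i. c j * y j q)" for q by (simp add: scale_def sum_apply)
    have "x i q = (\<Sum>j<i. c j * x j q)" if "q \<in> Q" for q
      using y_i[of q] that by (simp add: y_def)
    then show False using neg that by blast
  qed
  have "independent (y ` {..<i}) \<and> inj_on y {..<i}" if "i \<le> Suc n" for i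
    using that
  proof (induction i)
    case 0
    then show ?case by (simp add: independent_empty)
  next
    case (Suc i)
    then have ns: "y i \<notin> span (y ` {..<i})" using notin[of i] by simp
    then have "y i \<notin> y ` {..<i}" using span_base[of "y i" "y ` {..<i}"] by metis
    moreover have "independent (insert (y i) (y ` {..<i}))"
      using independent_insertI[OF ns] Suc by simp
    ultimately show ?case using Suc by (simp add: lessThan_Suc)
  qed
  then have "independent (y ` {..<Suc n})" "card (y ` {..<Suc n}) = Suc n"
    by (auto simp: card_image)
  moreover have "card (y ` {..<Suc n}) \<le> card (\<delta> ` Q)"
    using independent_span_bound[of "\<delta> ` Q" "y ` {..<Suc n}"] calculation(1) in_span assms(1)
    by blast
  moreover have "card (\<delta> ` Q) \<le> n" using card_image_le[OF assms(1)] assms(2) le_trans by blast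
  ultimately show False by simp
qed

text \<open>If \<open>u\<close> is long, the weight vectors of its prefixes \<open>take i u\<close>
  with \<open>i \<le> n\<close> are dependent. Exchanging a prefix for a combination of shorter ones
  in front of the same remainder reduces the claim to shorter words.\<close>

lemma vanishing_left:
  assumes p: "p \<in> set (states M)"
    and short: "\<And>u. u \<in> lists A \<Longrightarrow> length u \<le> length (states M) \<Longrightarrow> path M p (u @ y) None = 0"
  shows "u \<in> lists A \<Longrightarrow> path M p (u @ y) None = 0"
proof (induction "length u" arbitrary: u rule: less_induct)
  case less
  let ?n = "length (states M)"
  show ?case
  proof (cases "length u \<le> ?n")
    case False
    obtain i c where i: "i \<le> ?n" and c: "\<forall>q\<in>set (states M).
        path M p (take i u) (Some q) = (\<Sum>j<i. c j * path M p (take j u) (Some q))"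
      using dependent_vectors[of "set (states M)" ?n "\<lambda>i q. path M p (take i u) (Some q)"]
      by (auto simp: card_length)
    have "path M p (take i u @ drop i u @ y) None =
        (\<Sum>q\<in>set (states M). \<Sum>j<i. c j * (path M p (take j u) (Some q) * path M q (drop i u @ y) None))"
      by (subst path_append[OF p]) (auto simp: c sum_distrib_right mult.assoc)
    also have "\<dots> = (\<Sum>j<i. c j * path M p (take j u @ drop i u @ y) None)"
      by (subst sum.swap) (simp add: path_append[OF p] sum_distrib_left)
    also have "\<dots> = (\<Sum>j<i. c j * path M p ((take j u @ drop i u) @ y) None)" by simp
    also have "\<dots> = 0"
    proof (rule sum.neutral, intro ballI)
      fix j assume "j \<in> {..<i}"
      then have "path M p ((take j u @ drop i u) @ y) None = 0"
        using False i less(2) by (intro less(1)) (auto dest: in_set_takeD in_set_dropD)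
      then show "c j * path M p ((take j u @ drop i u) @ y) None = 0" by simp
    qed
    finally show ?thesis by (metis append.assoc append_take_drop_id)
  qed (use less short in auto)
qed

lemma vanishing_right:
  assumes p: "p \<in> set (states M)"
    and short: "\<And>v. v \<in> lists A \<Longrightarrow> length v \<le> length (states M) \<Longrightarrow> path M p (y @ v) None = 0"
  shows "v \<in> lists A \<Longrightarrow> path M p (y @ v) None = 0"
proof (induction "length v" arbitrary: v rule: less_induct)
  case less
  let ?n = "length (states M)"
  \<comment> \<open>The dual argument: \<open>d i\<close> consists of the last \<open>i\<close>
    letters, and the dependent vectors collect the weights from each state to the end.\<close>
  define d t where "d i = drop (length v - i) v" and "t i = take (length v - i) v" for i
  have dt: "length v = length (t i) + length (d i)" "v = t i @ d i" for i
    by (simp_all add: d_def t_def)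
  show ?case
  proof (cases "length v \<le> ?n")
    case False
    obtain i c where i: "i \<le> ?n" and c: "\<forall>q\<in>set (states M).
        path M q (d i) None = (\<Sum>j<i. c j * path M q (d j) None)"
      using dependent_vectors[of "set (states M)" ?n "\<lambda>i q. path M q (d i) None"]
      by (auto simp: card_length)
    have "path M p ((y @ t i) @ d i) None =
        (\<Sum>q\<in>set (states M). \<Sum>j<i. c j * (path M p (y @ t i) (Some q) * path M q (d j) None))"
      by (subst path_append[OF p]) (auto simp: c sum_distrib_left mult_ac)
    also have "\<dots> = (\<Sum>j<i. c j * path M p ((y @ t i) @ d j) None)"
      by (subst sum.swap) (simp only: path_append[OF p] sum_distrib_left)
    also have "\<dots> = (\<Sum>j<i. c j * path M p (y @ t i @ d j) None)" by simp
    also have "\<dots> = 0"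
    proof (rule sum.neutral, intro ballI)
      fix j assume j: "j \<in> {..<i}"
      have "set (t i) \<subseteq> set v" "set (d j) \<subseteq> set v"
        by (auto simp: t_def d_def dest: in_set_takeD in_set_dropD)
      then have "path M p (y @ t i @ d j) None = 0"
        using False i less(2) j by (intro less(1)) (auto simp: t_def d_def)
      then show "c j * path M p (y @ t i @ d j) None = 0" by simp
    qed
    finally show ?thesis using dt(2)[of i] by simp
  qed (use less short in auto)
qed

subsection \<open>Closure constructions\<close>

text \<open>One type of states closed under all constructions, so that the automata of all
  expressions, of whatever nesting depth, share a single type.\<close>

datatype 'x state =
    Init
  | Rest "'x word"
  | InL "'x state"
  | InR "'x state"
  | After "'x word" "'x state"

type_synonym ('x, 'k) word_automaton = "('x state, 'x letter, 'k) automaton"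

definition coefficient :: "('k::field \<times> 'x word) list \<Rightarrow> 'x word \<Rightarrow> 'k" where
  "coefficient cs w = (\<Sum>(c, u)\<leftarrow>cs. if u = w then c else 0)"

primrec rests :: "'x word \<Rightarrow> 'x state list" where
  "rests [] = [Rest []]"
| "rests (a # w) = Rest (a # w) # rests w"

text \<open>The first letter chooses the monomial and pays its whole coefficient;
  \<open>Rest v\<close> then accepts exactly \<open>v\<close>, with weight \<open>1\<close>.
  Repeated monomials are added up in \<open>coefficient\<close>, not by parallel
  transitions.\<close>

definition lin_automaton :: "('k::field \<times> 'x word) list \<Rightarrow> ('x, 'k) word_automaton" where
  "lin_automaton cs = \<lparr>
    states = remdups (concat (map (\<lambda>(c, w). rests w) cs) @ [Init]),
    start = Init,
    weight = (\<lambda>p a q. case q of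
        Rest v \<Rightarrow> (case p of Init \<Rightarrow> coefficient cs (a # v) | Rest u \<Rightarrow> of_bool (u = a # v) | _ \<Rightarrow> 0)
      | _ \<Rightarrow> 0),
    final = (\<lambda>p. case p of Init \<Rightarrow> coefficient cs [] | Rest u \<Rightarrow> of_bool (u = []) | _ \<Rightarrow> 0)\<rparr>"

definition plus_automaton ::
  "('x, 'k::field) word_automaton \<Rightarrow> ('x, 'k) word_automaton \<Rightarrow> ('x, 'k) word_automaton" where
  "plus_automaton M N = \<lparr>
    states = Init # map InL (states M) @ map InR (states N),
    start = Init,
    weight = (\<lambda>p a q. case q of
        InL q' \<Rightarrow> (case p of Init \<Rightarrow> weight M (start M) a q' | InL p' \<Rightarrow> weight M p' a q' | _ \<Rightarrow> 0)
      | InR q' \<Rightarrow> (case p of Init \<Rightarrow> weight N (start N) a q' | InR p' \<Rightarrow> weight N p' a q' | _ \<Rightarrow> 0)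
      | _ \<Rightarrow> 0),
    final = (\<lambda>p. case p of Init \<Rightarrow> final M (start M) + final N (start N)
      | InL p' \<Rightarrow> final M p' | InR p' \<Rightarrow> final N p' | _ \<Rightarrow> 0)\<rparr>"

text \<open>There are no empty transitions: a final weight of \<open>M\<close> is multiplied
  directly onto the first transition, or onto the final weight, of the start of
  \<open>N\<close>.\<close>

definition times_automaton ::
  "('x, 'k::field) word_automaton \<Rightarrow> ('x, 'k) word_automaton \<Rightarrow> ('x, 'k) word_automaton" where
  "times_automaton M N = \<lparr>
    states = map InL (states M) @ map InR (states N),
    start = InL (start M),
    weight = (\<lambda>p a q. case q of
        InL q' \<Rightarrow> (case p of InL p' \<Rightarrow> weight M p' a q' | _ \<Rightarrow> 0)
      | InR q' \<Rightarrow> (case p of InL p' \<Rightarrow> final M p' * weight N (start N) a q'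
          | InR p' \<Rightarrow> weight N p' a q' | _ \<Rightarrow> 0)
      | _ \<Rightarrow> 0),
    final = (\<lambda>p. case p of InL p' \<Rightarrow> final M p' * final N (start N) | InR p' \<Rightarrow> final N p' | _ \<Rightarrow> 0)\<rparr>"

text \<open>\<open>Init\<close> copies the outgoing transitions of the start of \<open>M\<close> but
  has final weight \<open>1\<close>. The weight that \<open>M\<close> gives to the empty word thus
  drops out, in agreement with \<open>fstar\<close>.\<close>

definition star_automaton :: "('x, 'k::field) word_automaton \<Rightarrow> ('x, 'k) word_automaton" where
  "star_automaton M = \<lparr>
    states = Init # map InL (states M),
    start = Init,
    weight = (\<lambda>p a q. case q of
        InL q' \<Rightarrow> (case p of Init \<Rightarrow> weight M (start M) a q'
          | InL p' \<Rightarrow> weight M p' a q' + final M p' * weight M (start M) a q' | _ \<Rightarrow> 0)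
      | _ \<Rightarrow> 0),
    final = (\<lambda>p. case p of Init \<Rightarrow> 1 | InL p' \<Rightarrow> final M p' | _ \<Rightarrow> 0)\<rparr>"

definition well_formed :: "('s, 'l, 'k) automaton \<Rightarrow> bool" where
  "well_formed M \<longleftrightarrow> distinct (states M) \<and> start M \<in> set (states M)"

lemma set_rests: "set (rests w) = Rest ` {v. suffix v w}"
  by (induction w) (auto simp: suffix_Cons)

lemma states_lin:
  "set (states (lin_automaton cs)) = insert Init (Rest ` {v. \<exists>(c, w)\<in>set cs. suffix v w})"
  by (auto simp: lin_automaton_def set_rests)

lemma well_formed_lin: "well_formed (lin_automaton cs)"
  by (simp add: well_formed_def lin_automaton_def)

lemma well_formed_plus: "well_formed M \<Longrightarrow> well_formed N \<Longrightarrow> well_formed (plus_automaton M N)"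
  by (auto simp: well_formed_def plus_automaton_def distinct_map inj_on_def)

lemma well_formed_times: "well_formed M \<Longrightarrow> well_formed N \<Longrightarrow> well_formed (times_automaton M N)"
  by (auto simp: well_formed_def times_automaton_def distinct_map inj_on_def)

lemma well_formed_star: "well_formed M \<Longrightarrow> well_formed (star_automaton M)"
  by (auto simp: well_formed_def star_automaton_def distinct_map inj_on_def)

lemma sum_In:
  assumes "finite S" "finite T"
  shows "(\<Sum>s\<in>InL ` S \<union> InR ` T. f s) = (\<Sum>s\<in>S. f (InL s)) + (\<Sum>s\<in>T. f (InR s))"
    "(\<Sum>s\<in>insert Init (InL ` S \<union> InR ` T). f s) =
      f Init + ((\<Sum>s\<in>S. f (InL s)) + (\<Sum>s\<in>T. f (InR s)))"
proof -
  have "(\<Sum>s\<in>InL ` S \<union> InR ` T. f s) = sum f (InL ` S) + sum f (InR ` T)"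
    using assms by (intro sum.union_disjoint) auto
  then show *: "(\<Sum>s\<in>InL ` S \<union> InR ` T. f s) = (\<Sum>s\<in>S. f (InL s)) + (\<Sum>s\<in>T. f (InR s))"
    by (simp add: sum.reindex inj_on_def)
  show "(\<Sum>s\<in>insert Init (InL ` S \<union> InR ` T). f s) =
      f Init + ((\<Sum>s\<in>S. f (InL s)) + (\<Sum>s\<in>T. f (InR s)))"
    using assms * by (subst sum.insert) auto
qed

lemma sum_Init_InL:
  "finite S \<Longrightarrow> (\<Sum>s\<in>insert Init (InL ` S). f s) = f Init + (\<Sum>s\<in>S. f (InL s))"
  by (subst sum.insert) (auto simp: sum.reindex inj_on_def)

lemma path_Rest:
  "Rest u \<in> set (states (lin_automaton cs)) \<Longrightarrow>
    path (lin_automaton cs) (Rest u) w None = of_bool (u = w)"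
proof (induction w arbitrary: u)
  case Nil
  then show ?case by (simp add: lin_automaton_def)
next
  case (Cons a w)
  let ?M = "lin_automaton cs"
  have "path ?M (Rest u) (a # w) None =
      (\<Sum>s\<in>set (states ?M). if s = Rest w then of_bool (u = a # w) else 0)"
    unfolding path.simps
  proof (rule sum.cong)
    fix s assume s: "s \<in> set (states ?M)"
    show "weight ?M (Rest u) a s * path ?M s w None = (if s = Rest w then of_bool (u = a # w) else 0)"
    proof (cases s)
      case (Rest v)
      then show ?thesis using Cons.IH[of v] s by (auto simp: lin_automaton_def)
    qed (simp_all add: lin_automaton_def)
  qed simp
  also have "\<dots> = (if Rest w \<in> set (states ?M) then of_bool (u = a # w) else 0)" by simp
  also have "\<dots> = of_bool (u = a # w)"
    using Cons.prems by (auto simp: states_lin dest: suffix_ConsD)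
  finally show ?case .
qed

lemma behaviour_lin: "behaviour (lin_automaton cs) w = coefficient cs w"
proof (cases w)
  case Nil
  then show ?thesis by (simp add: behaviour_def lin_automaton_def)
next
  case (Cons a v)
  let ?M = "lin_automaton cs"
  have "path ?M Init (a # v) None =
      (\<Sum>s\<in>set (states ?M). if s = Rest v then coefficient cs (a # v) else 0)"
    unfolding path.simps
  proof (rule sum.cong)
    fix s assume s: "s \<in> set (states ?M)"
    show "weight ?M Init a s * path ?M s v None = (if s = Rest v then coefficient cs (a # v) else 0)"
    proof (cases s)
      case (Rest u)
      then show ?thesis using path_Rest[of u cs v] s by (auto simp: lin_automaton_def)
    qed (simp_all add: lin_automaton_def)
  qed simp
  also have "\<dots> = (if Rest v \<in> set (states ?M) then coefficient cs (a # v) else 0)" by simp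
  also have "\<dots> = coefficient cs (a # v)"
  proof (cases "Rest v \<in> set (states ?M)")
    case False
    then have "\<forall>(c, w)\<in>set cs. \<not> suffix v w" by (auto simp: states_lin)
    then have "\<forall>(c, w)\<in>set cs. w \<noteq> a # v" by (auto simp: suffix_Cons)
    then have "coefficient cs (a # v) = 0" unfolding coefficient_def by (induction cs) auto
    then show ?thesis by simp
  qed simp
  finally show ?thesis using Cons by (simp add: behaviour_def lin_automaton_def)
qed

lemma path_plus:
  "path (plus_automaton M N) (InL p) w None = path M p w None"
  "path (plus_automaton M N) (InR q) w None = path N q w None"
proof (induction w arbitrary: p q)
  case (Cons a w)
  { case 1 show ?case using Cons by (simp add: plus_automaton_def sum_In) }
  { case 2 show ?case using Cons by (simp add: plus_automaton_def sum_In) }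
qed (simp_all add: plus_automaton_def)

lemma behaviour_plus: "behaviour (plus_automaton M N) w = behaviour M w + behaviour N w"
proof (cases w)
  case (Cons a v)
  then show ?thesis
    by (simp add: behaviour_def plus_automaton_def sum_In flip: path_plus[of M N])
qed (simp add: behaviour_def plus_automaton_def)

lemma path_times:
  "path (times_automaton M N) (InR q) w None = path N q w None"
  "path (times_automaton M N) (InL p) w None =
    conv (\<lambda>u. path M p u None) (behaviour N) w"
proof (induction w arbitrary: p q)
  case (Cons a w)
  { case 1 show ?case using Cons by (simp add: times_automaton_def sum_In) }
  { case 2 show ?case using Cons
    by (simp add: times_automaton_def sum_In conv_sum_left behaviour_def sum_distrib_left
        mult.assoc add.commute) }
qed (simp_all add: times_automaton_def behaviour_def)

lemma behaviour_times: "behaviour (times_automaton M N) w = conv (behaviour M) (behaviour N) w"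
proof -
  have "start (times_automaton M N) = InL (start M)" by (simp add: times_automaton_def)
  then show ?thesis
    unfolding behaviour_def[of "times_automaton M N"]
    by (simp add: path_times behaviour_def[of M, abs_def])
qed

lemma path_star:
  "path (star_automaton M) (InL p) w None =
    conv (\<lambda>u. path M p u None) (fstar (behaviour M)) w"
proof (induction w arbitrary: p)
  case (Cons a w)
  have "path (star_automaton M) (InL p) (a # w) None =
    (\<Sum>s\<in>set (states M). weight M p a s * conv (\<lambda>u. path M s u None) (fstar (behaviour M)) w) +
    final M p * (\<Sum>s\<in>set (states M).
      weight M (start M) a s * conv (\<lambda>u. path M s u None) (fstar (behaviour M)) w)"
    using Cons by (simp add: star_automaton_def sum_Init_InL sum.distrib sum_distrib_left algebra_simps)
  also have "\<dots> = conv (\<lambda>u. path M p u None) (fstar (behaviour M)) (a # w)"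
    by (simp add: conv_sum_left fstar_Cons behaviour_def[of M] add.commute)
  finally show ?case .
qed (simp add: star_automaton_def)

lemma behaviour_star: "behaviour (star_automaton M) w = fstar (behaviour M) w"
proof (cases w)
  case (Cons a v)
  have "path (star_automaton M) Init (a # v) None =
      (\<Sum>s\<in>set (states M). weight M (start M) a s * path (star_automaton M) (InL s) v None)"
    by (simp add: star_automaton_def sum_Init_InL)
  also have "\<dots> = fstar (behaviour M) (a # v)"
    by (simp add: path_star fstar_Cons conv_sum_left behaviour_def[of M])
  finally have "path (star_automaton M) Init (a # v) None = fstar (behaviour M) (a # v)" .
  moreover have "start (star_automaton M) = Init" by (simp add: star_automaton_def)
  ultimately show ?thesis using Cons by (simp only: behaviour_def)
qed (simp add: behaviour_def star_automaton_def)


subsection \<open>Free reduction of an automaton\<close>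

text \<open>For \<open>y = [a]\<close> the condition on suffixes singles out first passages, which
  makes the factors unique. For \<open>y = []\<close> it is dropped, because the trivial tail of a
  word is taken as one factor.\<close>

definition passages :: "'x word \<Rightarrow> 'x word list \<Rightarrow> 'x word list" where
  "passages y ws = filter (\<lambda>w. nf w = y \<and> (y = [] \<or> no_trivial_suffix w)) ws"

text \<open>The list \<open>ws\<close> contains the factors that are summed over. A word with normal form
  \<open>a\<^sub>1 \<dots> a\<^sub>l\<close> factors uniquely as \<open>x\<^sub>1 \<dots> x\<^sub>l d\<close> where \<open>x\<^sub>i\<close> passes to \<open>a\<^sub>i\<close> for the first time, and \<open>d\<close>
  reduces to \<open>1\<close>. The state \<open>After l p\<close> remembers the last letter, to block unreduced words.\<close>

definition red_automaton ::
  "'x letter list \<Rightarrow> 'x word list \<Rightarrow> ('x, 'k::field) word_automaton \<Rightarrow> ('x, 'k) word_automaton" where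
  "red_automaton A ws M = \<lparr>
    states = After [] (start M) # concat (map (\<lambda>a. map (After [a]) (states M)) A),
    start = After [] (start M),
    weight = (\<lambda>p a q. case p of
        After l p' \<Rightarrow> (case q of
            After l' q' \<Rightarrow>
              if l' = [a] \<and> l \<noteq> [inv_letter a]
              then \<Sum>w\<leftarrow>passages [a] ws. path M p' w (Some q') else 0
          | _ \<Rightarrow> 0)
      | _ \<Rightarrow> 0),
    final = (\<lambda>p. case p of After l p' \<Rightarrow> \<Sum>w\<leftarrow>passages [] ws. path M p' w None | _ \<Rightarrow> 0)\<rparr>"

lemma start_red: "start (red_automaton A ws M) = After [] (start M)"
  by (simp add: red_automaton_def)

lemma well_formed_red:
  assumes "well_formed M" "distinct A"
  shows "well_formed (red_automaton A ws M)"
proof -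
  have "distinct (concat (map (\<lambda>a. map (After [a]) (states M)) A))"
    using assms(2) by (induction A) (use assms(1) in \<open>auto simp: well_formed_def distinct_map inj_on_def\<close>)
  then show ?thesis by (auto simp: well_formed_def red_automaton_def)
qed

primrec words :: "'x letter list \<Rightarrow> nat \<Rightarrow> 'x word list" where
  "words A 0 = [[]]"
| "words A (Suc n) = [] # concat (map (\<lambda>a. map (\<lambda>w. a # w) (words A n)) A)"

lemma set_words: "set (words A n) = {w \<in> lists (set A). length w \<le> n}"
proof (induction n)
  case (Suc n)
  have "w \<in> set (words A (Suc n)) \<longleftrightarrow> w \<in> {w \<in> lists (set A). length w \<le> Suc n}" for w
    using Suc by (cases w) auto
  then show ?case by blast
qed auto

lemma distinct_words: "distinct A \<Longrightarrow> distinct (words A n)"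
proof (induction n)
  case (Suc n)
  have "distinct (concat (map (\<lambda>a. map (\<lambda>w. a # w) (words A n)) A'))" if "distinct A'" for A'
    using that by (induction A') (use Suc in \<open>auto simp: distinct_map\<close>)
  then show ?case using Suc.prems by auto
qed simp

declare words.simps [simp del]

text \<open>The words of length at most the number of states suffice to test vanishing in all contexts.
  A trivial word of length greater than \<open>2m + 2\<close> has the form \<open>b d b\<^sup>-\<^sup>1 z\<close> with trivial \<open>d\<close> and \<open>z\<close>
  one of which is longer than \<open>m\<close>, so that the test up to length \<open>2m + 2\<close> is conclusive.\<close>

definition bound_ok :: "'x letter list \<Rightarrow> ('s, 'x letter, 'k::field) automaton \<Rightarrow> nat \<Rightarrow> bool" where
  "bound_ok A M m \<longleftrightarrow> (\<forall>w \<in> set (words A (2 * m + 2)). nf w = [] \<and> w \<notin> set (words A m) \<longrightarrow>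
    (\<forall>u \<in> set (words A (length (states M))). \<forall>v \<in> set (words A (length (states M))).
      behaviour M (u @ w @ v) = 0))"

text \<open>Arbitrary contexts are needed for the induction: when \<open>d\<close> or
  \<open>z\<close> is the long part, the letters around it move into \<open>u\<close> and
  \<open>v\<close>.\<close>

lemma bound_ok_vanishing:
  assumes wf: "well_formed M" and ok: "bound_ok A M m"
  shows "nf w = [] \<Longrightarrow> w \<in> lists (set A) \<Longrightarrow> m < length w \<Longrightarrow>
    u \<in> lists (set A) \<Longrightarrow> v \<in> lists (set A) \<Longrightarrow> behaviour M (u @ w @ v) = 0"
proof (induction "length w" arbitrary: w u v rule: less_induct)
  case less
  have p: "start M \<in> set (states M)" using wf by (simp add: well_formed_def)
  show ?case
  proof (cases "length w \<le> 2 * m + 2")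
    case True
    have "path M (start M) (u' @ w @ v') None = 0"
      if "u' \<in> lists (set A)" "v' \<in> lists (set A)"
        "length u' \<le> length (states M)" "length v' \<le> length (states M)" for u' v'
      using ok that less.prems True unfolding bound_ok_def behaviour_def by (auto simp: set_words)
    \<comment> \<open>The context is lengthened one side at a time: first \<open>u\<close> is
      arbitrary with \<open>v'\<close> still short, then the right side follows.\<close>
    then have "path M (start M) (u @ w @ v') None = 0"
      if "v' \<in> lists (set A)" "length v' \<le> length (states M)" for v'
      using vanishing_left[OF p, of "set A" "w @ v'" u] that less.prems(4) by simp
    then show ?thesis
      using vanishing_right[OF p, of "set A" "u @ w" v] less.prems(5) by (simp add: behaviour_def)
  next
    case False
    then have "w \<noteq> []" by auto
    then obtain b d z where w: "w = b # d @ inv_letter b # z" "nf d = []" "nf z = []"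
      using trivial_word_split[OF less.prems(1)] by blast
    then have "m < length d \<or> m < length z" using False by auto
    then show ?thesis
    proof
      assume "m < length d"
      then have "behaviour M ((u @ [b]) @ d @ (inv_letter b # z @ v)) = 0"
        using w less.prems by (intro less.hyps) auto
      then show ?thesis using w by simp
    next
      assume "m < length z"
      then have "behaviour M ((u @ b # d @ [inv_letter b]) @ z @ v) = 0"
        using w less.prems by (intro less.hyps) auto
      then show ?thesis using w by simp
    qed
  qed
qed

lemma bound_ok_exists:
  assumes "\<And>v. finite {w \<in> lists (set A). nf w = v \<and> behaviour M w \<noteq> 0}"
  shows "\<exists>m. bound_ok A M m"
proof -
  let ?W = "set (words A (length (states M)))"
  \<comment> \<open>The words that survive in some short context. For fixed \<open>u\<close> and
    \<open>v\<close> the map to \<open>u @ w @ v\<close> is injective, and a trivial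
    \<open>w\<close> lands over the single normal form \<open>nf (u @ v)\<close>, where only
    finitely many words have nonzero weight.\<close>
  define D where "D = (\<Union>u\<in>?W. \<Union>v\<in>?W.
    {w. u @ w @ v \<in> {z \<in> lists (set A). nf z = nf (u @ v) \<and> behaviour M z \<noteq> 0}})"
  have "finite {w. u @ w @ v \<in> {z \<in> lists (set A). nf z = nf (u @ v) \<and> behaviour M z \<noteq> 0}}" for u v
    using finite_vimageI[OF assms, of "\<lambda>w. u @ w @ v"] by (simp add: vimage_def inj_def)
  then have fin: "finite D" unfolding D_def by blast
  then obtain m where "\<forall>n\<in>length ` D. n \<le> m"
    using finite_nat_set_iff_bounded_le[of "length ` D"] by blast
  then have m: "w \<in> D \<Longrightarrow> length w \<le> m" for w by blast
  have "bound_ok A M m"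
    unfolding bound_ok_def
  proof (intro ballI impI, elim conjE, rule ccontr)
    fix w u v
    assume w: "w \<in> set (words A (2 * m + 2))" "nf w = []" "w \<notin> set (words A m)"
      and uv: "u \<in> ?W" "v \<in> ?W" "behaviour M (u @ w @ v) \<noteq> 0"
    have "nf (u @ w @ v) = nf (u @ v)" using w(2) by (simp add: nf_append[of u])
    then have "w \<in> D" using w(1) uv unfolding D_def by (auto simp: set_words)
    then show False using m w(1,3) by (auto simp: set_words)
  qed
  then show ?thesis by blast
qed

text \<open>The part of the fibre of \<open>nf\<close> over a reduced \<open>v\<close> in which
  every first passage and the trivial tail have length at most \<open>n\<close>.\<close>

primrec factored :: "'x letter list \<Rightarrow> nat \<Rightarrow> 'x word \<Rightarrow> 'x word set" where
  "factored A n [] = set (passages [] (words A n))"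
| "factored A n (a # v) =
    (\<lambda>(x, z). x @ z) ` (set (passages [a] (words A n)) \<times> factored A n v)"

lemma set_passages:
  "set (passages y (words A n)) =
    {w \<in> lists (set A). length w \<le> n \<and> nf w = y \<and> (y = [] \<or> no_trivial_suffix w)}"
  by (auto simp: passages_def set_words)

lemma finite_factored: "finite (factored A n v)"
  by (induction v) auto

lemma factored_lists: "factored A n v \<subseteq> lists (set A)"
proof (induction v)
  case (Cons a v)
  then have step: "x @ z \<in> lists (set A)"
    if "x \<in> set (passages [a] (words A n))" "z \<in> factored A n v" for x z
    using that by (auto simp: set_passages)
  show ?case
    unfolding factored.simps by (rule image_subsetI, erule SigmaE, simp only: split, rule step)
qed (auto simp: set_passages)

lemma nf_factored: "w \<in> factored A n v \<Longrightarrow> reduced v \<Longrightarrow> nf w = v"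
proof (induction v arbitrary: w)
  case (Cons a v)
  then show ?case
    by (auto simp: set_passages nf_append reduced_Cons push_reduced[unfolded reduced_Cons])
qed (auto simp: set_passages)

text \<open>Uniqueness of the first passage makes the concatenation in \<open>factored\<close>
  injective, so no word is counted twice.\<close>

lemma sum_factored_Cons:
  "(\<Sum>w\<in>factored A n (a # v). f w) =
    (\<Sum>x\<in>set (passages [a] (words A n)). \<Sum>z\<in>factored A n v. f (x @ z))"
proof -
  have "inj_on (\<lambda>(x, z). x @ z) (set (passages [a] (words A n)) \<times> factored A n v)"
    unfolding inj_on_def set_passages by (auto dest: first_passage_unique)
  then show ?thesis
    by (simp add: sum.reindex sum.cartesian_product case_prod_unfold)
qed

text \<open>A first passage to \<open>a\<close> is a trivial word followed by \<open>a\<close>.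
  Hence a passage longer than \<open>m + 1\<close> contains a trivial factor longer than
  \<open>m\<close>; this is the origin of \<open>Suc m\<close>.\<close>

lemma not_factored:
  assumes "nf w = v" "w \<in> lists (set A)" "w \<notin> factored A (Suc m) v"
  shows "\<exists>u d z. w = u @ d @ z \<and> nf d = [] \<and> m < length d"
  using assms
proof (induction v arbitrary: w)
  case Nil
  then have "\<not> length w \<le> Suc m" by (simp add: set_passages del: words.simps)
  then show ?case using Nil by (intro exI[of _ "[]"] exI[of _ w]) auto
next
  case (Cons a v)
  obtain x z where x: "w = x @ z" "nf x = [a]" "no_trivial_suffix x" "nf z = v"
    using first_passage_exists[OF Cons.prems(1)] by blast
  show ?case
  proof (cases "length x \<le> Suc m")
    case True
    then have "x \<in> set (passages [a] (words A (Suc m)))"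
      using x Cons.prems by (auto simp: set_passages)
    then have "z \<notin> factored A (Suc m) v" using Cons.prems(3) x(1) by (auto simp: image_iff)
    then obtain u d y where "z = u @ d @ y" "nf d = []" "m < length d"
      using Cons.IH[OF x(4)] Cons.prems x(1) by auto
    then show ?thesis using x(1) by (intro exI[of _ "x @ u"] exI[of _ d] exI[of _ y]) auto
  next
    case False
    obtain d y where d: "x = d @ a # y" "nf d = []" "nf y = []"
      using nf_split[OF x(2)] by blast
    \<comment> \<open>\<open>y\<close> is a trivial suffix of a first passage.\<close>
    have "y = []"
      using x(3) d(3) unfolding no_trivial_suffix_iff d(1) by (metis append.assoc append_Cons append_Nil)
    then show ?thesis using False d x(1) by (intro exI[of _ "[]"] exI[of _ d] exI[of _ "a # z"]) auto
  qed
qed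

text \<open>The guard \<open>l \<noteq> [inv_letter a]\<close> removes exactly the unreduced words.
  For the others the transitions sum over the states between consecutive factors, and
  \<open>path_append\<close> merges these sums into paths of \<open>M\<close> along the concatenated
  word.\<close>

lemma path_red:
  assumes wf: "well_formed M" and A: "distinct A" and ws: "ws = words A n"
  shows "p \<in> set (states M) \<Longrightarrow> reduced l \<Longrightarrow> length l \<le> 1 \<Longrightarrow> v \<in> lists (set A) \<Longrightarrow>
    path (red_automaton A ws M) (After l p) v None =
      (if reduced (l @ v) then \<Sum>w\<in>factored A n v. path M p w None else 0)"
proof (induction v arbitrary: p l)
  case Nil
  have "distinct (passages [] ws)" by (simp add: passages_def ws distinct_words A)
  then show ?case using Nil by (simp add: red_automaton_def ws sum_list_distinct_conv_sum_set)
next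
  case (Cons a v)
  let ?R = "red_automaton A ws M"
  define P where "P = set (passages [a] ws)"
  have P: "distinct (passages [a] ws)" by (simp add: passages_def ws distinct_words A)
  define S where "S = set (states M)"
  have T: "weight ?R (After l p) a (After l' q) =
      (if l' = [a] \<and> l \<noteq> [inv_letter a] then \<Sum>x\<in>P. path M p x (Some q) else 0)" for l' q
    using P by (simp add: red_automaton_def P_def sum_list_distinct_conv_sum_set)
  have "a \<in> set A" using Cons.prems by auto
  have "path ?R (After l p) (a # v) None =
      (\<Sum>s\<in>After [a] ` S. weight ?R (After l p) a s * path ?R s v None)"
    unfolding path.simps
  proof (rule sum.mono_neutral_right)
    show "After [a] ` S \<subseteq> set (states ?R)" using \<open>a \<in> set A\<close> by (auto simp: red_automaton_def S_def)
    show "\<forall>s\<in>set (states ?R) - After [a] ` S. weight ?R (After l p) a s * path ?R s v None = 0"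
      by (auto simp: T red_automaton_def[of A ws M, THEN arg_cong[where f = states]] S_def)
  qed simp
  also have "\<dots> = (\<Sum>q\<in>S. weight ?R (After l p) a (After [a] q) * path ?R (After [a] q) v None)"
    by (simp add: sum.reindex inj_on_def)
  also have "\<dots> = (\<Sum>q\<in>S. if reduced (l @ a # v)
      then \<Sum>x\<in>P. \<Sum>z\<in>factored A n v. path M p x (Some q) * path M q z None else 0)"
  proof (rule sum.cong)
    fix q assume "q \<in> S"
    then have IH: "path ?R (After [a] q) v None =
        (if reduced (a # v) then \<Sum>w\<in>factored A n v. path M q w None else 0)"
      using Cons.IH[of q "[a]"] Cons.prems by (auto simp: S_def reduced_Cons)
    have "reduced (l @ a # v) \<longleftrightarrow> l \<noteq> [inv_letter a] \<and> reduced (a # v)"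
      using Cons.prems(3) by (cases l) (auto simp: reduced_Cons)
    then show "weight ?R (After l p) a (After [a] q) * path ?R (After [a] q) v None =
        (if reduced (l @ a # v)
         then \<Sum>x\<in>P. \<Sum>z\<in>factored A n v. path M p x (Some q) * path M q z None else 0)"
      by (simp add: T IH sum_product)
  qed simp
  also have "\<dots> = (if reduced (l @ a # v)
      then \<Sum>x\<in>P. \<Sum>z\<in>factored A n v. \<Sum>q\<in>S. path M p x (Some q) * path M q z None else 0)"
    by (simp add: sum.swap[of _ _ S])
  also have "\<dots> = (if reduced (l @ a # v) then \<Sum>w\<in>factored A n (a # v). path M p w None else 0)"
    unfolding sum_factored_Cons P_def S_def ws by (simp add: path_append[OF Cons.prems(1)])
  finally show ?case .
qed

text \<open>Both sums extend to the union of \<open>W\<close> and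
  \<open>factored A (Suc m) v\<close>: a word outside the second set has a trivial factor longer
  than \<open>m\<close> and so weight zero, and a word outside \<open>W\<close> vanishes by
  hypothesis.\<close>

lemma behaviour_red:
  assumes "well_formed M" "distinct A" "bound_ok A M m" "v \<in> lists (set A)"
    and W: "finite W" "\<And>w. w \<in> W \<Longrightarrow> w \<in> lists (set A) \<and> nf w = v"
      "\<And>w. w \<in> lists (set A) \<Longrightarrow> nf w = v \<Longrightarrow> w \<notin> W \<Longrightarrow> behaviour M w = 0"
  shows "behaviour (red_automaton A (words A (Suc m)) M) v = (\<Sum>w\<in>W. behaviour M w)"
proof -
  have b: "behaviour (red_automaton A (words A (Suc m)) M) v =
      (if reduced v then \<Sum>w\<in>factored A (Suc m) v. behaviour M w else 0)"
    using path_red[OF assms(1,2) refl, of "start M" "[]" v] assms(1,4)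
    by (simp add: behaviour_def start_red well_formed_def)
  show ?thesis
  proof (cases "reduced v")
    case True
    have "(\<Sum>w\<in>factored A (Suc m) v. behaviour M w) =
        (\<Sum>w\<in>factored A (Suc m) v \<union> W. behaviour M w)"
    proof (rule sum.mono_neutral_left)
      show "\<forall>w\<in>factored A (Suc m) v \<union> W - factored A (Suc m) v. behaviour M w = 0"
      proof
        fix w assume "w \<in> factored A (Suc m) v \<union> W - factored A (Suc m) v"
        then have w: "w \<in> lists (set A)" "nf w = v" "w \<notin> factored A (Suc m) v" using W(2) by auto
        then obtain u d z where "w = u @ d @ z" "nf d = []" "m < length d"
          using not_factored[OF w(2,1,3)] by blast
        then show "behaviour M w = 0"
          using bound_ok_vanishing[OF assms(1,3)] w(1) by simp
      qed
    qed (auto simp: finite_factored W(1))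
    also have "\<dots> = (\<Sum>w\<in>W. behaviour M w)"
    proof (rule sum.mono_neutral_right)
      show "\<forall>w\<in>factored A (Suc m) v \<union> W - W. behaviour M w = 0"
      proof
        fix w assume w: "w \<in> factored A (Suc m) v \<union> W - W"
        then have "w \<in> lists (set A)" using factored_lists[of A "Suc m" v] by blast
        then show "behaviour M w = 0" using W(3)[of w] w nf_factored[of w A "Suc m" v] True by auto
      qed
    qed (auto simp: finite_factored W(1))
    finally show ?thesis using b True by simp
  next
    case False
    then have "w \<notin> W" for w using W(2)[of w] reduced_nf[of w] by auto
    then have "W = {}" by blast
    then show ?thesis using b False by simp
  qed
qed

section \<open>From expressions to automata\<close>

text \<open>The program never tabulates an automaton. It keeps the tree below and recomputes the weights
  from it.\<close>

datatype ('k, 'x) construction =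
    CLin "('k \<times> 'x word) list"
  | CPlus "('k, 'x) construction" "('k, 'x) construction"
  | CTimes "('k, 'x) construction" "('k, 'x) construction"
  | CStar "('k, 'x) construction"
  | CRed "'x word list" "('k, 'x) construction"

primrec automaton_of ::
  "'x letter list \<Rightarrow> ('k::field, 'x) construction \<Rightarrow> ('x, 'k) word_automaton" where
  "automaton_of A (CLin cs) = lin_automaton cs"
| "automaton_of A (CPlus c d) = plus_automaton (automaton_of A c) (automaton_of A d)"
| "automaton_of A (CTimes c d) = times_automaton (automaton_of A c) (automaton_of A d)"
| "automaton_of A (CStar c) = star_automaton (automaton_of A c)"
| "automaton_of A (CRed ws c) = red_automaton A ws (automaton_of A c)"

lemma well_formed_automaton_of: "distinct A \<Longrightarrow> well_formed (automaton_of A c)"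
  by (induction c)
    (auto simp: well_formed_lin well_formed_plus well_formed_times well_formed_star well_formed_red)

text \<open>\<open>Suc\<close> leaves room for the last letter of a first passage, which follows a
  trivial word of length up to the bound. The least bound is the one at which an upward search
  stops.\<close>

definition reduction ::
  "'x letter list \<Rightarrow> ('k::field, 'x) construction \<Rightarrow> ('k, 'x) construction" where
  "reduction A c = CRed (words A (Suc (LEAST m. bound_ok A (automaton_of A c) m))) c"

primrec construction_of ::
  "'x letter list \<Rightarrow> ('k::field, 'x word) rexp \<Rightarrow> ('k, 'x) construction" where
  "construction_of A (Lin cs) = CLin cs"
| "construction_of A (Plus e f) = CPlus (construction_of A e) (construction_of A f)"
| "construction_of A (Times e f) = reduction A (CTimes (construction_of A e) (construction_of A f))"
| "construction_of A (Star e) = reduction A (CStar (construction_of A e))"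

section \<open>The alphabet of an expression\<close>

primrec word_letters :: "'x word \<Rightarrow> 'x letter list \<Rightarrow> 'x letter list" where
  "word_letters [] acc = acc"
| "word_letters (a # w) acc = a # inv_letter a # word_letters w acc"

primrec lin_letters :: "('k \<times> 'x word) list \<Rightarrow> 'x letter list \<Rightarrow> 'x letter list" where
  "lin_letters [] acc = acc"
| "lin_letters (m # cs) acc = word_letters (snd m) (lin_letters cs acc)"

primrec letters :: "('k, 'x word) rexp \<Rightarrow> 'x letter list \<Rightarrow> 'x letter list" where
  "letters (Lin cs) acc = lin_letters cs acc"
| "letters (Plus e f) acc = letters e (letters f acc)"
| "letters (Times e f) acc = letters e (letters f acc)"
| "letters (Star e) acc = letters e acc"

lemma set_word_letters: "set (word_letters w acc) = set w \<union> inv_letter ` set w \<union> set acc"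
  by (induction w) auto

lemma set_lin_letters:
  "set (lin_letters cs acc) = (\<Union>m\<in>set cs. set (snd m) \<union> inv_letter ` set (snd m)) \<union> set acc"
  by (induction cs) (auto simp: set_word_letters)

lemma set_letters_acc: "set (letters e acc) = set (letters e []) \<union> set acc"
proof (induction e arbitrary: acc)
  case (Lin cs)
  show ?case by (simp add: set_lin_letters)
next
  case (Plus e f)
  show ?case by (simp add: Plus(1)[of "letters f _"] Plus(2)[of acc] Un_assoc)
next
  case (Times e f)
  show ?case by (simp add: Times(1)[of "letters f _"] Times(2)[of acc] Un_assoc)
next
  case (Star e)
  show ?case unfolding letters.simps by (rule Star)
qed

lemma letters_carrier:
  "mn_exp (free_group X) r e \<Longrightarrow> fst ` set (letters e []) \<subseteq> X"
proof (induction e)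
  case (Lin cs)
  then have "fst ` set (snd m) \<subseteq> X" if "m \<in> set cs" for m
    using that by (auto simp: free_group_def)
  then have "fst a \<in> X" if "m \<in> set cs" "a \<in> set (snd m)" for m a
    using that by blast
  then show ?case by (auto simp: set_lin_letters)
next
  case (Plus e f)
  then show ?case by (simp add: set_letters_acc[of e "letters f []"] image_Un)
next
  case (Times e f)
  then show ?case by (simp add: set_letters_acc[of e "letters f []"] image_Un)
qed simp

section \<open>Correctness of the reduced constructions\<close>

lemma mult_free_group: "mult (free_group X) u v = foldr push u v"
  by (simp add: free_group_def)

lemma one_free_group: "\<one>\<^bsub>free_group X\<^esub> = []"
  by (simp add: free_group_def)

lemma carrier_free_group: "w \<in> carrier (free_group X) \<longleftrightarrow> reduced w \<and> fst ` set w \<subseteq> X"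
  by (simp add: free_group_def)

lemma foldr_push_eq_nf: "reduced u \<Longrightarrow> reduced v \<Longrightarrow> foldr push u v = nf (u @ v)"
  by (simp add: nf_append nf_reduced)

lemma foldr_mult_eq_nf:
  "\<forall>u\<in>set us. reduced u \<Longrightarrow> foldr (mult (free_group X)) us [] = nf (concat us)"
  by (induction us) (auto simp: mult_free_group nf_append nf_reduced)

lemma coefficient_nonzero: "coefficient cs w \<noteq> 0 \<Longrightarrow> \<exists>c. (c, w) \<in> set cs"
  unfolding coefficient_def by (induction cs) (auto split: if_splits)

lemma supp_value_of:
  assumes "mn_exp (free_group X) r e" "set (letters e []) \<subseteq> set A"
  shows "supp (value_of (free_group X) e) \<subseteq> {w \<in> lists (set A). w \<in> carrier (free_group X)}"
  using assms
proof (induction e)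
  case (Lin cs)
  have "value_of (free_group X) (Lin cs) = coefficient cs" by (simp add: coefficient_def fun_eq_iff)
  then show ?case
    using Lin coefficient_nonzero[of cs] by (force simp: supp_def set_lin_letters)
next
  case (Plus e f)
  then have "supp (value_of (free_group X) e) \<union> supp (value_of (free_group X) f)
      \<subseteq> {w \<in> lists (set A). w \<in> carrier (free_group X)}"
    by (simp add: set_letters_acc[of e "letters f []"])
  moreover have "supp (value_of (free_group X) (Plus e f))
      \<subseteq> supp (value_of (free_group X) e) \<union> supp (value_of (free_group X) f)"
    by (auto simp: supp_def)
  ultimately show ?case by (rule order_trans[rotated])
next
  case (Times e f)
  show ?case
  proof
    fix w assume "w \<in> supp (value_of (free_group X) (Times e f))"
    then have "cauchy_terms (free_group X) (value_of (free_group X) e) (value_of (free_group X) f) w \<noteq> {}"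
      by (auto simp: supp_def cauchy_def)
    then obtain u v where uv: "foldr push u v = w" "value_of (free_group X) e u \<noteq> 0"
        "value_of (free_group X) f v \<noteq> 0"
        "u \<in> carrier (free_group X)" "v \<in> carrier (free_group X)"
      by (auto simp: cauchy_terms_def mult_free_group)
    then have "u \<in> lists (set A)" "v \<in> lists (set A)"
      using Times by (auto simp: supp_def set_letters_acc[of e "letters f []"])
    moreover have "w \<in> carrier (free_group X)"
      using uv(1,4,5) monoid.m_closed[OF group.is_monoid[OF group_free_group], of u X v]
      by (simp add: mult_free_group)
    ultimately show "w \<in> {w \<in> lists (set A). w \<in> carrier (free_group X)}"
      using uv(1) set_foldr_push[of u v] by auto
  qed
next
  case (Star e)
  show ?case
  proof
    fix w assume "w \<in> supp (value_of (free_group X) (Star e))"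
    then have "star_terms (free_group X) (value_of (free_group X) e) w \<noteq> {}"
      by (auto simp: supp_def star_def)
    then obtain us where "us \<in> star_terms (free_group X) (value_of (free_group X) e) w" by blast
    then have us: "set us \<subseteq> carrier (free_group X)" "foldr (mult (free_group X)) us [] = w"
        "u \<in> set us \<Longrightarrow> value_of (free_group X) e u \<noteq> 0" for u
      by (force simp: star_terms_def one_free_group prod_list_zero_iff)+
    then have w: "w = nf (concat us)"
      by (subst foldr_mult_eq_nf[symmetric, of us X]) (auto simp: carrier_free_group)
    have sub: "set w \<subseteq> (\<Union>u\<in>set us. set u)" unfolding w using set_nf[of "concat us"] by simp
    have "u \<in> lists (set A)" if "u \<in> set us" for u
      using Star us(3)[OF that] by (simp add: supp_def) blast
    then have "set w \<subseteq> set A" using sub by auto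
    moreover have "fst ` set u \<subseteq> X" if "u \<in> set us" for u
      using subsetD[OF us(1) that] by (simp add: carrier_free_group)
    then have "fst ` set w \<subseteq> X" using sub by blast
    ultimately show "w \<in> {w \<in> lists (set A). w \<in> carrier (free_group X)}"
      by (auto simp: carrier_free_group w reduced_nf)
  qed
qed

lemma supp_value_of_carrier:
  "mn_exp (free_group X) r e \<Longrightarrow> supp (value_of (free_group X) e) \<subseteq> carrier (free_group X)"
  using supp_value_of[OF _ subset_refl, of X r e] by blast

text \<open>The set \<open>T v\<close> stands for the terms of a Cauchy product or of a star at \<open>v\<close>, and \<open>h\<close> concatenates
  the factors of a term to an unreduced word.\<close>

lemma reduction_correct:
  fixes b :: "'x word \<Rightarrow> 'k::field"
  assumes A: "distinct A"
    and T: "\<And>v. finite (T v)"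
    and b: "\<And>w. w \<in> lists (set A) \<Longrightarrow>
      behaviour (automaton_of A c) w = (\<Sum>t\<in>{t \<in> T (nf w). h t = w}. g t)"
    and h: "\<And>v t. t \<in> T v \<Longrightarrow> h t \<in> lists (set A) \<and> nf (h t) = v"
  shows "\<exists>m. bound_ok A (automaton_of A c) m"
    and "v \<in> lists (set A) \<Longrightarrow> behaviour (automaton_of A (reduction A c)) v = (\<Sum>t\<in>T v. g t)"
proof -
  let ?M = "automaton_of A c"
  have zero: "behaviour ?M w = 0" if "w \<in> lists (set A)" "nf w = v" "w \<notin> h ` T v" for v w
  proof -
    have "{t \<in> T (nf w). h t = w} = {}" using that by blast
    then show ?thesis by (simp only: b[OF that(1)] sum.empty)
  qed
  have "finite {w \<in> lists (set A). nf w = v \<and> behaviour ?M w \<noteq> 0}" for v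
    by (rule finite_subset[of _ "h ` T v"]) (use zero T in blast)+
  then show ex: "\<exists>m. bound_ok A ?M m" by (rule bound_ok_exists)
  assume v: "v \<in> lists (set A)"
  have "behaviour (automaton_of A (reduction A c)) v = (\<Sum>w\<in>h ` T v. behaviour ?M w)"
    unfolding reduction_def automaton_of.simps
    by (rule behaviour_red[OF well_formed_automaton_of[OF A] A LeastI_ex[OF ex] v])
      (use T h zero in blast)+
  also have "\<dots> = (\<Sum>w\<in>h ` T v. \<Sum>t\<in>{t \<in> T v. h t = w}. g t)"
    using h b by (intro sum.cong) auto
  also have "\<dots> = (\<Sum>t\<in>T v. g t)" by (rule sum.image_gen[OF T, symmetric])
  finally show "behaviour (automaton_of A (reduction A c)) v = (\<Sum>t\<in>T v. g t)" .
qed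

text \<open>Agreement on all words over \<open>A\<close> includes the unreduced ones, where
  \<open>a\<close> is zero by the condition on the support. An automaton that is right only after
  reduction would not be a valid input for the next star.\<close>

definition represents ::
  "'x letter list \<Rightarrow> ('k::field, 'x) construction \<Rightarrow> ('x word \<Rightarrow> 'k) \<Rightarrow> bool" where
  "represents A c a \<longleftrightarrow> supp a \<subseteq> {w \<in> lists (set A). reduced w} \<and>
    (\<forall>w\<in>lists (set A). behaviour (automaton_of A c) w = a w)"

text \<open>The terms of the Cauchy product at \<open>v\<close> are grouped by the unreduced word
  \<open>u @ v\<close> they spell; the product automaton computes one group, and reduction adds the
  groups up.\<close>

lemma represents_times:
  fixes a b :: "'x word \<Rightarrow> 'k::field"
  assumes A: "distinct A" and c: "represents A c a" and d: "represents A d b"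
    and carrier: "supp a \<subseteq> carrier (free_group X)" "supp b \<subseteq> carrier (free_group X)"
    and def: "cauchy_defined (free_group X) a b"
  shows "\<exists>m. bound_ok A (automaton_of A (CTimes c d)) m"
    and "v \<in> lists (set A) \<Longrightarrow> behaviour (automaton_of A (reduction A (CTimes c d))) v =
      cauchy (free_group X) a b v"
proof -
  let ?T = "cauchy_terms (free_group X) a b"
  have sa: "u \<in> lists (set A)" "reduced u" "u \<in> carrier (free_group X)" if "a u \<noteq> 0" for u
    using that c carrier(1) by (auto simp: represents_def supp_def)
  have sb: "u \<in> lists (set A)" "reduced u" "u \<in> carrier (free_group X)" if "b u \<noteq> 0" for u
    using that d carrier(2) by (auto simp: represents_def supp_def)
  have T: "(u, v) \<in> ?T w \<longleftrightarrow> nf (u @ v) = w \<and> a u * b v \<noteq> 0" for u v w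
    using sa[of u] sb[of v] by (auto simp: cauchy_terms_def mult_free_group foldr_push_eq_nf)
  have fin: "finite (?T w)" for w using def by (simp add: cauchy_defined_def)
  have beh: "behaviour (automaton_of A (CTimes c d)) w =
      (\<Sum>t\<in>{t \<in> ?T (nf w). (case t of (u, v) \<Rightarrow> u @ v) = w}. case t of (u, v) \<Rightarrow> a u * b v)"
    if w: "w \<in> lists (set A)" for w
  proof -
    have "behaviour (automaton_of A (CTimes c d)) w =
        (\<Sum>(u, v)\<in>{(u, v). u @ v = w}. behaviour (automaton_of A c) u * behaviour (automaton_of A d) v)"
      by (simp add: behaviour_times conv_eq_sum)
    also have "\<dots> = (\<Sum>(u, v)\<in>{(u, v). u @ v = w}. a u * b v)"
    proof (intro sum.cong refl, clarify)
      fix u v assume "w = u @ v"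
      then have "u \<in> lists (set A)" "v \<in> lists (set A)" using w by auto
      then show "behaviour (automaton_of A c) u * behaviour (automaton_of A d) v = a u * b v"
        using c d by (simp only: represents_def)
    qed
    also have "\<dots> = (\<Sum>t\<in>{t \<in> ?T (nf w). (case t of (u, v) \<Rightarrow> u @ v) = w}. case t of (u, v) \<Rightarrow> a u * b v)"
      by (rule sum.mono_neutral_right) (auto simp: finite_splits T)
    finally show ?thesis .
  qed
  have h: "(case t of (u, v) \<Rightarrow> u @ v) \<in> lists (set A) \<and> nf (case t of (u, v) \<Rightarrow> u @ v) = v"
    if "t \<in> ?T v" for t v
    using that sa sb T[of "fst t" "snd t" v] by (cases t) (auto simp del: in_lists_conv_set)
  note * = reduction_correct[where T = ?T and h = "\<lambda>(u, v). u @ v" and g = "\<lambda>(u, v). a u * b v"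
      and c = "CTimes c d", OF A fin beh h]
  show "\<exists>m. bound_ok A (automaton_of A (CTimes c d)) m" by (rule *(1))
  show "behaviour (automaton_of A (reduction A (CTimes c d))) v = cauchy (free_group X) a b v"
    if "v \<in> lists (set A)"
    unfolding cauchy_def by (rule *(2)[OF _ _ that])
qed

lemma represents_star:
  fixes a :: "'x word \<Rightarrow> 'k::field"
  assumes A: "distinct A" and c: "represents A c a"
    and carrier: "supp a \<subseteq> carrier (free_group X)"
    and def: "star_defined (free_group X) a" and proper: "a [] = 0"
  shows "\<exists>m. bound_ok A (automaton_of A (CStar c)) m"
    and "v \<in> lists (set A) \<Longrightarrow> behaviour (automaton_of A (reduction A (CStar c))) v =
      star (free_group X) a v"
proof -
  let ?T = "star_terms (free_group X) a"
  have sa: "u \<in> lists (set A)" "reduced u" "u \<in> carrier (free_group X)" if "a u \<noteq> 0" for u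
    using that c carrier(1) by (auto simp: represents_def supp_def)
  have T: "us \<in> ?T w \<longleftrightarrow> nf (concat us) = w \<and> prod_list (map a us) \<noteq> 0" for us w
  proof (cases "prod_list (map a us) = 0")
    case False
    then have nz: "\<forall>u\<in>set us. a u \<noteq> 0" by (auto simp: prod_list_zero_iff)
    then have "set us \<subseteq> carrier (free_group X)" "\<forall>u\<in>set us. reduced u" using sa by blast+
    then show ?thesis using foldr_mult_eq_nf[of us X] False
      by (auto simp: star_terms_def one_free_group)
  qed (simp add: star_terms_def)
  have fin: "finite (?T w)" for w using def by (simp add: star_defined_def)
  have beh: "behaviour (automaton_of A (CStar c)) w =
      (\<Sum>t\<in>{t \<in> ?T (nf w). concat t = w}. prod_list (map a t))"
    if w: "w \<in> lists (set A)" for w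
  proof -
    have "behaviour (automaton_of A (CStar c)) w =
        (\<Sum>us\<in>factorizations w. prod_list (map (behaviour (automaton_of A c)) us))"
      by (simp add: behaviour_star fstar_def)
    also have "\<dots> = (\<Sum>us\<in>factorizations w. prod_list (map a us))"
    proof (rule sum.cong)
      fix us assume "us \<in> factorizations w"
      then have "\<forall>u\<in>set us. u \<in> lists (set A)" using w by (auto simp: factorizations_def)
      then have "map (behaviour (automaton_of A c)) us = map a us"
        using c by (intro map_cong) (auto simp: represents_def)
      then show "prod_list (map (behaviour (automaton_of A c)) us) = prod_list (map a us)"
        by (simp only:)
    qed simp
    also have "\<dots> = (\<Sum>t\<in>{t \<in> ?T (nf w). concat t = w}. prod_list (map a t))"
    proof (rule sum.mono_neutral_right[OF finite_factorizations])
      \<comment> \<open>Since \<open>a [] = 0\<close>, no nonzero term has an empty factor, so the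
        terms spelling \<open>w\<close> are factorizations in the sense of
        \<open>fstar\<close>.\<close>
      have "[] \<notin> set us" if "prod_list (map a us) \<noteq> 0" for us
        using that proper by (force simp: prod_list_zero_iff)
      then show "{t \<in> ?T (nf w). concat t = w} \<subseteq> factorizations w"
        by (auto simp: T factorizations_def)
    qed (auto simp: T factorizations_def)
    finally show ?thesis .
  qed
  have h: "concat us \<in> lists (set A) \<and> nf (concat us) = v" if "us \<in> ?T v" for us v
  proof -
    have "a u \<noteq> 0" if "u \<in> set us" for u
      using \<open>us \<in> ?T v\<close> that by (force simp: T prod_list_zero_iff)
    then have "u \<in> lists (set A)" if "u \<in> set us" for u using sa(1) that by blast
    then have "(\<Union>u\<in>set us. set u) \<subseteq> set A" by blast
    then have "concat us \<in> lists (set A)" unfolding lists_eq_set by simp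
    then show ?thesis using that by (simp add: T)
  qed
  note * = reduction_correct[where T = ?T and h = concat and g = "\<lambda>us. prod_list (map a us)"
      and c = "CStar c", OF A fin beh h]
  show "\<exists>m. bound_ok A (automaton_of A (CStar c)) m" by (rule *(1))
  show "behaviour (automaton_of A (reduction A (CStar c))) v = star (free_group X) a v"
    if "v \<in> lists (set A)"
    unfolding star_def by (rule *(2)[OF _ _ that])
qed

text \<open>The last reduction leaves the series unchanged. It supplies states that remember a
  letter, which state elimination relies on and which the automata of \<open>Lin\<close> and
  \<open>Plus\<close> do not have.\<close>

lemma represents_reduced:
  fixes a :: "'x word \<Rightarrow> 'k::field"
  assumes A: "distinct A" and c: "represents A c a"
  shows "\<exists>m. bound_ok A (automaton_of A c) m"
    and "v \<in> lists (set A) \<Longrightarrow> behaviour (automaton_of A (reduction A c)) v = a v"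
proof -
  let ?T = "\<lambda>v. if a v = 0 then {} else {v}"
  have sa: "u \<in> lists (set A)" "reduced u" if "a u \<noteq> 0" for u
    using that c by (auto simp: represents_def supp_def)
  have beh: "behaviour (automaton_of A c) w = (\<Sum>t\<in>{t \<in> ?T (nf w). id t = w}. a t)"
    if w: "w \<in> lists (set A)" for w
  proof -
    \<comment> \<open>If \<open>w\<close> is unreduced, both sides are empty: \<open>nf w\<close>
      differs from \<open>w\<close>, and \<open>a w = 0\<close>.\<close>
    have "{t \<in> ?T (nf w). id t = w} = ?T w"
      using sa(2)[of w] reduced_nf[of w] nf_reduced[of w] by auto
    then show ?thesis using c w by (simp add: represents_def)
  qed
  have h: "id u \<in> lists (set A) \<and> nf (id u) = v" if "u \<in> ?T v" for u v
    using that sa nf_reduced by (auto split: if_splits)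
  have fin: "finite (?T v)" for v by simp
  note * = reduction_correct[where T = ?T and h = id and g = a, OF A fin beh h]
  show "\<exists>m. bound_ok A (automaton_of A c) m" by (rule *(1))
  show "behaviour (automaton_of A (reduction A c)) v = a v" if "v \<in> lists (set A)"
    using *(2)[OF _ _ that] by (auto split: if_splits)
qed

locale ordered_free_group =
  fixes X :: "'x set" and r :: "'x word rel"
  assumes order: "compatible_order (free_group X) r"

sublocale ordered_free_group \<subseteq> ordered_group "free_group X" r
  by (intro ordered_group.intro ordered_group_axioms.intro group_free_group order)

context ordered_free_group
begin

lemma represents_construction_of:
  assumes A: "distinct A" and "mn_exp (free_group X) r e" "set (letters e []) \<subseteq> set A"
  shows "represents A (construction_of A e) (value_of (free_group X) e)"
  using assms(2,3)
proof (induction e)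
  case (Lin cs)
  have "value_of (free_group X) (Lin cs) = coefficient cs" by (simp add: coefficient_def fun_eq_iff)
  then show ?case
    using supp_value_of[OF Lin] by (auto simp: represents_def behaviour_lin carrier_free_group)
next
  case (Plus e f)
  then have "represents A (construction_of A e) (value_of (free_group X) e)"
    "represents A (construction_of A f) (value_of (free_group X) f)"
    by (auto simp: set_letters_acc[of e "letters f []"])
  then show ?case
    using supp_value_of[OF Plus(3,4)] by (auto simp: represents_def behaviour_plus carrier_free_group)
next
  case (Times e f)
  then have l: "set (letters e []) \<subseteq> set A" "set (letters f []) \<subseteq> set A"
    by (auto simp: set_letters_acc[of e "letters f []"])
  then have r: "represents A (construction_of A e) (value_of (free_group X) e)"
    "represents A (construction_of A f) (value_of (free_group X) f)"
    using Times by auto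
  have "cauchy_defined (free_group X) (value_of (free_group X) e) (value_of (free_group X) f)"
    using Times.prems by (intro cauchy_malcev_neumann value_of_malcev_neumann) auto
  moreover have "supp (value_of (free_group X) e) \<subseteq> carrier (free_group X)"
    "supp (value_of (free_group X) f) \<subseteq> carrier (free_group X)"
    using supp_value_of_carrier[of X r e] supp_value_of_carrier[of X r f] Times.prems by simp_all
  ultimately have "\<forall>v\<in>lists (set A).
      behaviour (automaton_of A (construction_of A (Times e f))) v = value_of (free_group X) (Times e f) v"
    using represents_times(2)[OF A r] by simp
  then show ?case
    using supp_value_of[OF Times.prems] by (auto simp: represents_def carrier_free_group)
next
  case (Star e)
  then have r: "represents A (construction_of A e) (value_of (free_group X) e)" by simp
  have "star_defined (free_group X) (value_of (free_group X) e)"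
    using Star.prems by (intro star_malcev_neumann) auto
  moreover have "value_of (free_group X) e [] = 0"
    using Star.prems irreflexive by (auto simp: supp_def one_free_group)
  moreover have "supp (value_of (free_group X) e) \<subseteq> carrier (free_group X)"
    using supp_value_of_carrier[of X r e] Star.prems by simp
  ultimately have "\<forall>v\<in>lists (set A).
      behaviour (automaton_of A (construction_of A (Star e))) v = value_of (free_group X) (Star e) v"
    using represents_star(2)[OF A r] by simp
  then show ?case
    using supp_value_of[OF Star.prems] by (auto simp: represents_def carrier_free_group)
qed

text \<open>This makes the search of the program terminate at a product;
  \<open>bound_ok_star\<close> does so at a star.\<close>

lemma bound_ok_times:
  assumes A: "distinct A" and "mn_exp (free_group X) r (Times e f)"
    "set (letters (Times e f) []) \<subseteq> set A"
  shows "\<exists>m. bound_ok A (automaton_of A (CTimes (construction_of A e) (construction_of A f))) m"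
proof -
  have l: "set (letters e []) \<subseteq> set A" "set (letters f []) \<subseteq> set A"
    using assms(3) by (auto simp: set_letters_acc[of e "letters f []"])
  have "cauchy_defined (free_group X) (value_of (free_group X) e) (value_of (free_group X) f)"
    using assms(2) by (intro cauchy_malcev_neumann value_of_malcev_neumann) auto
  moreover have "supp (value_of (free_group X) e) \<subseteq> carrier (free_group X)"
    "supp (value_of (free_group X) f) \<subseteq> carrier (free_group X)"
    using supp_value_of_carrier[of X r e] supp_value_of_carrier[of X r f] assms(2) by simp_all
  moreover have "represents A (construction_of A e) (value_of (free_group X) e)"
    "represents A (construction_of A f) (value_of (free_group X) f)"
    using represents_construction_of[OF A, of e] represents_construction_of[OF A, of f] l assms(2)
    by simp_all
  ultimately show ?thesis by (intro represents_times(1)[OF A])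
qed

lemma bound_ok_star:
  assumes A: "distinct A" and "mn_exp (free_group X) r (Star e)" "set (letters (Star e) []) \<subseteq> set A"
  shows "\<exists>m. bound_ok A (automaton_of A (CStar (construction_of A e))) m"
proof -
  have "star_defined (free_group X) (value_of (free_group X) e)"
    using assms(2) by (intro star_malcev_neumann) auto
  moreover have "value_of (free_group X) e [] = 0"
    using assms(2) irreflexive by (auto simp: supp_def one_free_group)
  moreover have "supp (value_of (free_group X) e) \<subseteq> carrier (free_group X)"
    using supp_value_of_carrier[of X r e] assms(2) by simp
  moreover have "represents A (construction_of A e) (value_of (free_group X) e)"
    using represents_construction_of[OF A, of e] assms by simp
  ultimately show ?thesis by (intro represents_star(1)[OF A])
qed

end

section \<open>From automata to expressions without simplification\<close>

text \<open>The McNaughton-Yamada recursion on the allowed intermediate states: a path avoids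
  \<open>s\<close> or is cut at all its visits to \<open>s\<close>. The base case lists single
  transitions.\<close>

primrec kleene ::
  "'x letter list \<Rightarrow> ('x, 'k::field) word_automaton \<Rightarrow> 'x state list \<Rightarrow> 'x state \<Rightarrow> 'x state \<Rightarrow>
    ('k, 'x word) rexp" where
  "kleene A M [] p q = Lin (map (\<lambda>a. (weight M p a q, [a])) A)"
| "kleene A M (s # ss) p q = Plus (kleene A M ss p q)
    (Times (kleene A M ss p s) (Times (Star (kleene A M ss s s)) (kleene A M ss s q)))"

text \<open>Elimination yields nonempty paths only, so the weight of the empty word is added at the
  end of the list.\<close>

primrec accepted ::
  "'x letter list \<Rightarrow> ('x, 'k::field) word_automaton \<Rightarrow> 'x state list \<Rightarrow> ('k, 'x word) rexp" where
  "accepted A M [] = Lin [(final M (start M), [])]"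
| "accepted A M (q # qs) =
    Plus (Times (kleene A M (states M) (start M) q) (Lin [(final M q, [])])) (accepted A M qs)"

text \<open>The weight of the nonempty paths whose intermediate states are in \<open>ss\<close>.\<close>

primrec via :: "('s, 'l, 'k::field) automaton \<Rightarrow> 's list \<Rightarrow> 's \<Rightarrow> 's \<Rightarrow> 'l list \<Rightarrow> 'k" where
  "via M ss p q [] = 0"
| "via M ss p q (a # w) = of_bool (w = []) * weight M p a q + (\<Sum>s\<in>set ss. weight M p a s * via M ss s q w)"

lemma conv_scale_left: "conv (\<lambda>u. c * f u) g w = c * conv f g w"
  by (induction w arbitrary: f) (auto simp: algebra_simps)

lemma conv_assoc: "conv (conv f g) h w = conv f (conv g h) w"
proof (induction w arbitrary: f)
  case (Cons a w)
  then show ?case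
    by (simp add: conv_add_left conv_scale_left[where f = "\<lambda>u. g (a # u)"] algebra_simps)
qed simp

lemma conv_fstar:
  assumes "f [] = 0"
  shows "conv (fstar f) h w = h w + conv f (conv (fstar f) h) w"
proof (cases w)
  case (Cons a v)
  have "conv (\<lambda>u. fstar f (a # u)) h v = conv (conv (\<lambda>u. f (a # u)) (fstar f)) h v"
    by (simp only: fstar_Cons)
  then show ?thesis using assms Cons by (simp add: conv_assoc)
qed (use assms in simp)

lemma conv_zero_left: "conv (\<lambda>u. 0) g w = 0"
  by (induction w) auto

lemma conv_unit_left: "conv (\<lambda>u. of_bool (u = []) * c) g w = c * g w"
  by (induction w) (auto simp: conv_zero_left)

lemma conv_unit_right: "conv f (\<lambda>u. if [] = u then c else 0) w = f w * c"
  by (induction w arbitrary: f) auto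

text \<open>The weight \<open>g\<close> of the paths from \<open>s\<close> to \<open>q\<close>
  solves \<open>g = via M ss s q + conv (via M ss s s) g\<close>, by \<open>conv_fstar\<close>. With
  this equation both sides obey the same recursion on the first letter.\<close>

lemma via_Cons:
  assumes "s \<notin> set ss"
  shows "via M (s # ss) p q w =
    via M ss p q w + conv (via M ss p s) (conv (fstar (via M ss s s)) (via M ss s q)) w"
proof (induction w arbitrary: p)
  case (Cons a w)
  define g where "g = conv (fstar (via M ss s s)) (via M ss s q)"
  have g: "g w = via M ss s q w + conv (via M ss s s) g w" for w
    unfolding g_def by (rule conv_fstar) simp
  have IH: "via M (s # ss) p q w = via M ss p q w + conv (via M ss p s) g w" for p
    using Cons unfolding g_def .
  have "via M (s # ss) p q (a # w) = of_bool (w = []) * weight M p a q + weight M p a s * g w +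
      (\<Sum>t\<in>set ss. weight M p a t * (via M ss t q w + conv (via M ss t s) g w))"
    using assms by (simp add: IH g[of w] add.assoc)
  also have "\<dots> = via M ss p q (a # w) + conv (via M ss p s) g (a # w)"
    by (simp add: conv_add_left conv_sum_left conv_unit_left sum.distrib algebra_simps)
  finally show ?case unfolding g_def .
qed simp

lemma path_via:
  "path M p w None =
    (\<Sum>q\<in>set (states M). via M (states M) p q w * final M q) + of_bool (w = []) * final M p"
proof (induction w arbitrary: p)
  case (Cons a w)
  let ?Q = "set (states M)"
  have "path M p (a # w) None = (\<Sum>s\<in>?Q. \<Sum>q\<in>?Q. weight M p a s * via M (states M) s q w * final M q)
      + (\<Sum>s\<in>?Q. weight M p a s * (of_bool (w = []) * final M s))"
    by (simp add: Cons distrib_left sum.distrib sum_distrib_left mult.assoc)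
  also have "\<dots> = (\<Sum>q\<in>?Q. \<Sum>s\<in>?Q. weight M p a s * via M (states M) s q w * final M q)
      + (\<Sum>q\<in>?Q. of_bool (w = []) * weight M p a q * final M q)"
    by (subst sum.swap) (simp add: mult_ac)
  also have "\<dots> = (\<Sum>q\<in>?Q. via M (states M) p q (a # w) * final M q)"
    by (simp add: distrib_right sum.distrib sum_distrib_right add.commute)
  finally show ?case by simp
qed simp

section \<open>Products and stars without cancellation\<close>

lemma reduced_append_iff:
  "reduced (u @ v) \<longleftrightarrow> reduced u \<and> reduced v \<and>
    (u = [] \<or> v = [] \<or> hd v \<noteq> inv_letter (last u))"
  by (auto simp: reduced_def successively_append_iff)

lemma conv_nonzero: "conv f g w \<noteq> 0 \<Longrightarrow> \<exists>u v. u @ v = w \<and> f u \<noteq> 0 \<and> g v \<noteq> 0"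
  unfolding conv_eq_sum by (rule ccontr) (auto intro!: sum.neutral)

lemma fstar_nonzero: "fstar f w \<noteq> 0 \<Longrightarrow> \<exists>us. concat us = w \<and> (\<forall>u\<in>set us. f u \<noteq> 0)"
proof (rule ccontr)
  assume "fstar f w \<noteq> 0" "\<nexists>us. concat us = w \<and> (\<forall>u\<in>set us. f u \<noteq> 0)"
  then have "\<forall>us\<in>factorizations w. prod_list (map f us) = 0"
    by (force simp: factorizations_def prod_list_zero_iff)
  then have "fstar f w = 0" unfolding fstar_def by (simp add: sum.neutral)
  then show False using \<open>fstar f w \<noteq> 0\<close> by simp
qed

text \<open>If supports concatenate to reduced words, the group product is concatenation. A word has
  finitely many splittings, so the product is defined and equals the one over the free
  monoid.\<close>

lemma cauchy_eq_conv:
  assumes "\<And>u v. f u \<noteq> 0 \<Longrightarrow> g v \<noteq> 0 \<Longrightarrow> u @ v \<in> carrier (free_group X)"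
  shows "cauchy_defined (free_group X) f g" "length_additive X f g"
    "cauchy (free_group X) f g = conv f g"
proof -
  have uv: "u \<in> carrier (free_group X)" "v \<in> carrier (free_group X)" "foldr push u v = u @ v"
    if "f u \<noteq> 0" "g v \<noteq> 0" for u v
  proof -
    show "u \<in> carrier (free_group X)" "v \<in> carrier (free_group X)"
      using assms[OF that] by (auto simp: carrier_free_group reduced_append_iff)
    then show "foldr push u v = u @ v"
      using assms[OF that] by (simp add: carrier_free_group foldr_push_eq_nf nf_reduced)
  qed
  have T: "cauchy_terms (free_group X) f g w = {(u, v). u @ v = w \<and> f u * g v \<noteq> 0}" for w
    using uv by (auto simp: cauchy_terms_def mult_free_group)
  have sub: "{(u, v). u @ v = w \<and> f u * g v \<noteq> 0} \<subseteq> {(u, v). u @ v = w}" for w by auto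
  show "cauchy_defined (free_group X) f g"
    unfolding cauchy_defined_def T using finite_subset[OF sub finite_splits] by blast
  show "length_additive X f g"
    using uv by (auto simp: length_additive_def supp_def mult_free_group)
  have "cauchy (free_group X) f g w = conv f g w" for w
    unfolding cauchy_def T conv_eq_sum
    by (rule sum.mono_neutral_left[OF finite_splits sub]) auto
  then show "cauchy (free_group X) f g = conv f g" ..
qed

lemma star_eq_fstar:
  assumes "\<And>us. \<forall>u\<in>set us. f u \<noteq> 0 \<Longrightarrow> concat us \<in> carrier (free_group X)" and "f [] = 0"
  shows "star_defined (free_group X) f" "length_additive X f f" "star (free_group X) f = fstar f"
proof -
  have one: "u \<in> carrier (free_group X)" if "f u \<noteq> 0" for u
    using assms(1)[of "[u]"] that by simp
  have T: "star_terms (free_group X) f w = {us \<in> factorizations w. prod_list (map f us) \<noteq> 0}" for w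
  proof -
    have "us \<in> star_terms (free_group X) f w \<longleftrightarrow> us \<in> factorizations w"
      if nz: "prod_list (map f us) \<noteq> 0" for us
    proof -
      have u: "\<forall>u\<in>set us. f u \<noteq> 0" using nz by (force simp: prod_list_zero_iff)
      then have us: "set us \<subseteq> carrier (free_group X)" "[] \<notin> set us" using one assms(2) by auto
      then have "foldr (mult (free_group X)) us [] = nf (concat us)"
        by (intro foldr_mult_eq_nf) (auto simp: carrier_free_group)
      also have "\<dots> = concat us" using assms(1)[OF u] by (simp add: carrier_free_group nf_reduced)
      finally show ?thesis
        using us nz by (simp add: star_terms_def one_free_group factorizations_def)
    qed
    then show ?thesis by (auto simp: star_terms_def)
  qed
  have "{us \<in> factorizations w. prod_list (map f us) \<noteq> 0} \<subseteq> factorizations w" for w by blast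
  note sub = this
  show "star_defined (free_group X) f"
    unfolding star_defined_def T using finite_subset[OF sub finite_factorizations] by blast
  show "length_additive X f f"
    \<comment> \<open>Lists of two factors in the hypothesis give the condition for \<open>f\<close>
      times \<open>f\<close>.\<close>
    by (rule cauchy_eq_conv(2)) (use assms(1)[of "[_, _]"] in auto)
  have "star (free_group X) f w = fstar f w" for w
    unfolding star_def T fstar_def
    by (rule sum.mono_neutral_left[OF finite_factorizations sub]) auto
  then show "star (free_group X) f = fstar f" ..
qed

section \<open>Automata whose states remember the last letter\<close>

primrec tag :: "'x state \<Rightarrow> 'x word" where
  "tag Init = []"
| "tag (Rest w) = []"
| "tag (InL s) = []"
| "tag (InR s) = []"
| "tag (After l s) = l"

text \<open>The words that may label a nonempty path from \<open>p\<close> to \<open>q\<close>: they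
  do not cancel against the letter remembered by \<open>p\<close>, and they end in the one
  remembered by \<open>q\<close>. Such languages compose without cancellation.\<close>

definition labels :: "'x letter set \<Rightarrow> 'x state \<Rightarrow> 'x state \<Rightarrow> 'x word set" where
  "labels A p q = {w. w \<noteq> [] \<and> reduced (tag p @ w) \<and> tag q = [last w] \<and> w \<in> lists A}"

lemma labels_append: "u \<in> labels A p s \<Longrightarrow> v \<in> labels A s q \<Longrightarrow> u @ v \<in> labels A p q"
  by (auto simp: labels_def reduced_append_iff reduced_Cons)

lemma concat_labels: "\<forall>u\<in>set us. u \<in> labels A s s \<Longrightarrow> concat us \<in> insert [] (labels A s s)"
proof (induction us)
  case (Cons u us)
  then show ?case
    using labels_append[of u A s s "concat us" s] by (cases "concat us = []") (auto simp del: concat_eq_Nil_conv)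
qed simp

locale typed_automaton =
  fixes X :: "'x set" and A :: "'x letter list" and M :: "('x, 'k::field) word_automaton"
  assumes distinct: "distinct A"
    and alphabet: "fst ` set A \<subseteq> X"
    and weight_labels: "\<And>p a q. p \<in> set (states M) \<Longrightarrow> q \<in> set (states M) \<Longrightarrow>
      weight M p a q \<noteq> 0 \<Longrightarrow> [a] \<in> labels (set A) p q"
begin

lemma labels_carrier: "labels (set A) p q \<subseteq> carrier (free_group X)"
proof
  fix w assume w: "w \<in> labels (set A) p q"
  then have "set w \<subseteq> set A" by (auto simp: labels_def)
  then have "fst ` set w \<subseteq> X" using alphabet by blast
  then show "w \<in> carrier (free_group X)"
    using w by (simp add: labels_def carrier_free_group reduced_append_iff)
qed

lemma via_labels:
  "p \<in> set (states M) \<Longrightarrow> q \<in> set (states M) \<Longrightarrow> set ss \<subseteq> set (states M) \<Longrightarrow>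
    via M ss p q w \<noteq> 0 \<Longrightarrow> w \<in> labels (set A) p q"
proof (induction w arbitrary: p)
  case (Cons a w)
  show ?case
  proof (cases "w = [] \<and> weight M p a q \<noteq> 0")
    case True
    then show ?thesis using weight_labels Cons.prems by simp
  next
    case False
    then have "of_bool (w = []) * weight M p a q = 0" by auto
    with Cons.prems(4) have "(\<Sum>s\<in>set ss. weight M p a s * via M ss s q w) \<noteq> 0"
      unfolding via.simps by (metis add.left_neutral)
    then obtain s where s: "s \<in> set ss" "weight M p a s * via M ss s q w \<noteq> 0"
      by (meson sum.neutral)
    moreover from this have "s \<in> set (states M)" using Cons.prems(3) by blast
    ultimately have "[a] \<in> labels (set A) p s" "w \<in> labels (set A) s q"
      using Cons.prems weight_labels[of p s a] Cons.IH[of s] by auto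
    then show ?thesis using labels_append by fastforce
  qed
qed simp

definition good_exp :: "('k, 'x word) rexp \<Rightarrow> bool" where
  "good_exp e \<longleftrightarrow> star_rational_exp (free_group X) e \<and> without_simplification X e"

text \<open>By \<open>via_labels\<close> all subexpressions are supported in label languages. These
  compose, so every product and star involved is that of the free monoid, and
  \<open>via_Cons\<close> identifies the value.\<close>

lemma kleene_correct:
  "p \<in> set (states M) \<Longrightarrow> q \<in> set (states M) \<Longrightarrow> set ss \<subseteq> set (states M) \<Longrightarrow> distinct ss \<Longrightarrow>
    good_exp (kleene A M ss p q) \<and> value_of (free_group X) (kleene A M ss p q) = via M ss p q"
proof (induction ss arbitrary: p q)
  case Nil
  have "[a] \<in> carrier (free_group X)" if "a \<in> set A" for a
    using alphabet that by (auto simp: carrier_free_group reduced_Cons)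
  moreover have "(\<Sum>(c, u)\<leftarrow>map (\<lambda>a. (weight M p a q, [a])) A. if u = w then c else 0) = via M [] p q w" for w
  proof (cases "\<exists>a. w = [a]")
    case True
    then obtain a where w: "w = [a]" by blast
    have "(\<Sum>(c, u)\<leftarrow>map (\<lambda>a. (weight M p a q, [a])) A. if u = w then c else 0) =
        (\<Sum>b\<in>set A. if b = a then weight M p a q else 0)"
      using distinct by (simp add: w o_def sum_list_distinct_conv_sum_set cong: sum.cong if_cong)
    \<comment> \<open>A letter outside \<open>A\<close> contributes nothing to the list, and its
      weight vanishes by \<open>weight_labels\<close>.\<close>
    also have "\<dots> = weight M p a q"
      using weight_labels[of p q a] Nil by (auto simp: labels_def)
    finally show ?thesis by (simp add: w)
  next
    case False
    then have "via M [] p q w = 0" by (cases w) auto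
    moreover have "map (\<lambda>(c, u). if u = w then c else 0) (map (\<lambda>a. (weight M p a q, [a])) A)
        = map (\<lambda>_. 0) A"
      using False by auto
    ultimately show ?thesis by (simp only: sum_list_0)
  qed
  ultimately show ?case by (auto simp: good_exp_def)
next
  case (Cons s ss)
  let ?V = "value_of (free_group X)"
  let ?K = "kleene A M ss"
  have s: "s \<in> set (states M)" "set ss \<subseteq> set (states M)" "s \<notin> set ss" "distinct ss"
    using Cons.prems by auto
  have IH: "good_exp (?K p' q')" "?V (?K p' q') = via M ss p' q'"
    if "p' \<in> {p, s}" "q' \<in> {q, s}" for p' q'
    using Cons.IH[of p' q'] that s Cons.prems by auto
  have lab: "w \<in> labels (set A) p' q'" if "via M ss p' q' w \<noteq> 0" "p' \<in> {p, s}" "q' \<in> {q, s}" for p' q' w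
    using via_labels[OF _ _ s(2) that(1)] that(2,3) Cons.prems s(1) by auto
  have star: "star_defined (free_group X) (via M ss s s)" "length_additive X (via M ss s s) (via M ss s s)"
      "star (free_group X) (via M ss s s) = fstar (via M ss s s)"
  proof -
    have "concat us \<in> carrier (free_group X)" if "\<forall>u\<in>set us. via M ss s s u \<noteq> 0" for us
    proof -
      have "concat us \<in> insert [] (labels (set A) s s)" using that lab by (intro concat_labels) auto
      moreover have "[] \<in> carrier (free_group X)" by (simp add: carrier_free_group)
      ultimately show ?thesis using labels_carrier[of s s] by (metis insertE subsetD)
    qed
    then show "star_defined (free_group X) (via M ss s s)"
      "length_additive X (via M ss s s) (via M ss s s)"
      "star (free_group X) (via M ss s s) = fstar (via M ss s s)"
      by (intro star_eq_fstar; simp)+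
  qed
  have fstar_lab: "w \<in> insert [] (labels (set A) s s)" if "fstar (via M ss s s) w \<noteq> 0" for w
  proof -
    obtain us where "concat us = w" "\<forall>u\<in>set us. via M ss s s u \<noteq> 0"
      using fstar_nonzero[OF \<open>fstar (via M ss s s) w \<noteq> 0\<close>] by blast
    then show ?thesis using concat_labels[of us "set A" s] lab by auto
  qed
  define g where "g = conv (fstar (via M ss s s)) (via M ss s q)"
  have lab1: "u @ v \<in> labels (set A) s q" if "fstar (via M ss s s) u \<noteq> 0" "via M ss s q v \<noteq> 0" for u v
    using fstar_lab[OF that(1)] lab[OF that(2)] labels_append[of u "set A" s s v q] by auto
  have 1: "cauchy_defined (free_group X) (fstar (via M ss s s)) (via M ss s q)"
    "length_additive X (fstar (via M ss s s)) (via M ss s q)"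
    "cauchy (free_group X) (fstar (via M ss s s)) (via M ss s q) = g"
    unfolding g_def by (intro cauchy_eq_conv; use lab1 labels_carrier in blast)+
  have lab2: "u @ v \<in> labels (set A) p q" if uv: "via M ss p s u \<noteq> 0" "g v \<noteq> 0" for u v
  proof -
    obtain x y where "x @ y = v" "fstar (via M ss s s) x \<noteq> 0" "via M ss s q y \<noteq> 0"
      using conv_nonzero[of "fstar (via M ss s s)" "via M ss s q" v] uv(2) unfolding g_def by blast
    then have "v \<in> labels (set A) s q" using lab1 by blast
    moreover have "u \<in> labels (set A) p s" using lab[OF uv(1)] by simp
    ultimately show ?thesis by (intro labels_append)
  qed
  have 2: "cauchy_defined (free_group X) (via M ss p s) g" "length_additive X (via M ss p s) g"
    "cauchy (free_group X) (via M ss p s) g = conv (via M ss p s) g"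
    by (intro cauchy_eq_conv; use lab2 labels_carrier in blast)+
  show ?case
    using IH[of p q] IH[of p s] IH[of s s] IH[of s q] star 1 2 via_Cons[OF s(3), of M p q]
    by (auto simp: good_exp_def g_def[symmetric])
qed

lemma accepted_correct:
  assumes wf: "well_formed M"
  shows "set qs \<subseteq> set (states M) \<Longrightarrow> good_exp (accepted A M qs) \<and>
    value_of (free_group X) (accepted A M qs) w =
      (\<Sum>q\<leftarrow>qs. via M (states M) (start M) q w * final M q) + of_bool (w = []) * final M (start M)"
proof (induction qs)
  case Nil
  then show ?case by (auto simp: good_exp_def carrier_free_group)
next
  case (Cons q qs)
  let ?e = "kleene A M (states M) (start M) q" and ?f = "Lin [(final M q, [])]"
  have k: "good_exp ?e" "value_of (free_group X) ?e = via M (states M) (start M) q"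
    using kleene_correct[of "start M" q "states M"] wf Cons.prems by (auto simp: well_formed_def)
  have f: "value_of (free_group X) ?f = (\<lambda>w. if [] = w then final M q else 0)" by simp
  have uv: "u @ v \<in> carrier (free_group X)"
    if "via M (states M) (start M) q u \<noteq> 0" "(if [] = v then final M q else 0) \<noteq> 0" for u v
  proof -
    have "u \<in> labels (set A) (start M) q"
      using via_labels[of "start M" q "states M" u] wf Cons.prems that(1) by (auto simp: well_formed_def)
    then show ?thesis using that(2) labels_carrier by (auto split: if_splits)
  qed
  let ?v = "via M (states M) (start M) q" and ?c = "\<lambda>w. if [] = w then final M q else 0"
  have c: "cauchy_defined (free_group X) ?v ?c" "length_additive X ?v ?c"
      "cauchy (free_group X) ?v ?c = conv ?v ?c"
    by (intro cauchy_eq_conv; use uv in blast)+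
  have "good_exp (Times ?e ?f)"
    using k c(1,2) unfolding good_exp_def by (simp add: carrier_free_group)
  moreover have "value_of (free_group X) (Times ?e ?f) w = via M (states M) (start M) q w * final M q"
    unfolding value_of.simps(3) k(2) f c(3) by (rule conv_unit_right)
  ultimately show ?case using Cons by (simp add: good_exp_def)
qed

lemma expression_correct:
  assumes wf: "well_formed M"
  shows "good_exp (accepted A M (states M))"
    and "value_of (free_group X) (accepted A M (states M)) w = behaviour M w"
    and "behaviour M w \<noteq> 0 \<Longrightarrow> w \<in> lists (set A)"
proof -
  show "good_exp (accepted A M (states M))" using accepted_correct[OF wf] by blast
  have v: "value_of (free_group X) (accepted A M (states M)) w =
      (\<Sum>q\<in>set (states M). via M (states M) (start M) q w * final M q) +
      of_bool (w = []) * final M (start M)"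
    using accepted_correct[OF wf, of "states M" w] wf
    by (simp add: well_formed_def sum_list_distinct_conv_sum_set)
  then show "value_of (free_group X) (accepted A M (states M)) w = behaviour M w"
    by (simp add: behaviour_def path_via)
  assume nz: "behaviour M w \<noteq> 0"
  show "w \<in> lists (set A)"
  proof (rule ccontr)
    assume w: "w \<notin> lists (set A)"
    have "via M (states M) (start M) q w = 0" if "q \<in> set (states M)" for q
      using via_labels[of "start M" q "states M" w] that w wf by (auto simp: well_formed_def labels_def)
    moreover have "w \<noteq> []" using w by auto
    ultimately have "behaviour M w = 0" by (simp add: behaviour_def path_via)
    then show False using nz by simp
  qed
qed

end

lemma typed_automaton_red:
  assumes "distinct A" "fst ` set A \<subseteq> X" "well_formed M"
  shows "typed_automaton X A (red_automaton A ws M)"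
proof (unfold_locales, fact assms(1), fact assms(2))
  fix p a q
  assume p: "p \<in> set (states (red_automaton A ws M))" and q: "q \<in> set (states (red_automaton A ws M))"
    and w: "weight (red_automaton A ws M) p a q \<noteq> 0"
  obtain l p' where p': "p = After l p'" "l = [] \<or> (\<exists>b. l = [b])"
    using p by (auto simp: red_automaton_def)
  obtain l' q' where q': "q = After l' q'" "l' = [] \<or> (\<exists>b\<in>set A. l' = [b])"
    using q by (auto simp: red_automaton_def)
  have "l' = [a]" "l \<noteq> [inv_letter a]"
    using w p' q' by (auto simp: red_automaton_def split: if_splits)
  then show "[a] \<in> labels (set A) p q"
    using p' q' by (auto simp: labels_def reduced_Cons)
qed

context ordered_free_group
begin

definition normal_expression :: "'x letter list \<Rightarrow> ('k::field, 'x word) rexp \<Rightarrow> ('k, 'x word) rexp" where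
  "normal_expression A e =
    (let M = automaton_of A (reduction A (construction_of A e)) in accepted A M (states M))"

lemma normal_expression_correct:
  fixes e :: "('k::field, 'x word) rexp"
  assumes e: "mn_exp (free_group X) r e"
  defines "A \<equiv> remdups (letters e [])"
  shows "star_rational_exp (free_group X) (normal_expression A e)"
    and "without_simplification X (normal_expression A e)"
    and "value_of (free_group X) (normal_expression A e) = value_of (free_group X) e"
    and "\<exists>m. bound_ok A (automaton_of A (construction_of A e)) m"
proof -
  let ?M = "automaton_of A (construction_of A e)"
  define N where "N = automaton_of A (reduction A (construction_of A e))"
  have A: "distinct A" "set (letters e []) \<subseteq> set A" by (simp_all add: A_def)
  have rep: "represents A (construction_of A e) (value_of (free_group X) e)"
    by (rule represents_construction_of[OF A(1) e A(2)])
  show "\<exists>m. bound_ok A ?M m" by (rule represents_reduced(1)[OF A(1) rep])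
  interpret typed_automaton X A N
    unfolding N_def reduction_def automaton_of.simps
    by (rule typed_automaton_red)
      (use A letters_carrier[OF e] in \<open>auto simp: A_def intro: well_formed_automaton_of\<close>)
  have wf: "well_formed N" unfolding N_def by (rule well_formed_automaton_of[OF A(1)])
  have ne: "normal_expression A e = accepted A N (states N)"
    by (simp add: normal_expression_def N_def Let_def)
  show "star_rational_exp (free_group X) (normal_expression A e)"
    "without_simplification X (normal_expression A e)"
    using expression_correct(1)[OF wf] by (auto simp: ne good_exp_def)
  show "value_of (free_group X) (normal_expression A e) = value_of (free_group X) e"
  proof
    fix w
    show "value_of (free_group X) (normal_expression A e) w = value_of (free_group X) e w"
    proof (cases "w \<in> lists (set A)")
      case True
      then show ?thesis
        using represents_reduced(2)[OF A(1) rep True] expression_correct(2)[OF wf, of w]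
        by (simp add: ne N_def)
    next
      case False
      then have "value_of (free_group X) e w = 0" using rep by (auto simp: represents_def supp_def)
      moreover have "behaviour N w = 0" using expression_correct(3)[OF wf, of w] False by blast
      ultimately show ?thesis using expression_correct(2)[OF wf, of w] by (simp add: ne)
    qed
  qed
qed

end

section \<open>The program\<close>

text \<open>Each number is the position of the corresponding body in \<open>program\<close>.\<close>

definition "f_append = (1 :: nat)"
definition "f_inv = (2 :: nat)"
definition "f_push = (3 :: nat)"
definition "f_nf = (4 :: nat)"
definition "f_no_suffix = (5 :: nat)"
definition "f_member = (6 :: nat)"
definition "f_remdups = (7 :: nat)"
definition "f_word_letters = (8 :: nat)"
definition "f_lin_letters = (9 :: nat)"
definition "f_letters = (10 :: nat)"
definition "f_prepend = (11 :: nat)"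
definition "f_product = (12 :: nat)"
definition "f_words = (13 :: nat)"
definition "f_passages = (14 :: nat)"
definition "f_rests = (15 :: nat)"
definition "f_lin_states = (16 :: nat)"
definition "f_tag = (17 :: nat)"
definition "f_tag_letters = (18 :: nat)"
definition "f_start = (19 :: nat)"
definition "f_states = (20 :: nat)"
definition "f_coefficient = (21 :: nat)"
definition "f_weight = (22 :: nat)"
definition "f_final = (23 :: nat)"
definition "f_path = (24 :: nat)"
definition "f_path_sum = (25 :: nat)"
definition "f_paths = (26 :: nat)"
definition "f_vanishing = (27 :: nat)"
definition "f_long = (28 :: nat)"
definition "f_bound_ok = (29 :: nat)"
definition "f_search = (30 :: nat)"
definition "f_reduction = (31 :: nat)"
definition "f_construction = (32 :: nat)"
definition "f_base = (33 :: nat)"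
definition "f_kleene = (34 :: nat)"
definition "f_accepted = (35 :: nat)"

lemmas function_defs = f_append_def f_inv_def f_push_def f_nf_def f_no_suffix_def f_member_def
  f_remdups_def f_word_letters_def f_lin_letters_def f_letters_def f_prepend_def f_product_def
  f_words_def f_passages_def f_rests_def f_lin_states_def f_tag_def f_tag_letters_def f_start_def
  f_states_def f_coefficient_def f_weight_def f_final_def f_path_def f_path_sum_def f_paths_def
  f_vanishing_def f_long_def f_bound_ok_def f_search_def f_reduction_def f_construction_def
  f_base_def f_kleene_def f_accepted_def

definition "b_main = LetIn (Call f_remdups [Call f_letters [Var 0, Quote 0]])
  (LetIn (Call f_reduction [Var 0, Call f_construction [Var 0, Var 1]])
    (Call f_accepted [Var 1, Var 0, Call f_states [Var 1, Var 0]]))"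

definition "b_append =
  IfPair (Var 0) (Pairing (Fst (Var 0)) (Call f_append [Snd (Var 0), Var 1])) (Var 1)"

definition "b_inv = Pairing (Fst (Var 0)) (IfEq (Snd (Var 0)) (Quote 0) (Quote 1) (Quote 0))"

definition "b_push = IfPair (Var 1)
  (IfEq (Fst (Var 1)) (Call f_inv [Var 0]) (Snd (Var 1)) (Pairing (Var 0) (Var 1)))
  (Pairing (Var 0) (Var 1))"

definition "b_nf =
  IfPair (Var 0) (Call f_push [Fst (Var 0), Call f_nf [Snd (Var 0)]]) (Quote 0)"

text \<open>The results \<open>Sym 2\<close> and \<open>Sym 0\<close> stand for true and false, as
  in all tests of the program.\<close>

definition "b_no_suffix = IfPair (Var 0)
  (IfPair (Call f_nf [Var 0]) (Call f_no_suffix [Snd (Var 0)]) (Quote 0)) (Quote 2)"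

definition "b_member = IfPair (Var 1)
  (IfEq (Var 0) (Fst (Var 1)) (Quote 2) (Call f_member [Var 0, Snd (Var 1)])) (Quote 0)"

definition "b_remdups = IfPair (Var 0)
  (IfEq (Call f_member [Fst (Var 0), Snd (Var 0)]) (Quote 2)
    (Call f_remdups [Snd (Var 0)])
    (Pairing (Fst (Var 0)) (Call f_remdups [Snd (Var 0)])))
  (Quote 0)"

definition "b_word_letters = IfPair (Var 0)
  (Pairing (Pairing (Fst (Var 0)) (Quote 0))
    (Pairing (Pairing (Call f_inv [Fst (Var 0)]) (Quote 0))
      (Call f_word_letters [Snd (Var 0), Var 1])))
  (Var 1)"

definition "b_lin_letters = IfPair (Var 0)
  (Call f_word_letters [Snd (Fst (Var 0)), Call f_lin_letters [Snd (Var 0), Var 1]])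
  (Var 1)"

definition "b_letters =
  IfEq (Fst (Var 0)) (Quote 0) (Call f_lin_letters [Snd (Var 0), Var 1])
  (IfEq (Fst (Var 0)) (Quote 3) (Call f_letters [Snd (Var 0), Var 1])
  (Call f_letters [Fst (Snd (Var 0)), Call f_letters [Snd (Snd (Var 0)), Var 1]]))"

definition "b_prepend = IfPair (Var 1)
  (Pairing (Call f_append [Var 0, Fst (Var 1)]) (Call f_prepend [Var 0, Snd (Var 1), Var 2]))
  (Var 2)"

definition "b_product = IfPair (Var 0)
  (Call f_prepend [Fst (Var 0), Var 1, Call f_product [Snd (Var 0), Var 1]]) (Quote 0)"

definition "b_words = IfPair (Var 1)
  (Pairing (Quote 0) (Call f_product [Var 0, Call f_words [Var 0, Snd (Var 1)]]))
  (Pairing (Quote 0) (Quote 0))"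

definition "b_passages = IfPair (Var 1)
  (LetIn (Call f_passages [Var 0, Snd (Var 1)])
    (IfEq (Call f_nf [Fst (Var 2)]) (Var 1)
      (IfPair (Var 1)
        (IfEq (Call f_no_suffix [Fst (Var 2)]) (Quote 2) (Pairing (Fst (Var 2)) (Var 0)) (Var 0))
        (Pairing (Fst (Var 2)) (Var 0)))
      (Var 0)))
  (Quote 0)"

definition "b_rests = IfPair (Var 0)
  (Pairing (Pairing (Quote 3) (Var 0)) (Call f_rests [Snd (Var 0), Var 1]))
  (Pairing (Pairing (Quote 3) (Quote 0)) (Var 1))"

definition "b_lin_states = IfPair (Var 0)
  (Call f_rests [Snd (Fst (Var 0)), Call f_lin_states [Snd (Var 0)]])
  (Pairing (Quote 0) (Quote 0))"

definition "b_tag = IfPair (Var 1)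
  (Pairing (Pairing (Var 0) (Fst (Var 1))) (Call f_tag [Var 0, Snd (Var 1), Var 2]))
  (Var 2)"

definition "b_tag_letters = IfPair (Var 0)
  (Call f_tag [Fst (Var 0), Var 1, Call f_tag_letters [Snd (Var 0), Var 1]]) (Quote 0)"

definition "b_start =
  IfEq (Fst (Var 0)) (Quote 3) (Pairing (Quote 6) (Call f_start [Fst (Snd (Var 0))]))
  (IfEq (Fst (Var 0)) (Quote 5) (Pairing (Quote 0) (Call f_start [Snd (Snd (Var 0))]))
  (Quote 0))"

definition "b_states =
  IfEq (Fst (Var 1)) (Quote 0) (Call f_remdups [Call f_lin_states [Snd (Var 1)]])
  (IfEq (Fst (Var 1)) (Quote 2)
    (Pairing (Quote 0)
      (Call f_tag [Quote 6, Call f_states [Var 0, Fst (Snd (Var 1))],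
        Call f_tag [Quote 7, Call f_states [Var 0, Snd (Snd (Var 1))], Quote 0]]))
  (IfEq (Fst (Var 1)) (Quote 3)
    (Call f_tag [Quote 6, Call f_states [Var 0, Fst (Snd (Var 1))],
      Call f_tag [Quote 7, Call f_states [Var 0, Snd (Snd (Var 1))], Quote 0]])
  (IfEq (Fst (Var 1)) (Quote 4)
    (Pairing (Quote 0) (Call f_tag [Quote 6, Call f_states [Var 0, Snd (Var 1)], Quote 0]))
  (Pairing (Pairing (Quote 0) (Call f_start [Snd (Snd (Var 1))]))
    (Call f_tag_letters [Var 0, Call f_states [Var 0, Snd (Snd (Var 1))]])))))"

definition "b_coefficient = IfPair (Var 0)
  (IfEq (Snd (Fst (Var 0))) (Var 1)
    (KAdd (Fst (Fst (Var 0))) (Call f_coefficient [Snd (Var 0), Var 1]))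
    (Call f_coefficient [Snd (Var 0), Var 1]))
  KZero"

text \<open>The arguments are the alphabet, the construction, the source, the letter and the target;
  under \<open>LetIn\<close> their indices shift by one. The cases follow
  \<open>automaton_of\<close>, with the symbols of \<open>enc_construction\<close> and
  \<open>enc_state\<close>.\<close>

definition "b_weight =
  IfEq (Fst (Var 1)) (Quote 0)
    (IfPair (Var 4)
      (IfPair (Var 2)
        (IfEq (Snd (Var 2)) (Pairing (Var 3) (Snd (Var 4))) KOne KZero)
        (Call f_coefficient [Snd (Var 1), Pairing (Var 3) (Snd (Var 4))]))
      KZero)
  (IfEq (Fst (Var 1)) (Quote 2)
    (IfPair (Var 4)
      (LetIn (IfEq (Fst (Var 4)) (Quote 6) (Fst (Snd (Var 1))) (Snd (Snd (Var 1))))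
        (IfPair (Var 3)
          (IfEq (Fst (Var 3)) (Fst (Var 5))
            (Call f_weight [Var 1, Var 0, Snd (Var 3), Var 4, Snd (Var 5)]) KZero)
          (Call f_weight [Var 1, Var 0, Call f_start [Var 0], Var 4, Snd (Var 5)])))
      KZero)
  (IfEq (Fst (Var 1)) (Quote 3)
    (IfEq (Fst (Var 4)) (Quote 6)
      (IfEq (Fst (Var 2)) (Quote 6)
        (Call f_weight [Var 0, Fst (Snd (Var 1)), Snd (Var 2), Var 3, Snd (Var 4)]) KZero)
      (IfEq (Fst (Var 2)) (Quote 6)
        (KMult (Call f_final [Var 0, Fst (Snd (Var 1)), Snd (Var 2)])
          (Call f_weight [Var 0, Snd (Snd (Var 1)), Call f_start [Snd (Snd (Var 1))], Var 3, Snd (Var 4)]))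
        (Call f_weight [Var 0, Snd (Snd (Var 1)), Snd (Var 2), Var 3, Snd (Var 4)])))
  (IfEq (Fst (Var 1)) (Quote 4)
    (IfPair (Var 4)
      (LetIn (Call f_weight [Var 0, Snd (Var 1), Call f_start [Snd (Var 1)], Var 3, Snd (Var 4)])
        (IfPair (Var 3)
          (KAdd (Call f_weight [Var 1, Snd (Var 2), Snd (Var 3), Var 4, Snd (Var 5)])
            (KMult (Call f_final [Var 1, Snd (Var 2), Snd (Var 3)]) (Var 0)))
          (Var 0)))
      KZero)
  (IfEq (Fst (Var 4)) (Pairing (Var 3) (Quote 0))
    (IfEq (Fst (Var 2)) (Pairing (Call f_inv [Var 3]) (Quote 0)) KZero
      (Call f_paths [Var 0, Snd (Snd (Var 1)), Snd (Var 2),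
        Call f_passages [Pairing (Var 3) (Quote 0), Fst (Snd (Var 1))], Snd (Var 4)]))
    KZero))))"

definition "b_final =
  IfEq (Fst (Var 1)) (Quote 0)
    (IfPair (Var 2) (IfPair (Snd (Var 2)) KZero KOne) (Call f_coefficient [Snd (Var 1), Quote 0]))
  (IfEq (Fst (Var 1)) (Quote 2)
    (IfPair (Var 2)
      (IfEq (Fst (Var 2)) (Quote 6)
        (Call f_final [Var 0, Fst (Snd (Var 1)), Snd (Var 2)])
        (Call f_final [Var 0, Snd (Snd (Var 1)), Snd (Var 2)]))
      (KAdd (Call f_final [Var 0, Fst (Snd (Var 1)), Call f_start [Fst (Snd (Var 1))]])
        (Call f_final [Var 0, Snd (Snd (Var 1)), Call f_start [Snd (Snd (Var 1))]])))
  (IfEq (Fst (Var 1)) (Quote 3)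
    (IfEq (Fst (Var 2)) (Quote 6)
      (KMult (Call f_final [Var 0, Fst (Snd (Var 1)), Snd (Var 2)])
        (Call f_final [Var 0, Snd (Snd (Var 1)), Call f_start [Snd (Snd (Var 1))]]))
      (Call f_final [Var 0, Snd (Snd (Var 1)), Snd (Var 2)]))
  (IfEq (Fst (Var 1)) (Quote 4)
    (IfPair (Var 2) (Call f_final [Var 0, Snd (Var 1), Snd (Var 2)]) KOne)
  (Call f_paths [Var 0, Snd (Snd (Var 1)), Snd (Var 2),
    Call f_passages [Quote 0, Fst (Snd (Var 1))], Quote 5]))))"

text \<open>\<open>Quote 5\<close> in the place of a target stands for \<open>None\<close>; no state
  is encoded by it.\<close>

definition "b_path = IfPair (Var 3)
  (Call f_path_sum [Var 0, Var 1, Var 2, Fst (Var 3), Snd (Var 3), Var 4, Call f_states [Var 0, Var 1]])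
  (IfEq (Var 4) (Quote 5) (Call f_final [Var 0, Var 1, Var 2]) (IfEq (Var 2) (Var 4) KOne KZero))"

definition "b_path_sum = IfPair (Var 6)
  (KAdd (KMult (Call f_weight [Var 0, Var 1, Var 2, Var 3, Fst (Var 6)])
      (Call f_path [Var 0, Var 1, Fst (Var 6), Var 4, Var 5]))
    (Call f_path_sum [Var 0, Var 1, Var 2, Var 3, Var 4, Var 5, Snd (Var 6)]))
  KZero"

definition "b_paths = IfPair (Var 3)
  (KAdd (Call f_path [Var 0, Var 1, Var 2, Fst (Var 3), Var 4])
    (Call f_paths [Var 0, Var 1, Var 2, Snd (Var 3), Var 4]))
  KZero"

definition "b_vanishing = IfPair (Var 2)
  (IfEq (Call f_path [Var 0, Var 1, Call f_start [Var 1], Fst (Var 2), Quote 5]) KZero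
    (Call f_vanishing [Var 0, Var 1, Snd (Var 2)]) (Quote 0))
  (Quote 2)"

definition "b_long = IfPair (Var 0)
  (LetIn (Call f_long [Snd (Var 0), Var 1])
    (IfPair (Call f_nf [Fst (Var 1)]) (Var 0)
      (IfEq (Call f_member [Fst (Var 1), Var 2]) (Quote 2) (Var 0)
        (Pairing (Fst (Var 1)) (Var 0)))))
  (Quote 0)"

text \<open>Numbers are lengths: the list of states itself is the bound for the contexts, and
  \<open>2 * m + 2\<close> is \<open>m\<close> appended to itself below two further pairs.\<close>

definition "b_bound_ok =
  LetIn (Call f_words [Var 0, Call f_states [Var 0, Var 1]])
    (Call f_vanishing [Var 1, Var 2, Call f_product [Var 0, Call f_product
      [Call f_long [Call f_words [Var 1,
          Pairing (Quote 0) (Pairing (Quote 0) (Call f_append [Var 3, Var 3]))],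
        Call f_words [Var 1, Var 3]], Var 0]]])"

text \<open>The only recursion without a decreasing argument. On success it returns the words of
  length at most \<open>m + 1\<close>, as \<open>reduction\<close> requires.\<close>

definition "b_search = IfEq (Call f_bound_ok [Var 0, Var 1, Var 2]) (Quote 2)
  (Call f_words [Var 0, Pairing (Quote 0) (Var 2)])
  (Call f_search [Var 0, Var 1, Pairing (Quote 0) (Var 2)])"

definition "b_reduction =
  Pairing (Quote 5) (Pairing (Call f_search [Var 0, Var 1, Quote 0]) (Var 1))"

definition "b_construction =
  IfEq (Fst (Var 1)) (Quote 0) (Var 1)
  (IfEq (Fst (Var 1)) (Quote 1)
    (Pairing (Quote 2) (Pairing (Call f_construction [Var 0, Fst (Snd (Var 1))])
      (Call f_construction [Var 0, Snd (Snd (Var 1))])))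
  (IfEq (Fst (Var 1)) (Quote 2)
    (Call f_reduction [Var 0, Pairing (Quote 3)
      (Pairing (Call f_construction [Var 0, Fst (Snd (Var 1))])
        (Call f_construction [Var 0, Snd (Snd (Var 1))]))])
  (Call f_reduction [Var 0, Pairing (Quote 4) (Call f_construction [Var 0, Snd (Var 1)])])))"

text \<open>The alphabet is passed twice: the first copy is consumed, the second is handed on to the
  weights.\<close>

definition "b_base = IfPair (Var 0)
  (Pairing (Pairing (Call f_weight [Var 1, Var 2, Var 3, Fst (Fst (Var 0)), Var 4]) (Fst (Var 0)))
    (Call f_base [Snd (Var 0), Var 1, Var 2, Var 3, Var 4]))
  (Quote 0)"

definition "b_kleene = IfPair (Var 2)
  (Pairing (Quote 1) (Pairing (Call f_kleene [Var 0, Var 1, Snd (Var 2), Var 3, Var 4])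
    (Pairing (Quote 2) (Pairing (Call f_kleene [Var 0, Var 1, Snd (Var 2), Var 3, Fst (Var 2)])
      (Pairing (Quote 2) (Pairing
        (Pairing (Quote 3) (Call f_kleene [Var 0, Var 1, Snd (Var 2), Fst (Var 2), Fst (Var 2)]))
        (Call f_kleene [Var 0, Var 1, Snd (Var 2), Fst (Var 2), Var 4])))))))
  (Pairing (Quote 0) (Call f_base [Var 0, Var 0, Var 1, Var 3, Var 4]))"

definition "b_accepted = IfPair (Var 2)
  (Pairing (Quote 1) (Pairing
    (Pairing (Quote 2) (Pairing
      (Call f_kleene [Var 0, Var 1, Call f_states [Var 0, Var 1], Call f_start [Var 1], Fst (Var 2)])
      (Pairing (Quote 0) (Pairing
        (Pairing (Call f_final [Var 0, Var 1, Fst (Var 2)]) (Quote 0)) (Quote 0)))))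
    (Call f_accepted [Var 0, Var 1, Snd (Var 2)])))
  (Pairing (Quote 0) (Pairing
    (Pairing (Call f_final [Var 0, Var 1, Call f_start [Var 1]]) (Quote 0)) (Quote 0)))"

definition program :: prog where
  "program = [b_main, b_append, b_inv, b_push, b_nf, b_no_suffix, b_member, b_remdups,
    b_word_letters, b_lin_letters, b_letters, b_prepend, b_product, b_words, b_passages, b_rests,
    b_lin_states, b_tag, b_tag_letters, b_start, b_states, b_coefficient, b_weight, b_final, b_path,
    b_path_sum, b_paths, b_vanishing, b_long, b_bound_ok, b_search, b_reduction, b_construction,
    b_base, b_kleene, b_accepted]"


subsection \<open>Evaluation\<close>

text \<open>The specifications below have the form
  \<open>runs f us v \<longleftrightarrow> v = result\<close>. The equivalence expresses termination
  and uniqueness at once, and serves as a rewrite rule for calls inside other bodies.\<close>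

definition runs :: "nat \<Rightarrow> ('k::field, 'x) val list \<Rightarrow> ('k, 'x) val \<Rightarrow> bool" where
  "runs f us v \<longleftrightarrow> f < length program \<and> eval program us (program ! f) v"

primrec is_pair :: "('k, 'x) val \<Rightarrow> bool" where
  "is_pair (Scalar x) \<longleftrightarrow> False"
| "is_pair (Gen x) \<longleftrightarrow> False"
| "is_pair (Sym x) \<longleftrightarrow> False"
| "is_pair (Pr x y) \<longleftrightarrow> True"

lemma is_pair_iff: "is_pair v \<longleftrightarrow> (\<exists>x y. v = Pr x y)"
  by (cases v) auto

lemma eval_Call_iff:
  "eval program \<rho> (Call f ts) v \<longleftrightarrow> (\<exists>us. list_all2 (eval program \<rho>) ts us \<and> runs f us v)"
  by (auto simp: runs_def elim: eval_cases intro: eval.intros)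

text \<open>Each existential stands directly before the evaluation that determines it, so it
  disappears by the one-point rule as soon as that evaluation is rewritten to an equation.\<close>

lemma eval_iffs:
  "eval P \<rho> (Var i) v \<longleftrightarrow> i < length \<rho> \<and> v = \<rho> ! i"
  "eval P \<rho> (Quote n) v \<longleftrightarrow> v = Sym n"
  "eval P \<rho> (Pairing s t) v \<longleftrightarrow> (\<exists>a. eval P \<rho> s a \<and> (\<exists>b. eval P \<rho> t b \<and> v = Pr a b))"
  "eval P \<rho> (Fst t) v \<longleftrightarrow> (\<exists>a. eval P \<rho> t a \<and> (\<exists>b. a = Pr v b))"
  "eval P \<rho> (Snd t) v \<longleftrightarrow> (\<exists>a. eval P \<rho> t a \<and> (\<exists>b. a = Pr b v))"
  "eval P \<rho> (IfPair c s t) v \<longleftrightarrow>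
    (\<exists>u. eval P \<rho> c u \<and> (if is_pair u then eval P \<rho> s v else eval P \<rho> t v))"
  "eval P \<rho> (IfEq c d s t) v \<longleftrightarrow>
    (\<exists>x. eval P \<rho> c x \<and> (\<exists>y. eval P \<rho> d y \<and> (if x = y then eval P \<rho> s v else eval P \<rho> t v)))"
  "eval P \<rho> KZero v \<longleftrightarrow> v = Scalar 0"
  "eval P \<rho> KOne v \<longleftrightarrow> v = Scalar 1"
  "eval P \<rho> (KAdd s t) v \<longleftrightarrow>
    (\<exists>a. eval P \<rho> s a \<and> (\<exists>b. eval P \<rho> t b \<and> (\<exists>x y. a = Scalar x \<and> b = Scalar y \<and> v = Scalar (x + y))))"
  "eval P \<rho> (KMult s t) v \<longleftrightarrow>
    (\<exists>a. eval P \<rho> s a \<and> (\<exists>b. eval P \<rho> t b \<and> (\<exists>x y. a = Scalar x \<and> b = Scalar y \<and> v = Scalar (x * y))))"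
  "eval P \<rho> (LetIn s t) v \<longleftrightarrow> (\<exists>u. eval P \<rho> s u \<and> eval P (u # \<rho>) t v)"
  by (auto simp: is_pair_iff elim!: eval_cases intro: eval.intros split: if_splits)

lemma list_all2_eval:
  "list_all2 R [] us \<longleftrightarrow> us = []"
  "list_all2 R (t # ts) us \<longleftrightarrow> (\<exists>x. R t x \<and> (\<exists>xs. list_all2 R ts xs \<and> us = x # xs))"
  by (auto simp: list_all2_Cons1)

lemmas eval_simps = eval_iffs eval_Call_iff list_all2_eval

text \<open>The body of the function numbered \<open>n\<close> is item \<open>n + 1\<close>.\<close>

lemma runs_unfold:
  "runs 0 us = eval program us b_main"
  "runs f_append us = eval program us b_append"
  "runs f_inv us = eval program us b_inv"
  "runs f_push us = eval program us b_push"
  "runs f_nf us = eval program us b_nf"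
  "runs f_no_suffix us = eval program us b_no_suffix"
  "runs f_member us = eval program us b_member"
  "runs f_remdups us = eval program us b_remdups"
  "runs f_word_letters us = eval program us b_word_letters"
  "runs f_lin_letters us = eval program us b_lin_letters"
  "runs f_letters us = eval program us b_letters"
  "runs f_prepend us = eval program us b_prepend"
  "runs f_product us = eval program us b_product"
  "runs f_words us = eval program us b_words"
  "runs f_passages us = eval program us b_passages"
  "runs f_rests us = eval program us b_rests"
  "runs f_lin_states us = eval program us b_lin_states"
  "runs f_tag us = eval program us b_tag"
  "runs f_tag_letters us = eval program us b_tag_letters"
  "runs f_start us = eval program us b_start"
  "runs f_states us = eval program us b_states"
  "runs f_coefficient us = eval program us b_coefficient"
  "runs f_weight us = eval program us b_weight"
  "runs f_final us = eval program us b_final"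
  "runs f_path us = eval program us b_path"
  "runs f_path_sum us = eval program us b_path_sum"
  "runs f_paths us = eval program us b_paths"
  "runs f_vanishing us = eval program us b_vanishing"
  "runs f_long us = eval program us b_long"
  "runs f_bound_ok us = eval program us b_bound_ok"
  "runs f_search us = eval program us b_search"
  "runs f_reduction us = eval program us b_reduction"
  "runs f_construction us = eval program us b_construction"
  "runs f_base us = eval program us b_base"
  "runs f_kleene us = eval program us b_kleene"
  "runs f_accepted us = eval program us b_accepted"
  by (auto simp: fun_eq_iff runs_def program_def function_defs)

section \<open>Encoding of words, states and constructions\<close>

abbreviation enc_word :: "'x word \<Rightarrow> ('k, 'x) val" where
  "enc_word \<equiv> enc_list enc_letter"

text \<open>\<open>After\<close> has no symbol of its own: its first component is
  \<open>Sym 0\<close> or a pair, and so never one of the symbols 3, 6 and 7.\<close>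

primrec enc_state :: "'x state \<Rightarrow> ('k, 'x) val" where
  "enc_state Init = Sym 0"
| "enc_state (Rest w) = Pr (Sym 3) (enc_word w)"
| "enc_state (InL s) = Pr (Sym 6) (enc_state s)"
| "enc_state (InR s) = Pr (Sym 7) (enc_state s)"
| "enc_state (After w s) = Pr (enc_word w) (enc_state s)"

primrec enc_construction :: "('k, 'x) construction \<Rightarrow> ('k, 'x) val" where
  "enc_construction (CLin cs) = Pr (Sym 0) (enc_list enc_monomial cs)"
| "enc_construction (CPlus c d) = Pr (Sym 2) (Pr (enc_construction c) (enc_construction d))"
| "enc_construction (CTimes c d) = Pr (Sym 3) (Pr (enc_construction c) (enc_construction d))"
| "enc_construction (CStar c) = Pr (Sym 4) (enc_construction c)"
| "enc_construction (CRed ws c) = Pr (Sym 5) (Pr (enc_list enc_word ws) (enc_construction c))"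

text \<open>Letters are stored as words of length one, so that the alphabet can be passed to
  \<open>f_product\<close> as a list of words.\<close>

definition enc_alphabet :: "'x letter list \<Rightarrow> ('k, 'x) val" where
  "enc_alphabet A = enc_list (\<lambda>a. enc_word [a]) A"

primrec enc_target :: "'x state option \<Rightarrow> ('k, 'x) val" where
  "enc_target None = Sym 5"
| "enc_target (Some s) = enc_state s"

definition enc_bool :: "bool \<Rightarrow> ('k, 'x) val" where
  "enc_bool b = (if b then Sym 2 else Sym 0)"

text \<open>Natural numbers are represented in unary by the length of any list.\<close>

primrec unary :: "('k, 'x) val \<Rightarrow> nat" where
  "unary (Scalar x) = 0"
| "unary (Gen x) = 0"
| "unary (Sym x) = 0"
| "unary (Pr x y) = Suc (unary y)"

primrec val_append :: "('k, 'x) val \<Rightarrow> ('k, 'x) val \<Rightarrow> ('k, 'x) val" where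
  "val_append (Scalar x) v = v"
| "val_append (Gen x) v = v"
| "val_append (Sym x) v = v"
| "val_append (Pr x y) v = Pr x (val_append y v)"

lemma unary_enc_list [simp]: "unary (enc_list g xs) = length xs"
  by (induction xs) auto

lemma unary_val_append [simp]: "unary (val_append u v) = unary u + unary v"
  by (induction u) auto

lemma enc_list_append [simp]: "enc_list g (xs @ ys) = val_append (enc_list g xs) (enc_list g ys)"
  by (induction xs) auto

lemma val_append_Nil [simp]: "val_append (enc_list g xs) (Sym 0) = enc_list g xs"
  by (induction xs) auto

lemma enc_list_map [simp]: "enc_list g (map f xs) = enc_list (\<lambda>x. g (f x)) xs"
  by (induction xs) auto

lemma is_pair_enc_list [simp]: "is_pair (enc_list g xs) \<longleftrightarrow> xs \<noteq> []"
  by (cases xs) auto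

lemma enc_list_eq_Sym [simp]:
  "enc_list g xs = Sym n \<longleftrightarrow> xs = [] \<and> n = 0" "Sym n = enc_list g xs \<longleftrightarrow> xs = [] \<and> n = 0"
  by (cases xs; auto)+

lemma enc_list_eq_iff: "inj g \<Longrightarrow> enc_list g xs = enc_list g ys \<longleftrightarrow> xs = ys"
proof (induction xs arbitrary: ys)
  case (Cons x xs)
  then show ?case by (cases ys) (auto simp: inj_eq)
qed auto

lemma enc_letter_eq_iff [simp]: "enc_letter a = enc_letter b \<longleftrightarrow> a = b"
  by (cases a; cases b) (auto simp: enc_letter_def of_bool_def split: if_splits)

lemma inj_enc_letter: "inj enc_letter"
  by (simp add: inj_def)

lemmas enc_word_eq_iff [simp] = enc_list_eq_iff[OF inj_enc_letter]

lemma enc_word_eq_Pr [simp]: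
  "enc_word w = Pr (enc_letter a) (enc_word v) \<longleftrightarrow> w = a # v"
  "Pr (enc_letter a) (enc_word v) = enc_word w \<longleftrightarrow> w = a # v"
  "enc_word w = Pr (enc_letter a) (Sym 0) \<longleftrightarrow> w = [a]"
  "Pr (enc_letter a) (Sym 0) = enc_word w \<longleftrightarrow> w = [a]"
  by (cases w; auto)+

lemma enc_state_eq_iff [simp]: "enc_state p = enc_state q \<longleftrightarrow> p = q"
proof (induction p arbitrary: q)
  case (After w p)
  then show ?case by (cases q) auto
next
  case (Rest w)
  then show ?case by (cases q) auto
next
  case (InL p)
  then show ?case by (cases q) auto
next
  case (InR p)
  then show ?case by (cases q) auto
next
  case Init
  then show ?case by (cases q) auto
qed

lemma enc_state_neq_5 [simp]: "enc_state p \<noteq> Sym 5"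
  by (cases p) auto

lemma enc_bool_eq [simp]: "enc_bool b = Sym 2 \<longleftrightarrow> b"
  by (simp add: enc_bool_def)


section \<open>Functions on words, lists and states\<close>

lemma runs_append: "runs f_append [x, y] v \<longleftrightarrow> v = val_append x y"
  by (induction x arbitrary: v) (auto simp: runs_unfold(2) b_append_def eval_simps)

lemma runs_inv: "runs f_inv [enc_letter a] v \<longleftrightarrow> v = enc_letter (inv_letter a)"
  by (simp add: runs_unfold(3) b_inv_def eval_simps enc_letter_def inv_letter_def)

lemma runs_push: "runs f_push [enc_letter a, enc_word w] v \<longleftrightarrow> v = enc_word (push a w)"
  by (cases w) (auto simp: runs_unfold(4) b_push_def eval_simps runs_inv)

lemma runs_nf: "runs f_nf [enc_word w] v \<longleftrightarrow> v = enc_word (nf w)"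
  by (induction w arbitrary: v)
    (simp_all add: runs_unfold(5) b_nf_def eval_simps runs_push nf_Cons)

lemma runs_nf_Cons:
  "runs f_nf [Pr (enc_letter a) (enc_word w)] v \<longleftrightarrow> v = enc_word (nf (a # w))"
  using runs_nf[of "a # w" v] by simp

lemma runs_no_suffix: "runs f_no_suffix [enc_word w] v \<longleftrightarrow> v = enc_bool (no_trivial_suffix w)"
proof (induction w arbitrary: v)
  case (Cons a w)
  show ?case
    using Cons by (simp add: runs_unfold(6) b_no_suffix_def eval_simps runs_nf_Cons enc_bool_def)
qed (simp add: runs_unfold(6) b_no_suffix_def eval_simps enc_bool_def)

lemma runs_member: "runs f_member [x, enc_list g xs] v \<longleftrightarrow> v = enc_bool (x \<in> g ` set xs)"
  by (induction xs arbitrary: v) (auto simp: runs_unfold(7) b_member_def eval_simps enc_bool_def)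

lemma runs_remdups:
  "inj g \<Longrightarrow> runs f_remdups [enc_list g xs] v \<longleftrightarrow> v = enc_list g (remdups xs)"
  by (induction xs arbitrary: v)
    (auto simp: runs_unfold(8) b_remdups_def eval_simps runs_member inj_image_mem_iff)

lemma runs_word_letters:
  "runs f_word_letters [enc_word w, enc_alphabet acc] v \<longleftrightarrow> v = enc_alphabet (word_letters w acc)"
  by (induction w arbitrary: v)
    (simp_all add: runs_unfold(9) b_word_letters_def eval_simps runs_inv enc_alphabet_def)

lemma runs_lin_letters:
  "runs f_lin_letters [enc_list enc_monomial cs, enc_alphabet acc] v \<longleftrightarrow>
    v = enc_alphabet (lin_letters cs acc)"
  by (induction cs arbitrary: v)
    (simp_all add: runs_unfold(10) b_lin_letters_def eval_simps runs_word_letters enc_monomial_def)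

lemma runs_letters:
  "runs f_letters [enc e, enc_alphabet acc] v \<longleftrightarrow> v = enc_alphabet (letters e acc)"
  by (induction e arbitrary: v acc)
    (simp_all add: runs_unfold(11) b_letters_def eval_simps runs_lin_letters)

definition product :: "'a list list \<Rightarrow> 'a list list \<Rightarrow> 'a list list" where
  "product us ws = concat (map (\<lambda>u. map ((@) u) ws) us)"

lemma runs_prepend:
  "runs f_prepend [enc_word u, enc_list enc_word ws, enc_list enc_word acc] v \<longleftrightarrow>
    v = enc_list enc_word (map ((@) u) ws @ acc)"
  by (induction ws arbitrary: v)
    (simp_all add: runs_unfold(12) b_prepend_def eval_simps runs_append del: enc_list_map)

lemma runs_product:
  "runs f_product [enc_list enc_word us, enc_list enc_word ws] v \<longleftrightarrow>
    v = enc_list enc_word (product us ws)"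
  by (induction us arbitrary: v)
    (simp_all add: runs_unfold(13) b_product_def eval_simps runs_prepend product_def del: enc_list_map)

lemma runs_product_alphabet:
  fixes A :: "'x letter list"
  shows "runs f_product [enc_alphabet A, enc_list enc_word ws] v \<longleftrightarrow>
    v = enc_list enc_word (concat (map (\<lambda>a. map ((#) a) ws) A))"
proof -
  have "(@) [a] = (#) a" for a :: "'x letter" by (simp add: fun_eq_iff)
  then show ?thesis
    using runs_product[of "map (\<lambda>a. [a]) A" ws v]
    by (simp add: enc_alphabet_def product_def o_def)
qed

lemma runs_words: "runs f_words [enc_alphabet A, n] v \<longleftrightarrow> v = enc_list enc_word (words A (unary n))"
proof (induction n arbitrary: v)
  case (Pr x n)
  then show ?case
    by (simp add: runs_unfold(14) b_words_def eval_simps words.simps runs_product_alphabet del: enc_list_map)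
qed (simp_all add: runs_unfold(14) b_words_def eval_simps words.simps)

lemma runs_passages:
  "runs f_passages [enc_word y, enc_list enc_word ws] v \<longleftrightarrow> v = enc_list enc_word (passages y ws)"
  by (induction ws arbitrary: v)
    (auto simp: runs_unfold(15) b_passages_def eval_simps runs_nf runs_no_suffix passages_def)

lemma runs_rests:
  "runs f_rests [enc_word w, acc] v \<longleftrightarrow> v = val_append (enc_list enc_state (rests w)) acc"
  by (induction w arbitrary: v) (simp_all add: runs_unfold(16) b_rests_def eval_simps)

lemma runs_lin_states:
  "runs f_lin_states [enc_list enc_monomial cs] v \<longleftrightarrow>
    v = enc_list enc_state (concat (map (\<lambda>(c, w). rests w) cs) @ [Init])"
proof (induction cs arbitrary: v)
  case (Cons m cs)
  then show ?case
    by (cases m) (simp add: runs_unfold(17) b_lin_states_def eval_simps runs_rests enc_monomial_def)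
qed (simp add: runs_unfold(17) b_lin_states_def eval_simps)

lemma runs_tag:
  "runs f_tag [t, enc_list g xs, acc] v \<longleftrightarrow> v = val_append (enc_list (\<lambda>x. Pr t (g x)) xs) acc"
  by (induction xs arbitrary: v) (simp_all add: runs_unfold(18) b_tag_def eval_simps)

lemma runs_tag_letters:
  "runs f_tag_letters [enc_alphabet A, enc_list enc_state ps] v \<longleftrightarrow>
    v = enc_list enc_state (concat (map (\<lambda>a. map (After [a]) ps) A))"
proof (induction A arbitrary: v)
  case (Cons a A)
  then show ?case
    by (simp add: runs_unfold(19) b_tag_letters_def eval_simps runs_tag enc_alphabet_def)
qed (simp add: runs_unfold(19) b_tag_letters_def eval_simps enc_alphabet_def)

lemma runs_start:
  "runs f_start [enc_construction c] v \<longleftrightarrow> v = enc_state (start (automaton_of A c))"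
  by (induction c arbitrary: v)
    (simp_all add: runs_unfold(20) b_start_def eval_simps lin_automaton_def plus_automaton_def
      times_automaton_def star_automaton_def red_automaton_def)


lemma inj_enc_state: "inj enc_state"
  by (simp add: inj_def)

lemma runs_states:
  "runs f_states [enc_alphabet A, enc_construction c] v \<longleftrightarrow>
    v = enc_list enc_state (states (automaton_of A c))"
proof (induction c arbitrary: v)
  case (CLin cs)
  show ?case
    by (simp add: runs_unfold(21) b_states_def eval_simps runs_lin_states
        runs_remdups[OF inj_enc_state] lin_automaton_def del: enc_list_append)
next
  case (CRed ws c)
  then show ?case
    by (simp add: runs_unfold(21) b_states_def eval_simps runs_start[where A = A] runs_tag_letters
        red_automaton_def)
qed (simp_all add: runs_unfold(21) b_states_def eval_simps runs_tag plus_automaton_def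
      times_automaton_def star_automaton_def)

section \<open>Coefficients, weights and paths\<close>

lemma runs_coefficient:
  "runs f_coefficient [enc_list enc_monomial cs, enc_word w] v \<longleftrightarrow> v = Scalar (coefficient cs w)"
  by (induction cs arbitrary: v)
    (auto simp: runs_unfold(22) b_coefficient_def eval_simps enc_monomial_def coefficient_def
      split: prod.splits)

lemma runs_coefficient_Cons:
  "runs f_coefficient [enc_list enc_monomial cs, Pr (enc_letter a) (enc_word w)] v \<longleftrightarrow>
    v = Scalar (coefficient cs (a # w))"
  using runs_coefficient[of cs "a # w" v] by simp

lemma runs_coefficient_Nil:
  "runs f_coefficient [enc_list enc_monomial cs, Sym 0] v \<longleftrightarrow> v = Scalar (coefficient cs [])"
  using runs_coefficient[of cs "[]" v] by simp

text \<open>The restriction to states of the automaton matters: elsewhere the program may project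
  from a symbol, for instance at \<open>Init\<close> in a product. As a predicate on
  \<open>c\<close> it also breaks the mutual recursion, since weights of a reduction need only paths
  of the smaller construction.\<close>

definition runs_ok :: "'x letter list \<Rightarrow> ('k::field, 'x) construction \<Rightarrow> bool" where
  "runs_ok A c \<longleftrightarrow> (let M = automaton_of A c in \<forall>p\<in>set (states M).
    (\<forall>v. runs f_final [enc_alphabet A, enc_construction c, enc_state p] v \<longleftrightarrow> v = Scalar (final M p)) \<and>
    (\<forall>q\<in>set (states M). \<forall>a v.
      runs f_weight [enc_alphabet A, enc_construction c, enc_state p, enc_letter a, enc_state q] v \<longleftrightarrow>
        v = Scalar (weight M p a q)))"

lemma runs_final:
  "runs_ok A c \<Longrightarrow> p \<in> set (states (automaton_of A c)) \<Longrightarrow>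
    runs f_final [enc_alphabet A, enc_construction c, enc_state p] v \<longleftrightarrow>
      v = Scalar (final (automaton_of A c) p)"
  by (simp add: runs_ok_def Let_def)

lemma runs_weight:
  "runs_ok A c \<Longrightarrow> p \<in> set (states (automaton_of A c)) \<Longrightarrow> q \<in> set (states (automaton_of A c)) \<Longrightarrow>
    runs f_weight [enc_alphabet A, enc_construction c, enc_state p, enc_letter a, enc_state q] v \<longleftrightarrow>
      v = Scalar (weight (automaton_of A c) p a q)"
  unfolding runs_ok_def Let_def by blast

text \<open>The weights of the remaining word are abstracted into \<open>h\<close>, which separates
  this induction over target states from the one over the word in \<open>runs_path\<close>.\<close>

lemma runs_path_sum:
  assumes ok: "runs_ok A c" and p: "p \<in> set (states (automaton_of A c))"
    and w: "\<And>s v. s \<in> set (states (automaton_of A c)) \<Longrightarrow>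
      runs f_path [enc_alphabet A, enc_construction c, enc_state s, enc_word w, t] v \<longleftrightarrow> v = Scalar (h s)"
  shows "set ss \<subseteq> set (states (automaton_of A c)) \<Longrightarrow>
    runs f_path_sum [enc_alphabet A, enc_construction c, enc_state p, enc_letter a, enc_word w, t,
      enc_list enc_state ss] v \<longleftrightarrow>
    v = Scalar (\<Sum>s\<leftarrow>ss. weight (automaton_of A c) p a s * h s)"
  by (induction ss arbitrary: v)
    (simp_all add: runs_unfold(26) b_path_sum_def eval_simps runs_weight[OF ok p] w)

lemma distinct_states: "distinct A \<Longrightarrow> distinct (states (automaton_of A c))"
  using well_formed_automaton_of[of A c] by (simp add: well_formed_def)

lemma start_states: "distinct A \<Longrightarrow> start (automaton_of A c) \<in> set (states (automaton_of A c))"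
  using well_formed_automaton_of[of A c] by (simp add: well_formed_def)

lemma runs_path:
  assumes A: "distinct A" and ok: "runs_ok A c"
  shows "p \<in> set (states (automaton_of A c)) \<Longrightarrow>
    runs f_path [enc_alphabet A, enc_construction c, enc_state p, enc_word w, enc_target t] v \<longleftrightarrow>
    v = Scalar (path (automaton_of A c) p w t)"
proof (induction w arbitrary: p v)
  case Nil
  then show ?case
    by (cases t) (auto simp: runs_unfold(25) b_path_def eval_simps runs_final[OF ok])
next
  case (Cons a w)
  then show ?case
    by (simp add: runs_unfold(25) b_path_def eval_simps runs_states
        runs_path_sum[OF ok, where h = "\<lambda>s. path (automaton_of A c) s w t"]
        sum_list_distinct_conv_sum_set[OF distinct_states[OF A]])
qed

lemma runs_paths:
  assumes "distinct A" "runs_ok A c" "p \<in> set (states (automaton_of A c))"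
  shows "runs f_paths [enc_alphabet A, enc_construction c, enc_state p, enc_list enc_word ws,
      enc_target t] v \<longleftrightarrow> v = Scalar (\<Sum>w\<leftarrow>ws. path (automaton_of A c) p w t)"
  by (induction ws arbitrary: v)
    (simp_all add: runs_unfold(27) b_paths_def eval_simps runs_path[OF assms])

lemmas runs_paths_None = runs_paths[where t = None, simplified enc_target.simps]

lemmas runs_paths_Some = runs_paths[where t = "Some q" for q, simplified enc_target.simps]

lemma runs_passages_singleton:
  "runs f_passages [Pr (enc_letter a) (Sym 0), enc_list enc_word ws] v \<longleftrightarrow>
    v = enc_list enc_word (passages [a] ws)"
  using runs_passages[of "[a]" ws v] by simp

lemma runs_passages_Nil:
  "runs f_passages [Sym 0, enc_list enc_word ws] v \<longleftrightarrow> v = enc_list enc_word (passages [] ws)"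
  using runs_passages[of "[]" ws v] by simp

lemma runs_okI:
  assumes "\<And>p v. p \<in> set (states (automaton_of A c)) \<Longrightarrow>
      runs f_final [enc_alphabet A, enc_construction c, enc_state p] v \<longleftrightarrow>
        v = Scalar (final (automaton_of A c) p)"
    and "\<And>p q a v. p \<in> set (states (automaton_of A c)) \<Longrightarrow> q \<in> set (states (automaton_of A c)) \<Longrightarrow>
      runs f_weight [enc_alphabet A, enc_construction c, enc_state p, enc_letter a, enc_state q] v \<longleftrightarrow>
        v = Scalar (weight (automaton_of A c) p a q)"
  shows "runs_ok A c"
  unfolding runs_ok_def Let_def using assms by blast

lemma states_automaton_of_cases:
  "p \<in> set (states (automaton_of A (CLin cs))) \<Longrightarrow> p = Init \<or> (\<exists>w. p = Rest w)"
  "p \<in> set (states (automaton_of A (CPlus c d))) \<Longrightarrow> p = Init \<or>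
    (\<exists>x. p = InL x \<and> x \<in> set (states (automaton_of A c))) \<or>
    (\<exists>x. p = InR x \<and> x \<in> set (states (automaton_of A d)))"
  "p \<in> set (states (automaton_of A (CTimes c d))) \<Longrightarrow>
    (\<exists>x. p = InL x \<and> x \<in> set (states (automaton_of A c))) \<or>
    (\<exists>x. p = InR x \<and> x \<in> set (states (automaton_of A d)))"
  "p \<in> set (states (automaton_of A (CStar c))) \<Longrightarrow> p = Init \<or>
    (\<exists>x. p = InL x \<and> x \<in> set (states (automaton_of A c)))"
  "distinct A \<Longrightarrow> p \<in> set (states (automaton_of A (CRed ws c))) \<Longrightarrow>
    \<exists>l x. p = After l x \<and> x \<in> set (states (automaton_of A c))"
  by (auto simp: states_lin plus_automaton_def times_automaton_def star_automaton_def
      red_automaton_def start_states)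

lemma runs_ok: "distinct A \<Longrightarrow> runs_ok A c"
proof (induction c)
  case (CLin cs)
  note [simp] = b_weight_def b_final_def eval_simps lin_automaton_def runs_coefficient_Cons runs_coefficient_Nil
  show ?case
  proof (rule runs_okI)
    fix p v assume "p \<in> set (states (automaton_of A (CLin cs)))"
    then show "runs f_final [enc_alphabet A, enc_construction (CLin cs), enc_state p] v \<longleftrightarrow>
        v = Scalar (final (automaton_of A (CLin cs)) p)"
      by (subst runs_unfold(24), elim states_automaton_of_cases(1)[elim_format] disjE exE conjE) simp_all
  next
    fix p q a v
    assume "p \<in> set (states (automaton_of A (CLin cs)))" "q \<in> set (states (automaton_of A (CLin cs)))"
    then show "runs f_weight [enc_alphabet A, enc_construction (CLin cs), enc_state p,
          enc_letter a, enc_state q] v \<longleftrightarrow>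
        v = Scalar (weight (automaton_of A (CLin cs)) p a q)"
      by (subst runs_unfold(23), elim states_automaton_of_cases(1)[elim_format] disjE exE conjE) simp_all
  qed
next
  case (CPlus c d)
  have ok: "runs_ok A c" "runs_ok A d" using CPlus by auto
  note [simp] = ok[THEN runs_final] ok[THEN runs_weight] start_states[OF CPlus.prems]
  note [simp] = b_weight_def b_final_def eval_simps plus_automaton_def runs_start[where A = A]
  show ?case
  proof (rule runs_okI)
    fix p v assume "p \<in> set (states (automaton_of A (CPlus c d)))"
    then show "runs f_final [enc_alphabet A, enc_construction (CPlus c d), enc_state p] v \<longleftrightarrow>
        v = Scalar (final (automaton_of A (CPlus c d)) p)"
      by (subst runs_unfold(24), elim states_automaton_of_cases(2)[elim_format] disjE exE conjE) simp_all
  next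
    fix p q a v
    assume "p \<in> set (states (automaton_of A (CPlus c d)))" "q \<in> set (states (automaton_of A (CPlus c d)))"
    then show "runs f_weight [enc_alphabet A, enc_construction (CPlus c d), enc_state p,
          enc_letter a, enc_state q] v \<longleftrightarrow>
        v = Scalar (weight (automaton_of A (CPlus c d)) p a q)"
      by (subst runs_unfold(23), elim states_automaton_of_cases(2)[elim_format] disjE exE conjE) simp_all
  qed
next
  case (CTimes c d)
  have ok: "runs_ok A c" "runs_ok A d" using CTimes by auto
  note [simp] = ok[THEN runs_final] ok[THEN runs_weight] start_states[OF CTimes.prems]
  note [simp] = b_weight_def b_final_def eval_simps times_automaton_def runs_start[where A = A]
  show ?case
  proof (rule runs_okI)
    fix p v assume "p \<in> set (states (automaton_of A (CTimes c d)))"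
    then show "runs f_final [enc_alphabet A, enc_construction (CTimes c d), enc_state p] v \<longleftrightarrow>
        v = Scalar (final (automaton_of A (CTimes c d)) p)"
      by (subst runs_unfold(24), elim states_automaton_of_cases(3)[elim_format] disjE exE conjE) simp_all
  next
    fix p q a v
    assume "p \<in> set (states (automaton_of A (CTimes c d)))" "q \<in> set (states (automaton_of A (CTimes c d)))"
    then show "runs f_weight [enc_alphabet A, enc_construction (CTimes c d), enc_state p,
          enc_letter a, enc_state q] v \<longleftrightarrow>
        v = Scalar (weight (automaton_of A (CTimes c d)) p a q)"
      by (subst runs_unfold(23), elim states_automaton_of_cases(3)[elim_format] disjE exE conjE) simp_all
  qed
next
  case (CStar c)
  have ok: "runs_ok A c" using CStar by auto
  note [simp] = ok[THEN runs_final] ok[THEN runs_weight] start_states[OF CStar.prems]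
  note [simp] = b_weight_def b_final_def eval_simps star_automaton_def runs_start[where A = A]
  show ?case
  proof (rule runs_okI)
    fix p v assume "p \<in> set (states (automaton_of A (CStar c)))"
    then show "runs f_final [enc_alphabet A, enc_construction (CStar c), enc_state p] v \<longleftrightarrow>
        v = Scalar (final (automaton_of A (CStar c)) p)"
      by (subst runs_unfold(24), elim states_automaton_of_cases(4)[elim_format] disjE exE conjE) simp_all
  next
    fix p q a v
    assume "p \<in> set (states (automaton_of A (CStar c)))" "q \<in> set (states (automaton_of A (CStar c)))"
    then show "runs f_weight [enc_alphabet A, enc_construction (CStar c), enc_state p,
          enc_letter a, enc_state q] v \<longleftrightarrow>
        v = Scalar (weight (automaton_of A (CStar c)) p a q)"
      by (subst runs_unfold(23), elim states_automaton_of_cases(4)[elim_format] disjE exE conjE) simp_all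
  qed
next
  case (CRed ws c)
  have ok: "runs_ok A c" using CRed by auto
  note [simp] = b_weight_def b_final_def eval_simps red_automaton_def runs_passages_singleton
    runs_passages_Nil runs_inv runs_paths_None[OF CRed.prems ok] runs_paths_Some[OF CRed.prems ok]
  show ?case
  proof (rule runs_okI)
    fix p v assume "p \<in> set (states (automaton_of A (CRed ws c)))"
    then show "runs f_final [enc_alphabet A, enc_construction (CRed ws c), enc_state p] v \<longleftrightarrow>
        v = Scalar (final (automaton_of A (CRed ws c)) p)"
      by (subst runs_unfold(24), elim states_automaton_of_cases(5)[OF CRed.prems, elim_format] disjE exE conjE) simp_all
  next
    fix p q a v
    assume "p \<in> set (states (automaton_of A (CRed ws c)))" "q \<in> set (states (automaton_of A (CRed ws c)))"
    then show "runs f_weight [enc_alphabet A, enc_construction (CRed ws c), enc_state p,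
          enc_letter a, enc_state q] v \<longleftrightarrow>
        v = Scalar (weight (automaton_of A (CRed ws c)) p a q)"
      by (subst runs_unfold(23), elim states_automaton_of_cases(5)[OF CRed.prems, elim_format] disjE exE conjE) simp_all
  qed
qed

section \<open>The search for the bound and the output\<close>

lemma runs_vanishing:
  assumes A: "distinct A"
  shows "runs f_vanishing [enc_alphabet A, enc_construction c, enc_list enc_word ws] v \<longleftrightarrow>
    v = enc_bool (\<forall>w\<in>set ws. behaviour (automaton_of A c) w = 0)"
proof (induction ws arbitrary: v)
  case (Cons w ws)
  show ?case
    by (subst runs_unfold(28)) (simp add: b_vanishing_def eval_simps runs_start[where A = A]
        behaviour_def enc_bool_def Cons
        runs_path[OF A runs_ok[OF A] start_states[OF A], where t = None, simplified enc_target.simps])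
qed (simp add: runs_unfold(28) b_vanishing_def eval_simps enc_bool_def)

lemma runs_long:
  "runs f_long [enc_list enc_word ws, enc_list enc_word vs] v \<longleftrightarrow>
    v = enc_list enc_word (filter (\<lambda>w. nf w = [] \<and> w \<notin> set vs) ws)"
  by (induction ws arbitrary: v)
    (simp_all add: runs_unfold(29) b_long_def eval_simps runs_nf runs_member inj_image_mem_iff inj_def)

lemma runs_bound_ok:
  assumes A: "distinct A"
  shows "runs f_bound_ok [enc_alphabet A, enc_construction c, m] v \<longleftrightarrow>
    v = enc_bool (bound_ok A (automaton_of A c) (unary m))"
proof -
  let ?M = "automaton_of A c"
  let ?W = "words A (length (states ?M))"
  have "bound_ok A ?M (unary m) \<longleftrightarrow> (\<forall>w\<in>set (product ?W (product
      (filter (\<lambda>w. nf w = [] \<and> w \<notin> set (words A (unary m)))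
        (words A (Suc (Suc (unary m + unary m))))) ?W)). behaviour ?M w = 0)"
    by (auto simp: bound_ok_def product_def mult_2)
  then show ?thesis
    by (simp add: runs_unfold(30) b_bound_ok_def eval_simps runs_states runs_words runs_append
        runs_long runs_product runs_vanishing[OF A])
qed

text \<open>Induction on the distance to \<open>k\<close>. Since \<open>k\<close> is least, the test
  fails at every earlier number and the search moves on.\<close>

lemma runs_search:
  assumes A: "distinct A" and k: "bound_ok A (automaton_of A c) k"
    "\<And>j. j < k \<Longrightarrow> \<not> bound_ok A (automaton_of A c) j"
  shows "unary m \<le> k \<Longrightarrow> runs f_search [enc_alphabet A, enc_construction c, m] v \<longleftrightarrow>
    v = enc_list enc_word (words A (Suc k))"
proof (induction "k - unary m" arbitrary: m)
  case 0
  then show ?case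
    using k(1)
    by (subst runs_unfold(31)) (simp add: b_search_def eval_simps runs_bound_ok[OF A] runs_words)
next
  case (Suc n)
  then have "\<not> bound_ok A (automaton_of A c) (unary m)" using k(2) by simp
  moreover have "runs f_search [enc_alphabet A, enc_construction c, Pr (Sym 0) m] v \<longleftrightarrow>
      v = enc_list enc_word (words A (Suc k))"
    using Suc(1)[of "Pr (Sym 0) m"] Suc(2) by simp
  ultimately show ?case
    by (subst runs_unfold(31)) (simp add: b_search_def eval_simps runs_bound_ok[OF A])
qed

lemma runs_reduction:
  assumes A: "distinct A" and "\<exists>m. bound_ok A (automaton_of A c) m"
  shows "runs f_reduction [enc_alphabet A, enc_construction c] v \<longleftrightarrow>
    v = enc_construction (reduction A c)"
proof -
  let ?k = "LEAST m. bound_ok A (automaton_of A c) m"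
  have "runs f_search [enc_alphabet A, enc_construction c, Sym 0] v \<longleftrightarrow>
      v = enc_list enc_word (words A (Suc ?k))" for v
    by (rule runs_search[OF A LeastI_ex[OF assms(2)]]) (drule not_less_Least, assumption, simp)
  then show ?thesis by (simp add: runs_unfold(32) b_reduction_def eval_simps reduction_def)
qed

lemma runs_base:
  assumes "distinct A" "p \<in> set (states (automaton_of A c))" "q \<in> set (states (automaton_of A c))"
  shows "runs f_base [enc_alphabet B, enc_alphabet A, enc_construction c, enc_state p, enc_state q] v \<longleftrightarrow>
    v = enc_list enc_monomial (map (\<lambda>a. (weight (automaton_of A c) p a q, [a])) B)"
proof (induction B arbitrary: v)
  case Nil
  show ?case by (simp add: runs_unfold(34) b_base_def eval_simps enc_alphabet_def)
next
  case (Cons b B)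
  have B: "enc_alphabet (b # B) = Pr (Pr (enc_letter b) (Sym 0)) (enc_alphabet B)"
    by (simp add: enc_alphabet_def)
  show ?case
    unfolding B
    by (subst runs_unfold(34)) (simp add: b_base_def eval_simps Cons
        runs_weight[OF runs_ok[OF assms(1)] assms(2,3)] enc_monomial_def[of "(_, _)"] del: enc_list_map)
qed

lemma runs_kleene:
  assumes A: "distinct A"
  shows "p \<in> set (states (automaton_of A c)) \<Longrightarrow> q \<in> set (states (automaton_of A c)) \<Longrightarrow>
    set ss \<subseteq> set (states (automaton_of A c)) \<Longrightarrow>
    runs f_kleene [enc_alphabet A, enc_construction c, enc_list enc_state ss, enc_state p, enc_state q] v
      \<longleftrightarrow> v = enc (kleene A (automaton_of A c) ss p q)"
proof (induction ss arbitrary: p q v)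
  case Nil
  then show ?case
    by (subst runs_unfold(35)) (simp add: b_kleene_def eval_simps runs_base[OF A] del: enc_list_map)
next
  case (Cons s ss)
  then show ?case
    by (subst runs_unfold(35)) (simp add: b_kleene_def eval_simps)
qed

lemma runs_accepted:
  assumes A: "distinct A"
  shows "set qs \<subseteq> set (states (automaton_of A c)) \<Longrightarrow>
    runs f_accepted [enc_alphabet A, enc_construction c, enc_list enc_state qs] v \<longleftrightarrow>
      v = enc (accepted A (automaton_of A c) qs)"
proof (induction qs arbitrary: v)
  case Nil
  show ?case
    by (subst runs_unfold(36)) (simp add: b_accepted_def eval_simps runs_start[where A = A]
        runs_final[OF runs_ok[OF A]] start_states[OF A] enc_monomial_def)
next
  case (Cons q qs)
  then show ?case
    by (subst runs_unfold(36)) (simp add: b_accepted_def eval_simps runs_states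
        runs_start[where A = A] runs_kleene[OF A] runs_final[OF runs_ok[OF A]] start_states[OF A]
        enc_monomial_def)
qed

context ordered_free_group
begin

text \<open>The hypothesis \<open>mn_exp\<close> provides the bounds that end the search at each
  product and each star.\<close>

lemma runs_construction:
  assumes A: "distinct A"
  shows "mn_exp (free_group X) r e \<Longrightarrow> set (letters e []) \<subseteq> set A \<Longrightarrow>
    runs f_construction [enc_alphabet A, enc e] v \<longleftrightarrow> v = enc_construction (construction_of A e)"
proof (induction e arbitrary: v)
  case (Lin cs)
  show ?case by (subst runs_unfold(33)) (simp add: b_construction_def eval_simps)
next
  case (Plus e f)
  then show ?case
    by (subst runs_unfold(33)) (simp add: b_construction_def eval_simps set_letters_acc[of e "letters f []"])
next
  case (Times e f)
  have "runs f_reduction [enc_alphabet A, Pr (Sym 3) (Pr (enc_construction (construction_of A e))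
      (enc_construction (construction_of A f)))] v \<longleftrightarrow>
    v = enc_construction (reduction A (CTimes (construction_of A e) (construction_of A f)))" for v
    using runs_reduction[OF A bound_ok_times[OF A Times.prems], of v] by simp
  then show ?case
    using Times
    by (subst runs_unfold(33)) (simp add: b_construction_def eval_simps set_letters_acc[of e "letters f []"])
next
  case (Star e)
  have "runs f_reduction [enc_alphabet A, Pr (Sym 4) (enc_construction (construction_of A e))] v \<longleftrightarrow>
    v = enc_construction (reduction A (CStar (construction_of A e)))" for v
    using runs_reduction[OF A bound_ok_star[OF A Star.prems], of v] by simp
  then show ?case
    using Star by (subst runs_unfold(33)) (simp add: b_construction_def eval_simps)
qed

lemma program_correct:
  fixes e :: "('k::field, 'x word) rexp"
  assumes e: "mn_exp (free_group X) r e"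
  shows "computes program (enc e) (enc (normal_expression (remdups (letters e [])) e))"
proof -
  define A where "A = remdups (letters e [])"
  have A: "distinct A" "set (letters e []) \<subseteq> set A" by (simp_all add: A_def)
  have "runs f_letters [enc e, Sym 0] v \<longleftrightarrow> v = enc_alphabet (letters e [])" for v
    using runs_letters[of e "[]" v] by (simp add: enc_alphabet_def)
  moreover have "runs f_remdups [enc_alphabet (letters e [])] v \<longleftrightarrow> v = enc_alphabet A"
    for v :: "('k, 'x) val"
    unfolding enc_alphabet_def A_def by (rule runs_remdups) (simp add: inj_def)
  ultimately have "runs 0 [enc e] (enc (normal_expression A e))"
    using runs_construction[OF A(1) e A(2)]
      runs_reduction[OF A(1) normal_expression_correct(4)[OF e, folded A_def]]
      runs_states[of A "reduction A (construction_of A e)"]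
      runs_accepted[OF A(1), of "states (automaton_of A (reduction A (construction_of A e)))"
        "reduction A (construction_of A e)"]
    by (simp add: runs_unfold(1) b_main_def eval_simps normal_expression_def Let_def)
  then show ?thesis by (simp add: computes_def eval_simps A_def)
qed

end

theorem corollary4p4:
  fixes X :: "'x set" and r :: "'x word rel"
  assumes "finite X"
    and "compatible_order (free_group X) r"
  shows "(\<forall>a :: 'x word \<Rightarrow> 'k::field. mn_rational (free_group X) r a \<longrightarrow>
           (\<exists>e. star_rational_exp (free_group X) e \<and> without_simplification X e \<and>
                value_of (free_group X) e = a)) \<and>
         (\<exists>P :: prog. \<forall>e :: ('k, 'x word) rexp. mn_exp (free_group X) r e \<longrightarrow>
           (\<exists>e'. computes P (enc e) (enc e') \<and>
                 star_rational_exp (free_group X) e' \<and> without_simplification X e' \<and>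
                 value_of (free_group X) e' = value_of (free_group X) e))"
proof -
  interpret ordered_free_group X r by unfold_locales (rule assms(2))
  have "computes program (enc e) (enc (normal_expression (remdups (letters e [])) e)) \<and>
      star_rational_exp (free_group X) (normal_expression (remdups (letters e [])) e) \<and>
      without_simplification X (normal_expression (remdups (letters e [])) e) \<and>
      value_of (free_group X) (normal_expression (remdups (letters e [])) e) = value_of (free_group X) e"
    if "mn_exp (free_group X) r e" for e :: "('k, 'x word) rexp"
    using program_correct[OF that] normal_expression_correct[OF that] by blast
  then show ?thesis unfolding mn_rational_def by blast
qed

end
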